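(* Assume that $m$ is an even positive integer and $n\geq 3$. Let $G=G(m,1,n)$ act on $V=U\oplus U^*$, where $U$ is its natural $n$-dimensional representation with basis $x_1,\ldots,x_n$ and $y_1,\ldots,y_n$ is the dual basis of $U^*$. Put $v_i=x_i$, $v_{n+i}=y_i$ ($1\le i\le n$), and for $i,j\in\{1,\ldots,2n\}$ let $q_{ij}=1$ if $i\equiv j\bmod n$ and $q_{ij}=-1$ otherwise. Let $\mathcal{C}$ be the group of $m$th roots of unity in $\mathbb{C}$. The maps $\kappa:V\times V\to\mathbb{C}G(m,1,n)$ for which $\mathcal{H}_{\mathbf{q},\kappa}$ is a quantum Drinfeld Hecke algebra form an $(m+1)$-dimensional vector space with basis consisting of the following maps, determined by their effect on the pairs $(x_i,x_j)$, $(y_i,y_j)$, $(x_i,y_j)$, $(x_i,y_i)$, $i\neq j$: the $m$ maps, one for each $\varepsilon\in\mathcal{C}$, $$(x_i,x_j)\mapsto 0,\quad (y_i,y_j)\mapsto 0,\quad (x_i,y_j)\mapsto 0,\quad (x_i,y_i)\mapsto t_i^{(\varepsilon)},$$ and the map $$(x_i,x_j)\mapsto 0,\quad (y_i,y_j)\mapsto 0,\quad (x_i,y_j)\mapsto\sum_{\eta\in\mathcal{C}}\eta\,\sigma_{ij}^{(\eta)},\quad (x_i,y_i)\mapsto\sum_{\eta\in\mathcal{C}}\ \sum_{j\neq i}\sigma_{ij}^{(\eta)}.$$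
   Context: $G(m,1,n)$ is the group of $n\times n$ monomial matrices whose nonzero entries are $m$th roots of unity, acting naturally on $U$. The dual action on $U^*$ is determined by ${}^g y_i=\varepsilon^{-1}y_j$ if and only if ${}^g x_i=\varepsilon x_j$. For $\varepsilon\in\mathcal{C}$ and $i\ne j$ in $\{1,\ldots,n\}$, $\sigma_{ij}^{(\varepsilon)}\in G(m,1,n)$ is given by $x_k\mapsto x_k$ for $k\notin\{i,j\}$, $x_i\mapsto\varepsilon x_j$, $x_j\mapsto-\varepsilon^{-1}x_i$ (note $-1\in\mathcal{C}$ since $m$ is even); and $t_i^{(\varepsilon)}\in G(m,1,n)$ is given by $x_k\mapsto x_k$ for $k\ne i$, $x_i\mapsto\varepsilon x_i$. $S_{\mathbf{q}}(V)=\mathbb{C}\langle v_1,\ldots,v_{2n}\mid v_iv_j=q_{ij}v_jv_i\ \forall i,j\rangle$; the action of $G$ on $V$ extends to it by algebra automorphisms. $T(V)$ is the tensor algebra. For an algebra $A$ with an action of $G$ by automorphisms $a\mapsto{}^g a$, the skew group algebra $A\rtimes G$ is the free left $A$-module with basis $G$ and multiplication $(ag)(bh)=a({}^g b)\,gh$. The maps $\kappa:V\times V\to\mathbb{C}G$ under consideration are bilinear and satisfy $\kappa(v_i,v_j)=-q_{ij}\kappa(v_j,v_i)$ for all $i,j\in\{1,\ldots,2n\}$ (so $\kappa(v_i,v_i)=0$, and values on pairs $(y_j,x_i)$ are determined by those on $(x_i,y_j)$). For such $\kappa$, $$\mathcal{H}_{\mathbf{q},\kappa}=T(V)\rtimes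 G\,/\,(v_iv_j-q_{ij}v_jv_i-\kappa(v_i,v_j)\mid 1\le i,j\le 2n),$$ filtered with each $v_i$ in degree $1$ and each $g\in G$ in degree $0$; it is called a quantum Drinfeld Hecke algebra if its associated graded algebra is isomorphic (as a graded algebra) to $S_{\mathbf{q}}(V)\rtimes G$. *)

theory Defs
  imports
    "HOL-Library.Function_Algebras"
    "HOL-Algebra.QuotRing"
    "HOL-Algebra.Module"
    "Jordan_Normal_Form.Matrix"
begin

section \<open>Algebras over the complex numbers\<close>

text \<open>
  A (noncommutative) \<open>\<complex>\<close>-algebra is given by a record of type \<^typ>\<open>(complex, 'a) module\<close>:
  the ring operations together with a scalar multiplication.
\<close>

type_synonym 'a calg = "(complex, 'a) module"

text \<open>A two-sided ring ideal of a unital algebra is a linear subspace, so the library's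
  ideals and quotient rings apply; only the scalar multiplication has to be added.\<close>

definition quot_calg :: "'a calg \<Rightarrow> 'a set \<Rightarrow> 'a set calg" where
  "quot_calg A I =
    \<lparr>carrier = carrier (A Quot I), monoid.mult = monoid.mult (A Quot I), one = one (A Quot I),
     zero = zero (A Quot I), add = add (A Quot I),
     smult = (\<lambda>c X. \<Union>x\<in>X. I +>\<^bsub>A\<^esub> (c \<odot>\<^bsub>A\<^esub> x))\<rparr>"

definition calg_iso :: "'a calg \<Rightarrow> 'b calg \<Rightarrow> ('a \<Rightarrow> 'b) set" where
  "calg_iso A B =
    {\<phi> \<in> ring_iso A B. \<forall>c. \<forall>x\<in>carrier A. \<phi> (c \<odot>\<^bsub>A\<^esub> x) = c \<odot>\<^bsub>B\<^esub> \<phi> x}"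

text \<open>A graded algebra is given by an algebra and the family of its homogeneous components.\<close>

definition graded_isomorphic ::
    "'a calg \<Rightarrow> (nat \<Rightarrow> 'a set) \<Rightarrow> 'b calg \<Rightarrow> (nat \<Rightarrow> 'b set) \<Rightarrow> bool" where
  "graded_isomorphic A Ah B Bh \<longleftrightarrow> (\<exists>\<phi>\<in>calg_iso A B. \<forall>k. \<phi> ` Ah k = Bh k)"

subsection \<open>The free algebra\<close>

text \<open>The free algebra on a set \<open>I\<close>, i.e. the tensor algebra of the vector space with basis \<open>I\<close>:
  finitely supported functions on words, the product being induced by concatenation.\<close>

definition free_calg :: "'i set \<Rightarrow> ('i list \<Rightarrow> complex) calg" where
  "free_calg I =
    \<lparr>carrier = {a. finite {w. a w \<noteq> 0} \<and> {w. a w \<noteq> 0} \<subseteq> lists I},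
     monoid.mult = (\<lambda>a b w. \<Sum>k\<le>length w. a (take k w) * b (drop k w)),
     one = (\<lambda>w. if w = [] then 1 else 0),
     zero = (\<lambda>w. 0),
     add = (\<lambda>a b w. a w + b w),
     smult = (\<lambda>c a w. c * a w)\<rparr>"

definition word_elt :: "'i list \<Rightarrow> 'i list \<Rightarrow> complex" where
  "word_elt u = (\<lambda>w. if w = u then 1 else 0)"

text \<open>The algebra endomorphism of the free algebra on \<open>I\<close> (for finite \<open>I\<close>) that extends the linear
  map \<open>i \<mapsto> \<Sum>j\<in>I. M j i \<cdot> j\<close>, so that a word \<open>i\<^sub>1\<dots>i\<^sub>k\<close> is mapped to
  the sum of \<open>M j\<^sub>1 i\<^sub>1 \<cdots> M j\<^sub>k i\<^sub>k\<close> times \<open>j\<^sub>1\<dots>j\<^sub>k\<close>.\<close>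

definition free_ext :: "'i set \<Rightarrow> ('i \<Rightarrow> 'i \<Rightarrow> complex) \<Rightarrow> ('i list \<Rightarrow> complex) \<Rightarrow> 'i list \<Rightarrow> complex" where
  "free_ext I M a = (\<lambda>w. if w \<in> lists I
     then \<Sum>u\<in>{u \<in> lists I. length u = length w}. (\<Prod>k<length w. M (w ! k) (u ! k)) * a u
     else 0)"

subsection \<open>Skew group algebras\<close>

text \<open>For a finite group \<open>G\<close>. The function \<open>f\<close> stands for \<open>\<Sum>g\<in>G. f g \<cdot> g\<close>; by
  \<open>(a g) (b h) = a ({}\<^sup>g b) g h\<close>, the coefficient of \<open>k\<close> in a product collects the pairs
  \<open>(g, g\<^sup>-\<^sup>1 k)\<close>. Elements vanish outside the carrier of \<open>G\<close>.\<close>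

definition skew_group_calg ::
    "'a calg \<Rightarrow> 'g monoid \<Rightarrow> ('g \<Rightarrow> 'a \<Rightarrow> 'a) \<Rightarrow> ('g \<Rightarrow> 'a) calg" where
  "skew_group_calg A G act =
    \<lparr>carrier = {f. (\<forall>g\<in>carrier G. f g \<in> carrier A) \<and> (\<forall>g. g \<notin> carrier G \<longrightarrow> f g = \<zero>\<^bsub>A\<^esub>)},
     monoid.mult = (\<lambda>f h k. if k \<in> carrier G
       then \<Oplus>\<^bsub>A\<^esub>g\<in>carrier G. f g \<otimes>\<^bsub>A\<^esub> act g (h (inv\<^bsub>G\<^esub> g \<otimes>\<^bsub>G\<^esub> k))
       else \<zero>\<^bsub>A\<^esub>),
     one = (\<lambda>g. if g = \<one>\<^bsub>G\<^esub> then \<one>\<^bsub>A\<^esub> else \<zero>\<^bsub>A\<^esub>),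
     zero = (\<lambda>g. \<zero>\<^bsub>A\<^esub>),
     add = (\<lambda>f h g. f g \<oplus>\<^bsub>A\<^esub> h g),
     smult = (\<lambda>c f g. c \<odot>\<^bsub>A\<^esub> f g)\<rparr>"

subsection \<open>Associated graded algebras\<close>

text \<open>For an exhaustive filtration \<open>F 0 \<subseteq> F 1 \<subseteq> \<dots>\<close> of \<open>A\<close>, with \<open>F (-1) = 0\<close>.\<close>

definition filt_pred :: "'a calg \<Rightarrow> (nat \<Rightarrow> 'a set) \<Rightarrow> nat \<Rightarrow> 'a set" where
  "filt_pred A F k = (case k of 0 \<Rightarrow> {\<zero>\<^bsub>A\<^esub>} | Suc l \<Rightarrow> F l)"

text \<open>An element is a finitely supported family of cosets in \<open>F k / F (k - 1)\<close>, and
  the component of degree \<open>k\<close> of a product is the class of \<open>\<Sum>j\<le>k. x\<^sub>j y\<^sub>k\<^sub>-\<^sub>j\<close>, where \<open>x\<^sub>j\<close> and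
  \<open>y\<^sub>j\<close> are representatives of the components of the factors.\<close>

definition assoc_graded :: "'a calg \<Rightarrow> (nat \<Rightarrow> 'a set) \<Rightarrow> (nat \<Rightarrow> 'a set) calg" where
  "assoc_graded A F =
    \<lparr>carrier = {a. (\<forall>k. \<exists>x\<in>F k. a k = filt_pred A F k +>\<^bsub>A\<^esub> x) \<and> finite {k. a k \<noteq> filt_pred A F k}},
     monoid.mult = (\<lambda>a b k. \<Union>{filt_pred A F k +>\<^bsub>A\<^esub> (\<Oplus>\<^bsub>A\<^esub>j\<in>{..k}. x j \<otimes>\<^bsub>A\<^esub> y (k - j)) | x y.
       \<forall>j\<le>k. x j \<in> a j \<and> y j \<in> b j}),
     one = (\<lambda>k. if k = 0 then filt_pred A F k +>\<^bsub>A\<^esub> \<one>\<^bsub>A\<^esub> else filt_pred A F k),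
     zero = filt_pred A F,
     add = (\<lambda>a b k. a k <+>\<^bsub>A\<^esub> b k),
     smult = (\<lambda>c a k. \<Union>x\<in>a k. filt_pred A F k +>\<^bsub>A\<^esub> (c \<odot>\<^bsub>A\<^esub> x))\<rparr>"

definition assoc_graded_comp :: "'a calg \<Rightarrow> (nat \<Rightarrow> 'a set) \<Rightarrow> nat \<Rightarrow> (nat \<Rightarrow> 'a set) set" where
  "assoc_graded_comp A F k =
    {a \<in> carrier (assoc_graded A F). \<forall>j. j \<noteq> k \<longrightarrow> a j = filt_pred A F j}"

section \<open>The group \<open>G(m,1,n)\<close> and its action on \<open>V\<close>\<close>

definition roots_unity :: "nat \<Rightarrow> complex set" where
  "roots_unity m = {z. z ^ m = 1}"

definition Gm1n :: "nat \<Rightarrow> nat \<Rightarrow> complex mat monoid" where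
  "Gm1n m n =
    \<lparr>carrier = {A \<in> carrier_mat n n.
       (\<forall>r<n. \<exists>!c. c < n \<and> A $$ (r, c) \<noteq> 0) \<and>
       (\<forall>c<n. \<exists>!r. r < n \<and> A $$ (r, c) \<noteq> 0) \<and>
       (\<forall>r<n. \<forall>c<n. A $$ (r, c) \<noteq> 0 \<longrightarrow> A $$ (r, c) \<in> roots_unity m)},
     monoid.mult = (*), one = 1\<^sub>m n\<rparr>"

text \<open>
  All indices start at \<open>0\<close>. The basis of \<open>V = U \<oplus> U*\<close> is indexed by \<open>{..<2 * n}\<close>: for \<open>i < n\<close>, the
  index \<open>i\<close> stands for \<open>x\<^sub>i\<close> and \<open>n + i\<close> for \<open>y\<^sub>i\<close>. The \<open>(j, i)\<close> entry of the matrix of \<open>g\<close> on \<open>V\<close> is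
  the coefficient of \<open>v\<^sub>j\<close> in \<open>{}\<^sup>g v\<^sub>i\<close>. As \<open>{}\<^sup>g x\<^sub>i = \<epsilon> x\<^sub>j\<close> iff \<open>{}\<^sup>g y\<^sub>i = \<epsilon>\<^sup>-\<^sup>1 y\<^sub>j\<close>, the
  block of \<open>U*\<close> arises by inverting the nonzero entries of \<open>g\<close> (recall \<open>inverse 0 = 0\<close>).
\<close>

definition V_mat :: "nat \<Rightarrow> complex mat \<Rightarrow> nat \<Rightarrow> nat \<Rightarrow> complex" where
  "V_mat n g j i =
    (if i < n \<and> j < n then g $$ (j, i)
     else if n \<le> i \<and> i < 2 * n \<and> n \<le> j \<and> j < 2 * n then inverse (g $$ (j - n, i - n))
     else 0)"

definition qpar :: "nat \<Rightarrow> nat \<Rightarrow> nat \<Rightarrow> complex" where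
  "qpar n i j = (if i mod n = j mod n then 1 else -1)"

definition TV :: "nat \<Rightarrow> (nat list \<Rightarrow> complex) calg" where
  "TV n = free_calg {..<2 * n}"

definition TV_act :: "nat \<Rightarrow> complex mat \<Rightarrow> (nat list \<Rightarrow> complex) \<Rightarrow> nat list \<Rightarrow> complex" where
  "TV_act n g = free_ext {..<2 * n} (V_mat n g)"

section \<open>The quantum symmetric algebra and its skew group algebra\<close>

definition Sq_ideal :: "nat \<Rightarrow> (nat list \<Rightarrow> complex) set" where
  "Sq_ideal n = genideal (TV n)
    {(\<lambda>w. word_elt [i, j] w - qpar n i j * word_elt [j, i] w) | i j. i < 2 * n \<and> j < 2 * n}"

definition Sq :: "nat \<Rightarrow> (nat list \<Rightarrow> complex) set calg" where
  "Sq n = quot_calg (TV n) (Sq_ideal n)"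

text \<open>The action of \<open>g\<close> on a coset of the (invariant) ideal is by taking the image.\<close>

definition Sq_act ::
    "nat \<Rightarrow> complex mat \<Rightarrow> (nat list \<Rightarrow> complex) set \<Rightarrow> (nat list \<Rightarrow> complex) set" where
  "Sq_act n g X = TV_act n g ` X"

definition Sq_smash :: "nat \<Rightarrow> nat \<Rightarrow> (complex mat \<Rightarrow> (nat list \<Rightarrow> complex) set) calg" where
  "Sq_smash m n = skew_group_calg (Sq n) (Gm1n m n) (Sq_act n)"

definition Sq_smash_comp :: "nat \<Rightarrow> nat \<Rightarrow> nat \<Rightarrow> (complex mat \<Rightarrow> (nat list \<Rightarrow> complex) set) set" where
  "Sq_smash_comp m n k = {f \<in> carrier (Sq_smash m n). \<forall>g\<in>carrier (Gm1n m n).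
     \<exists>a\<in>carrier (TV n). (\<forall>w. a w \<noteq> 0 \<longrightarrow> length w = k) \<and> f g = Sq_ideal n +>\<^bsub>TV n\<^esub> a}"

section \<open>The maps \<open>\<kappa>\<close>\<close>

text \<open>\<open>V\<close> is \<^term>\<open>carrier_vec (2 * n) :: complex vec set\<close>. The elements of the group algebra
  \<open>\<complex>G\<close> are the functions \<^typ>\<open>complex mat \<Rightarrow> complex\<close> that vanish outside \<open>G\<close>. A map
  \<open>V \<times> V \<rightarrow> \<complex>G\<close> is extended by \<open>0\<close> outside \<open>V \<times> V\<close>.\<close>

type_synonym kmap = "complex vec \<Rightarrow> complex vec \<Rightarrow> complex mat \<Rightarrow> complex"

abbreviation Vsp :: "nat \<Rightarrow> complex vec set" where
  "Vsp n \<equiv> carrier_vec (2 * n)"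

abbreviation vb :: "nat \<Rightarrow> nat \<Rightarrow> complex vec" where
  "vb n i \<equiv> unit_vec (2 * n) i"

definition bilinear_maps :: "nat \<Rightarrow> nat \<Rightarrow> kmap set" where
  "bilinear_maps m n = {\<kappa>.
     (\<forall>u\<in>Vsp n. \<forall>u'\<in>Vsp n. \<forall>w\<in>Vsp n. \<kappa> (u + u') w = \<kappa> u w + \<kappa> u' w) \<and>
     (\<forall>u\<in>Vsp n. \<forall>w\<in>Vsp n. \<forall>w'\<in>Vsp n. \<kappa> u (w + w') = \<kappa> u w + \<kappa> u w') \<and>
     (\<forall>c. \<forall>u\<in>Vsp n. \<forall>w\<in>Vsp n. \<kappa> (c \<cdot>\<^sub>v u) w = (\<lambda>g. c * \<kappa> u w g)) \<and>
     (\<forall>c. \<forall>u\<in>Vsp n. \<forall>w\<in>Vsp n. \<kappa> u (c \<cdot>\<^sub>v w) = (\<lambda>g. c * \<kappa> u w g)) \<and>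
     (\<forall>u w g. g \<notin> carrier (Gm1n m n) \<longrightarrow> \<kappa> u w g = 0) \<and>
     (\<forall>u w. u \<notin> Vsp n \<or> w \<notin> Vsp n \<longrightarrow> \<kappa> u w = 0)}"

definition q_skew_maps :: "nat \<Rightarrow> nat \<Rightarrow> kmap set" where
  "q_skew_maps m n = {\<kappa> \<in> bilinear_maps m n.
     \<forall>i<2 * n. \<forall>j<2 * n. \<kappa> (vb n i) (vb n j) = (\<lambda>g. - qpar n i j * \<kappa> (vb n j) (vb n i) g)}"

definition kscale :: "complex \<Rightarrow> kmap \<Rightarrow> kmap" where
  "kscale c \<kappa> = (\<lambda>u w g. c * \<kappa> u w g)"

interpretation kvs: vector_space kscale
  by unfold_locales (auto simp: kscale_def fun_eq_iff algebra_simps)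

section \<open>Quantum Drinfeld Hecke algebras\<close>

definition TV_smash :: "nat \<Rightarrow> nat \<Rightarrow> (complex mat \<Rightarrow> nat list \<Rightarrow> complex) calg" where
  "TV_smash m n = skew_group_calg (TV n) (Gm1n m n) (TV_act n)"

definition Hqk_ideal :: "nat \<Rightarrow> nat \<Rightarrow> kmap \<Rightarrow> (complex mat \<Rightarrow> nat list \<Rightarrow> complex) set" where
  "Hqk_ideal m n \<kappa> = genideal (TV_smash m n)
    {(\<lambda>g w. (if g = \<one>\<^bsub>Gm1n m n\<^esub> then word_elt [i, j] w - qpar n i j * word_elt [j, i] w else 0)
        - \<kappa> (vb n i) (vb n j) g * word_elt [] w) | i j. i < 2 * n \<and> j < 2 * n}"

definition Hqk :: "nat \<Rightarrow> nat \<Rightarrow> kmap \<Rightarrow> (complex mat \<Rightarrow> nat list \<Rightarrow> complex) set calg" where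
  "Hqk m n \<kappa> = quot_calg (TV_smash m n) (Hqk_ideal m n \<kappa>)"

definition Hqk_filt ::
    "nat \<Rightarrow> nat \<Rightarrow> kmap \<Rightarrow> nat \<Rightarrow> (complex mat \<Rightarrow> nat list \<Rightarrow> complex) set set" where
  "Hqk_filt m n \<kappa> k = {Hqk_ideal m n \<kappa> +>\<^bsub>TV_smash m n\<^esub> f | f.
     f \<in> carrier (TV_smash m n) \<and> (\<forall>g w. f g w \<noteq> 0 \<longrightarrow> length w \<le> k)}"

definition quantum_Drinfeld_Hecke :: "nat \<Rightarrow> nat \<Rightarrow> kmap \<Rightarrow> bool" where
  "quantum_Drinfeld_Hecke m n \<kappa> \<longleftrightarrow>
    graded_isomorphic
      (assoc_graded (Hqk m n \<kappa>) (Hqk_filt m n \<kappa>)) (assoc_graded_comp (Hqk m n \<kappa>) (Hqk_filt m n \<kappa>))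
      (Sq_smash m n) (Sq_smash_comp m n)"

definition QDH_maps :: "nat \<Rightarrow> nat \<Rightarrow> kmap set" where
  "QDH_maps m n = {\<kappa> \<in> q_skew_maps m n. quantum_Drinfeld_Hecke m n \<kappa>}"

section \<open>The basis maps\<close>

definition grp_elt :: "complex mat \<Rightarrow> complex mat \<Rightarrow> complex" where
  "grp_elt g = (\<lambda>h. if h = g then 1 else 0)"

definition sigma_mat :: "nat \<Rightarrow> nat \<Rightarrow> nat \<Rightarrow> complex \<Rightarrow> complex mat" where
  "sigma_mat n i j \<epsilon> = mat n n (\<lambda>(r, c).
     if c = i then (if r = j then \<epsilon> else 0)
     else if c = j then (if r = i then - inverse \<epsilon> else 0)
     else (if r = c then 1 else 0))"

definition t_mat :: "nat \<Rightarrow> nat \<Rightarrow> complex \<Rightarrow> complex mat" where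
  "t_mat n i \<epsilon> = mat n n (\<lambda>(r, c). if r = c then (if c = i then \<epsilon> else 1) else 0)"

text \<open>The bilinear map \<open>\<kappa>\<close> with \<open>\<kappa>(v\<^sub>i, v\<^sub>j) = - q\<^sub>i\<^sub>j \<kappa>(v\<^sub>j, v\<^sub>i)\<close> that vanishes on the pairs
  \<open>(x\<^sub>i, x\<^sub>j)\<close> and \<open>(y\<^sub>i, y\<^sub>j)\<close> and has the value \<open>c i j\<close> on \<open>(x\<^sub>i, y\<^sub>j)\<close>, first on the basis and
  then on \<open>V\<close>.\<close>

definition xy_table ::
    "nat \<Rightarrow> (nat \<Rightarrow> nat \<Rightarrow> complex mat \<Rightarrow> complex) \<Rightarrow> nat \<Rightarrow> nat \<Rightarrow> complex mat \<Rightarrow> complex" where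
  "xy_table n c i j =
    (if i < n \<and> n \<le> j then c i (j - n)
     else if n \<le> i \<and> j < n then (\<lambda>g. - qpar n i j * c j (i - n) g)
     else 0)"

definition xy_map :: "nat \<Rightarrow> (nat \<Rightarrow> nat \<Rightarrow> complex mat \<Rightarrow> complex) \<Rightarrow> kmap" where
  "xy_map n c u w =
    (if u \<in> Vsp n \<and> w \<in> Vsp n
     then (\<lambda>g. \<Sum>i<2 * n. \<Sum>j<2 * n. u $ i * w $ j * xy_table n c i j g)
     else 0)"

definition kappa_t :: "nat \<Rightarrow> complex \<Rightarrow> kmap" where
  "kappa_t n \<epsilon> = xy_map n (\<lambda>i j. if i = j then grp_elt (t_mat n i \<epsilon>) else 0)"

definition kappa_sigma :: "nat \<Rightarrow> nat \<Rightarrow> kmap" where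
  "kappa_sigma m n = xy_map n (\<lambda>i j.
     if i = j then \<Sum>\<eta>\<in>roots_unity m. \<Sum>k\<in>{..<n} - {i}. grp_elt (sigma_mat n i k \<eta>)
     else \<Sum>\<eta>\<in>roots_unity m. (\<lambda>g. \<eta> * grp_elt (sigma_mat n i j \<eta>) g))"

definition basis_maps :: "nat \<Rightarrow> nat \<Rightarrow> kmap set" where
  "basis_maps m n = insert (kappa_sigma m n) (kappa_t n ` roots_unity m)"

end

theory Submission
  imports Defs "HOL-Combinatorics.Transposition"
begin

text \<open>
  \<open>G\<close> permutes the basis \<open>v\<^sub>1, \<dots>, v\<^sub>2\<^sub>n\<close> up to scalars and preserves the \<open>q\<^sub>i\<^sub>j\<close>, and words times
  group elements form a basis of \<open>T(V) \<rtimes> G\<close>. A prescription of values on the sorted words extends to a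
  functional \<open>L\<close> on \<open>T(V) \<rtimes> G\<close> by rewriting \<open>v\<^sub>i v\<^sub>j\<close> into \<open>q\<^sub>i\<^sub>j v\<^sub>j v\<^sub>i + \<kappa>(v\<^sub>i, v\<^sub>j)\<close>. By the diamond lemma, \<open>L\<close>
  vanishes on the defining ideal of \<open>H\<close> if \<open>\<kappa>\<close> is \<open>G\<close>-equivariant and satisfies a quantum Jacobi
  identity. Both \<open>gr H\<close> and \<open>S\<^sub>q(V) \<rtimes> G\<close> are graded quotients of \<open>T(V) \<rtimes> G\<close>, and the functionals \<open>L\<close> show
  that the two kernels agree. Conversely, a graded isomorphism makes the components of degree \<open>0\<close> and
  \<open>1\<close> of \<open>gr H\<close>, which are finite-dimensional, as large as those of \<open>T(V) \<rtimes> G\<close>, so that the defining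
  ideal has no nonzero elements concentrated in these degrees; conjugating the
  relations by \<open>G\<close> and comparing the two ways of reordering \<open>v\<^sub>i v\<^sub>j v\<^sub>k\<close> then yields the two conditions.

  For \<open>G(m,1,n)\<close> the Jacobi identity says that an element \<open>g\<close> in the support of \<open>\<kappa>(v\<^sub>j, v\<^sub>k)\<close> moves \<open>v\<^sub>i\<close>,
  \<open>i \<noteq> j, k\<close>, only into the lines of \<open>v\<^sub>j\<close> and \<open>v\<^sub>k\<close>, and it prescribes the scalar if \<open>g\<close> fixes that line.
  Together with equivariance under \<open>t\<^sub>i\<^bsup>(-1)\<^esup>\<close> this leaves only the \<open>t\<^sub>i\<^bsup>(\<epsilon>)\<^esup>\<close> and \<open>\<sigma>\<^sub>i\<^sub>j\<^bsup>(\<eta>)\<^esup>\<close>. As the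
  \<open>\<sigma>\<^sub>i\<^sub>j\<^bsup>(\<eta>)\<^esup>\<close> are all conjugate, as are the \<open>t\<^sub>i\<^bsup>(\<epsilon>)\<^esup>\<close> for fixed \<open>\<epsilon>\<close>, one coefficient remains for each \<open>\<epsilon>\<close>
  and one for all the \<open>\<sigma>\<^sub>i\<^sub>j\<^bsup>(\<eta>)\<^esup>\<close>.
\<close>

section \<open>The free algebra\<close>

text \<open>The isomorphism in the definition of a quantum Drinfeld Hecke algebra is an arbitrary
  graded one and need not send the class of v_i to v_i. The canonical comparison is therefore
  recovered from a dimension count, made only in degrees 0 and 1: the relations of S_q(V) start in
  degree 2, and the defects of equivariance and of the Jacobi identity lie in exactly these two
  degrees. In the other direction functionals replace normal forms, so that only scalars have to be
  shown independent of the chosen descent. Overlapping descents need the Jacobi identity. Disjoint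
  ones need equivariance, because a group element produced at the left pair has to be moved across
  the right pair. The sign in \<open>sigma_mat\<close> is forced: if g exchanges the lines of x_a
  and x_d and occurs in \<kappa>(x_a, y_a), the Jacobi identity for x_d, x_a, y_a gives two linear
  equations that are compatible only if the two scalars of g have product -1. Evenness of m enters
  twice: t_a^(-1) lies in G, and -1/\<eta> is a root of unity along with \<eta>.\<close>

lemma ring_transfer:
  assumes "ring A" "carrier B = carrier A" "monoid.mult B = monoid.mult A" "one B = one A"
    "zero B = zero A" "add B = add A"
  shows "ring B"
proof -
  interpret A: ring A by fact
  show ?thesis
  proof (intro ringI abelian_groupI monoidI)
    fix x assume "x \<in> carrier B"
    then show "\<exists>y\<in>carrier B. y \<oplus>\<^bsub>B\<^esub> x = \<zero>\<^bsub>B\<^esub>"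
      using assms A.add.l_inv_ex by simp
  qed (auto simp: assms A.a_ac A.m_assoc A.l_distr A.r_distr)
qed

lemma free_calg_simps [simp]:
  "\<one>\<^bsub>free_calg I\<^esub> = word_elt []"
  "\<zero>\<^bsub>free_calg I\<^esub> = 0"
  "a \<oplus>\<^bsub>free_calg I\<^esub> b = a + b"
  "s \<odot>\<^bsub>free_calg I\<^esub> a = (\<lambda>w. s * a w)"
  by (auto simp: free_calg_def word_elt_def fun_eq_iff)

lemma free_calg_carrier:
  "a \<in> carrier (free_calg I) \<longleftrightarrow> finite {w. a w \<noteq> 0} \<and> (\<forall>w. a w \<noteq> 0 \<longrightarrow> w \<in> lists I)"
  by (auto simp: free_calg_def)

lemma free_calg_mult:
  "(a \<otimes>\<^bsub>free_calg I\<^esub> b) w = (\<Sum>k\<le>length w. a (take k w) * b (drop k w))"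
  by (simp add: free_calg_def)

lemma word_elt_carrier [simp]: "u \<in> lists I \<Longrightarrow> word_elt u \<in> carrier (free_calg I)"
  by (auto simp: free_calg_carrier word_elt_def)

lemma word_elt_mult: "word_elt u \<otimes>\<^bsub>free_calg I\<^esub> word_elt v = word_elt (u @ v)"
proof
  fix w
  have "(\<Sum>k\<le>length w. word_elt u (take k w) * word_elt v (drop k w))
    = (\<Sum>k\<le>length w. if k = length u then (if w = u @ v then 1 else 0) else 0)"
  proof (rule sum.cong)
    fix k assume "k \<in> {..length w}"
    then have eq: "take k w = u \<and> drop k w = v \<longleftrightarrow> k = length u \<and> w = u @ v"
      by (metis append_eq_conv_conj append_take_drop_id atMost_iff length_take min.absorb2)
    have "word_elt u (take k w) * word_elt v (drop k w)
        = (if take k w = u \<and> drop k w = v then 1 else 0)"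
      by (simp add: word_elt_def)
    then show "word_elt u (take k w) * word_elt v (drop k w)
        = (if k = length u then (if w = u @ v then 1 else 0) else 0)"
      unfolding eq by (rule trans) auto
  qed simp
  then show "(word_elt u \<otimes>\<^bsub>free_calg I\<^esub> word_elt v) w = word_elt (u @ v) w"
    by (simp add: free_calg_mult word_elt_def)
qed

text \<open>Behind associativity of the word product: the left bracketing chooses the second cut
  first and then the first cut before it, the right bracketing chooses the first cut and then the
  distance to the second.\<close>

lemma nested_sum_shift:
  fixes F :: "nat \<Rightarrow> nat \<Rightarrow> 'a::comm_monoid_add"
  shows "(\<Sum>k\<le>n. \<Sum>j\<le>k. F j (k - j)) = (\<Sum>j\<le>n. \<Sum>k\<le>n - j. F j k)"
proof -
  have "(\<Sum>k\<le>n. \<Sum>j\<le>k. F j (k - j)) = (\<Sum>x\<in>Sigma {..n} (\<lambda>k. {..k}). F (snd x) (fst x - snd x))"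
    by (subst sum.Sigma) (auto simp: case_prod_unfold)
  also have "\<dots> = (\<Sum>x\<in>Sigma {..n} (\<lambda>j. {..n - j}). F (fst x) (snd x))"
    by (rule sum.reindex_bij_witness[of _ "\<lambda>x. (fst x + snd x, fst x)" "\<lambda>x. (snd x, fst x - snd x)"]) auto
  also have "\<dots> = (\<Sum>j\<le>n. \<Sum>k\<le>n - j. F j k)"
    by (subst sum.Sigma) (auto simp: case_prod_unfold)
  finally show ?thesis .
qed

lemma free_calg_ring: "ring (free_calg I)"
proof (intro ringI abelian_groupI monoidI)
  fix a b assume a: "a \<in> carrier (free_calg I)" and b: "b \<in> carrier (free_calg I)"
  have sub: "{w. (a \<otimes>\<^bsub>free_calg I\<^esub> b) w \<noteq> 0} \<subseteq> (\<lambda>(u, v). u @ v) ` ({w. a w \<noteq> 0} \<times> {w. b w \<noteq> 0})"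
  proof
    fix w assume "w \<in> {w. (a \<otimes>\<^bsub>free_calg I\<^esub> b) w \<noteq> 0}"
    then have "(\<Sum>k\<le>length w. a (take k w) * b (drop k w)) \<noteq> 0"
      by (simp add: free_calg_mult)
    then obtain k where "a (take k w) * b (drop k w) \<noteq> 0"
      by (rule sum.not_neutral_contains_not_neutral)
    then show "w \<in> (\<lambda>(u, v). u @ v) ` ({w. a w \<noteq> 0} \<times> {w. b w \<noteq> 0})"
      by (intro image_eqI[of _ _ "(take k w, drop k w)"]) auto
  qed
  show "a \<otimes>\<^bsub>free_calg I\<^esub> b \<in> carrier (free_calg I)"
    unfolding free_calg_carrier
  proof (intro conjI allI impI)
    show "finite {w. (a \<otimes>\<^bsub>free_calg I\<^esub> b) w \<noteq> 0}"
      using a b by (intro finite_subset[OF sub]) (auto simp: free_calg_carrier)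
  next
    fix w assume "(a \<otimes>\<^bsub>free_calg I\<^esub> b) w \<noteq> 0"
    then have "w \<in> (\<lambda>(u, v). u @ v) ` ({w. a w \<noteq> 0} \<times> {w. b w \<noteq> 0})"
      using sub by blast
    then obtain u v where uv: "w = u @ v" "a u \<noteq> 0" "b v \<noteq> 0" by auto
    with a b have "u \<in> lists I" "v \<in> lists I" unfolding free_calg_carrier by blast+
    with uv show "w \<in> lists I" by simp
  qed
  show "a \<oplus>\<^bsub>free_calg I\<^esub> b \<in> carrier (free_calg I)"
    unfolding free_calg_carrier
  proof (intro conjI allI impI)
    have "{w. (a + b) w \<noteq> 0} \<subseteq> {w. a w \<noteq> 0} \<union> {w. b w \<noteq> 0}" by auto
    with a b show "finite {w. (a \<oplus>\<^bsub>free_calg I\<^esub> b) w \<noteq> 0}"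
      by (simp add: free_calg_carrier finite_subset)
  next
    fix w assume "(a \<oplus>\<^bsub>free_calg I\<^esub> b) w \<noteq> 0"
    then have "a w \<noteq> 0 \<or> b w \<noteq> 0" by auto
    with a b show "w \<in> lists I" unfolding free_calg_carrier by blast
  qed
  show "a \<oplus>\<^bsub>free_calg I\<^esub> b = b \<oplus>\<^bsub>free_calg I\<^esub> a" by (simp add: add.commute)
  show "\<exists>y\<in>carrier (free_calg I). y \<oplus>\<^bsub>free_calg I\<^esub> a = \<zero>\<^bsub>free_calg I\<^esub>"
    using a by (intro bexI[of _ "-a"]) (auto simp: free_calg_carrier)
  show "\<one>\<^bsub>free_calg I\<^esub> \<otimes>\<^bsub>free_calg I\<^esub> a = a"
  proof
    fix w
    have "(\<Sum>k\<le>length w. word_elt [] (take k w) * a (drop k w)) = (\<Sum>k\<le>length w. if k = 0 then a w else 0)"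
      by (intro sum.cong) (auto simp: word_elt_def)
    then show "(\<one>\<^bsub>free_calg I\<^esub> \<otimes>\<^bsub>free_calg I\<^esub> a) w = a w"
      by (simp add: free_calg_mult)
  qed
  show "a \<otimes>\<^bsub>free_calg I\<^esub> \<one>\<^bsub>free_calg I\<^esub> = a"
  proof
    fix w
    have "(\<Sum>k\<le>length w. a (take k w) * word_elt [] (drop k w)) = (\<Sum>k\<le>length w. if k = length w then a w else 0)"
      by (intro sum.cong) (auto simp: word_elt_def)
    then show "(a \<otimes>\<^bsub>free_calg I\<^esub> \<one>\<^bsub>free_calg I\<^esub>) w = a w"
      by (simp add: free_calg_mult)
  qed
  fix d assume d: "d \<in> carrier (free_calg I)"
  show "a \<oplus>\<^bsub>free_calg I\<^esub> b \<oplus>\<^bsub>free_calg I\<^esub> d = a \<oplus>\<^bsub>free_calg I\<^esub> (b \<oplus>\<^bsub>free_calg I\<^esub> d)"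
    by (simp add: add.assoc)
  show "(a \<oplus>\<^bsub>free_calg I\<^esub> b) \<otimes>\<^bsub>free_calg I\<^esub> d = a \<otimes>\<^bsub>free_calg I\<^esub> d \<oplus>\<^bsub>free_calg I\<^esub> b \<otimes>\<^bsub>free_calg I\<^esub> d"
    by (auto simp: fun_eq_iff free_calg_mult algebra_simps sum.distrib)
  show "d \<otimes>\<^bsub>free_calg I\<^esub> (a \<oplus>\<^bsub>free_calg I\<^esub> b) = d \<otimes>\<^bsub>free_calg I\<^esub> a \<oplus>\<^bsub>free_calg I\<^esub> d \<otimes>\<^bsub>free_calg I\<^esub> b"
    by (auto simp: fun_eq_iff free_calg_mult algebra_simps sum.distrib)
  show "a \<otimes>\<^bsub>free_calg I\<^esub> b \<otimes>\<^bsub>free_calg I\<^esub> d = a \<otimes>\<^bsub>free_calg I\<^esub> (b \<otimes>\<^bsub>free_calg I\<^esub> d)"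
  proof
    fix w
    let ?F = "\<lambda>j k. a (take j w) * b (take k (drop j w)) * d (drop (j + k) w)"
    have "(a \<otimes>\<^bsub>free_calg I\<^esub> b \<otimes>\<^bsub>free_calg I\<^esub> d) w = (\<Sum>k\<le>length w. \<Sum>j\<le>k. ?F j (k - j))"
      unfolding free_calg_mult
    proof (rule sum.cong)
      fix k assume "k \<in> {..length w}"
      then have k: "k \<le> length w" by simp
      have "(\<Sum>j\<le>length (take k w). a (take j (take k w)) * b (drop j (take k w))) * d (drop k w)
         = (\<Sum>j\<le>k. (a (take j (take k w)) * b (drop j (take k w))) * d (drop k w))"
        using k by (simp add: sum_distrib_right min_def)
      also have "\<dots> = (\<Sum>j\<le>k. ?F j (k - j))"
        by (intro sum.cong) (auto simp: drop_take min_def)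
      finally show "(\<Sum>j\<le>length (take k w). a (take j (take k w)) * b (drop j (take k w))) * d (drop k w)
         = (\<Sum>j\<le>k. ?F j (k - j))" .
    qed simp
    also have "\<dots> = (\<Sum>j\<le>length w. \<Sum>k\<le>length w - j. ?F j k)"
      by (rule nested_sum_shift)
    also have "\<dots> = (a \<otimes>\<^bsub>free_calg I\<^esub> (b \<otimes>\<^bsub>free_calg I\<^esub> d)) w"
      unfolding free_calg_mult
      by (intro sum.cong) (auto simp: sum_distrib_left mult.assoc add.commute)
    finally show "(a \<otimes>\<^bsub>free_calg I\<^esub> b \<otimes>\<^bsub>free_calg I\<^esub> d) w
        = (a \<otimes>\<^bsub>free_calg I\<^esub> (b \<otimes>\<^bsub>free_calg I\<^esub> d)) w" .
  qed
qed (auto simp: free_calg_carrier word_elt_def)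

lemma free_calg_smult_closed:
  "a \<in> carrier (free_calg I) \<Longrightarrow> (\<lambda>w. s * a w) \<in> carrier (free_calg I)"
  unfolding free_calg_carrier by (auto intro: finite_subset[of _ "{w. a w \<noteq> 0}"])

lemma free_calg_smult_mult:
  "(\<lambda>w. s * a w) \<otimes>\<^bsub>free_calg I\<^esub> b = (\<lambda>w. s * (a \<otimes>\<^bsub>free_calg I\<^esub> b) w)"
  "a \<otimes>\<^bsub>free_calg I\<^esub> (\<lambda>w. s * b w) = (\<lambda>w. s * (a \<otimes>\<^bsub>free_calg I\<^esub> b) w)"
  by (auto simp: fun_eq_iff free_calg_mult sum_distrib_left algebra_simps)

lemma free_calg_finsum:
  assumes "finite S" "\<And>x. x \<in> S \<Longrightarrow> f x \<in> carrier (free_calg I)"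
  shows "finsum (free_calg I) f S = (\<Sum>x\<in>S. f x)"
proof -
  interpret ring "free_calg I" by (rule free_calg_ring)
  show ?thesis using assms by (induction S rule: finite_induct) auto
qed

lemma free_calg_neg: "a \<in> carrier (free_calg I) \<Longrightarrow> \<ominus>\<^bsub>free_calg I\<^esub> a = - a"
proof -
  interpret ring "free_calg I" by (rule free_calg_ring)
  assume a: "a \<in> carrier (free_calg I)"
  moreover have "- a \<in> carrier (free_calg I)" using a by (auto simp: free_calg_carrier)
  ultimately show ?thesis by (intro minus_equality) auto
qed

text \<open>Terms are added one at a time along a finite set containing the support. Identities that
  are linear in an argument thereby reduce to words.\<close>

lemma free_calg_induct [consumes 1, case_names zero add]:
  assumes a: "a \<in> carrier (free_calg I)" and zero: "P 0"
    and add: "\<And>a u s. a \<in> carrier (free_calg I) \<Longrightarrow> u \<in> lists I \<Longrightarrow> P a \<Longrightarrow> P (a + (\<lambda>w. s * word_elt u w))"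
  shows "P a"
proof -
  have "\<forall>a \<in> carrier (free_calg I). {w. a w \<noteq> 0} \<subseteq> S \<longrightarrow> P a" if "finite S" for S
    using that
  proof (induction S rule: finite_induct)
    case empty
    have "a = 0" if "{w. a w \<noteq> 0} \<subseteq> {}" for a :: "'a list \<Rightarrow> complex" using that by auto
    then show ?case using zero by blast
  next
    case (insert u S)
    show ?case
    proof (intro ballI impI)
      fix a assume a: "a \<in> carrier (free_calg I)" and sub: "{w. a w \<noteq> 0} \<subseteq> insert u S"
      show "P a"
      proof (cases "a u = 0")
        case True then show ?thesis using insert.IH a sub by auto
      next
        case False
        let ?b = "a(u := 0)"
        have "?b \<in> carrier (free_calg I)" using a unfolding free_calg_carrier
          by (auto intro: finite_subset[of _ "{w. a w \<noteq> 0}"])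
        moreover have "{w. ?b w \<noteq> 0} \<subseteq> S" using sub by auto
        moreover have "u \<in> lists I" using a False unfolding free_calg_carrier by blast
        moreover have "a = ?b + (\<lambda>w. a u * word_elt u w)" by (simp add: word_elt_def fun_eq_iff)
        ultimately show ?thesis using insert.IH add[of ?b u "a u"] by metis
      qed
    qed
  qed
  then show ?thesis using a free_calg_carrier by blast
qed

section \<open>Skew group algebras of monomial actions\<close>

text \<open>Scalar multiplication on all functions, without reference to a carrier, so that it can
  later be interpreted as a vector space.\<close>

definition sc :: "complex \<Rightarrow> ('g \<Rightarrow> 'w \<Rightarrow> complex) \<Rightarrow> 'g \<Rightarrow> 'w \<Rightarrow> complex" where
  "sc s f = (\<lambda>g w. s * f g w)"

lemma sc_simps: "sc s (sc t f) = sc (s * t) f" "sc 0 f = 0" "sc 1 f = f" "sc s 0 = 0"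
  by (auto simp: sc_def fun_eq_iff)

lemma uminus_eq_sc: "- f = sc (- 1) f"
  by (auto simp: sc_def fun_eq_iff)

lemma sum_fun_apply: "(\<Sum>x\<in>S. f x) y = (\<Sum>x\<in>S. f x y)" for f :: "'b \<Rightarrow> 'c \<Rightarrow> 'd::comm_monoid_add"
  by (induction S rule: infinite_finite_induct) auto

lemma sc_sum: "sc s (\<Sum>x\<in>S. f x) = (\<Sum>x\<in>S. sc s (f x))"
  by (induction S rule: infinite_finite_induct) (auto simp: sc_def fun_eq_iff algebra_simps)

text \<open>The ring theory uses only that each group element permutes N letters up to scalars: g
  sends v_i to c g i times the letter p g i, and \<open>c_mult\<close> is the resulting cocycle
  identity. The matrix V is carried along because \<open>free_ext\<close> is defined through
  it.\<close>

locale monomial_action =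
  fixes G :: "'g monoid" and N :: nat and p :: "'g \<Rightarrow> nat \<Rightarrow> nat" and c :: "'g \<Rightarrow> nat \<Rightarrow> complex"
    and V :: "'g \<Rightarrow> nat \<Rightarrow> nat \<Rightarrow> complex"
  assumes grp: "group G" and finG: "finite (carrier G)"
    and p_less: "g \<in> carrier G \<Longrightarrow> i < N \<Longrightarrow> p g i < N"
    and p_one: "i < N \<Longrightarrow> p \<one>\<^bsub>G\<^esub> i = i"
    and p_mult: "g \<in> carrier G \<Longrightarrow> h \<in> carrier G \<Longrightarrow> i < N \<Longrightarrow> p (g \<otimes>\<^bsub>G\<^esub> h) i = p g (p h i)"
    and c_one: "i < N \<Longrightarrow> c \<one>\<^bsub>G\<^esub> i = 1"
    and c_mult: "g \<in> carrier G \<Longrightarrow> h \<in> carrier G \<Longrightarrow> i < N \<Longrightarrow> c (g \<otimes>\<^bsub>G\<^esub> h) i = c g (p h i) * c h i"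
    and V_monomial: "g \<in> carrier G \<Longrightarrow> i < N \<Longrightarrow> j < N \<Longrightarrow> V g j i = (if j = p g i then c g i else 0)"
begin

sublocale G: group G by (rule grp)

abbreviation W :: "nat list set" where "W \<equiv> lists {..<N}"

abbreviation TA :: "(nat list \<Rightarrow> complex) calg" where "TA \<equiv> free_calg {..<N}"

abbreviation act :: "'g \<Rightarrow> (nat list \<Rightarrow> complex) \<Rightarrow> nat list \<Rightarrow> complex" where
  "act g \<equiv> free_ext {..<N} (V g)"

abbreviation R :: "('g \<Rightarrow> nat list \<Rightarrow> complex) calg" where "R \<equiv> skew_group_calg TA G act"

definition pw :: "'g \<Rightarrow> nat list \<Rightarrow> nat list" where "pw g = map (p g)"
definition cw :: "'g \<Rightarrow> nat list \<Rightarrow> complex" where "cw g w = prod_list (map (c g) w)"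

text \<open>The element u g, for a word u and a group element g; these elements form a basis of
  R.\<close>

definition bas :: "nat list \<Rightarrow> 'g \<Rightarrow> 'g \<Rightarrow> nat list \<Rightarrow> complex" where
  "bas u g = (\<lambda>h. if h = g then word_elt u else 0)"

sublocale TA: ring TA by (rule free_calg_ring)

lemma p_inv [simp]: "g \<in> carrier G \<Longrightarrow> i < N \<Longrightarrow> p (inv\<^bsub>G\<^esub> g) (p g i) = i"
  "g \<in> carrier G \<Longrightarrow> i < N \<Longrightarrow> p g (p (inv\<^bsub>G\<^esub> g) i) = i"
  by (metis G.inv_closed G.l_inv p_mult p_one, metis G.inv_closed G.r_inv p_mult p_one)

lemma p_inj: "g \<in> carrier G \<Longrightarrow> i < N \<Longrightarrow> j < N \<Longrightarrow> p g i = p g j \<longleftrightarrow> i = j"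
  by (metis p_inv(1))

lemma c_nonzero: "g \<in> carrier G \<Longrightarrow> i < N \<Longrightarrow> c g i \<noteq> 0"
  using c_mult[of "inv\<^bsub>G\<^esub> g" g i] c_one[of i] by auto

lemma pw_W [simp]: "g \<in> carrier G \<Longrightarrow> w \<in> W \<Longrightarrow> pw g w \<in> W"
  by (auto simp: pw_def p_less)

lemma pw_simps [simp]: "pw g [] = []" "pw g (i # w) = p g i # pw g w" "pw g (u @ v) = pw g u @ pw g v"
  "length (pw g w) = length w"
  by (auto simp: pw_def)

lemma cw_simps [simp]: "cw g [] = 1" "cw g (i # w) = c g i * cw g w" "cw g (u @ v) = cw g u * cw g v"
  by (auto simp: cw_def)

lemma pw_one [simp]: "w \<in> W \<Longrightarrow> pw \<one>\<^bsub>G\<^esub> w = w" and cw_one [simp]: "w \<in> W \<Longrightarrow> cw \<one>\<^bsub>G\<^esub> w = 1"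
  by (induction w) (auto simp: p_one c_one)

lemma pw_mult: "g \<in> carrier G \<Longrightarrow> h \<in> carrier G \<Longrightarrow> w \<in> W \<Longrightarrow> pw (g \<otimes>\<^bsub>G\<^esub> h) w = pw g (pw h w)"
  and cw_mult: "g \<in> carrier G \<Longrightarrow> h \<in> carrier G \<Longrightarrow> w \<in> W \<Longrightarrow> cw (g \<otimes>\<^bsub>G\<^esub> h) w = cw g (pw h w) * cw h w"
  by (induction w) (auto simp: p_mult c_mult)

lemma pw_inv [simp]: "g \<in> carrier G \<Longrightarrow> w \<in> W \<Longrightarrow> pw (inv\<^bsub>G\<^esub> g) (pw g w) = w"
  "g \<in> carrier G \<Longrightarrow> w \<in> W \<Longrightarrow> pw g (pw (inv\<^bsub>G\<^esub> g) w) = w"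
  by (metis G.inv_closed G.l_inv pw_mult pw_one, metis G.inv_closed G.r_inv pw_mult pw_one)

lemma act_outside: "w \<notin> W \<Longrightarrow> act g a w = 0"
  by (simp add: free_ext_def)

text \<open>The product is an entry of the matrix of g on words. As p g is injective, the row of
  \<open>pw g v\<close> meets only the column of v.\<close>

lemma prod_V:
  assumes g: "g \<in> carrier G" and "v \<in> W" "u \<in> W" "length u = length v"
  shows "(\<Prod>k<length v. V g (pw g v ! k) (u ! k)) = (if u = v then cw g v else 0)"
  using assms(4,2,3)
proof (induction u v rule: list_induct2)
  case Nil
  then show ?case by simp
next
  case (Cons i u j v)
  have "(\<Prod>k<length (j # v). V g (pw g (j # v) ! k) ((i # u) ! k))
      = V g (p g j) i * (\<Prod>k<length v. V g (pw g v ! k) (u ! k))"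
    by (simp add: prod.lessThan_Suc_shift del: prod.lessThan_Suc)
  also have "\<dots> = (if i = j then c g j else 0) * (if u = v then cw g v else 0)"
    using Cons g by (simp add: V_monomial p_less p_inj)
  finally show ?case by simp
qed

lemma act_pw:
  assumes "g \<in> carrier G" "v \<in> W"
  shows "act g a (pw g v) = cw g v * a v"
proof -
  have fin: "finite {u \<in> W. length u = length v}"
    using finite_lists_length_eq[of "{..<N}" "length v"] by (simp add: lists_eq_set subset_eq)
  have "act g a (pw g v)
    = (\<Sum>u\<in>{u \<in> W. length u = length v}. (\<Prod>k<length v. V g (pw g v ! k) (u ! k)) * a u)"
    using assms by (simp add: free_ext_def del: in_lists_conv_set)
  also have "\<dots> = (\<Sum>u\<in>{u \<in> W. length u = length v}. if u = v then cw g v * a v else 0)"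
    using assms by (intro sum.cong) (auto simp: prod_V)
  also have "\<dots> = cw g v * a v"
    using assms fin by (simp add: sum.delta)
  finally show ?thesis .
qed

lemma act_eq:
  assumes "g \<in> carrier G" "w \<in> W"
  shows "act g a w = cw g (pw (inv\<^bsub>G\<^esub> g) w) * a (pw (inv\<^bsub>G\<^esub> g) w)"
  using act_pw[of g "pw (inv\<^bsub>G\<^esub> g) w" a] assms by (simp del: in_lists_conv_set)

lemma act_add: "act g (a + b) = act g a + act g b"
  by (auto simp: free_ext_def fun_eq_iff algebra_simps sum.distrib)

lemma act_smult: "act g (\<lambda>w. s * a w) = (\<lambda>w. s * act g a w)"
  by (auto simp: free_ext_def fun_eq_iff sum_distrib_left algebra_simps)

lemma act_zero [simp]: "act g 0 = 0"
  by (auto simp: free_ext_def fun_eq_iff)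

lemma act_word_elt:
  assumes "g \<in> carrier G" "u \<in> W"
  shows "act g (word_elt u) = (\<lambda>w. cw g u * word_elt (pw g u) w)"
proof
  fix w
  show "act g (word_elt u) w = cw g u * word_elt (pw g u) w"
  proof (cases "w \<in> W")
    case True
    then have "pw (inv\<^bsub>G\<^esub> g) w = u \<longleftrightarrow> w = pw g u"
      using assms pw_inv by metis
    then show ?thesis using True assms by (auto simp: act_eq word_elt_def simp del: in_lists_conv_set)
  next
    case False
    then have "w \<noteq> pw g u" using assms pw_W by blast
    then show ?thesis using False by (simp add: act_outside word_elt_def del: in_lists_conv_set)
  qed
qed

lemma act_carrier:
  assumes "g \<in> carrier G" "a \<in> carrier TA"
  shows "act g a \<in> carrier TA"
  using assms(2)
proof (induction rule: free_calg_induct)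
  case zero
  show ?case using TA.zero_closed act_zero[of g] by (metis free_calg_simps(2))
next
  case (add a u s)
  have "(\<lambda>w. s * (cw g u * word_elt (pw g u) w)) \<in> carrier TA"
    using add assms(1) by (intro free_calg_smult_closed word_elt_carrier pw_W) auto
  then show ?case
    using TA.a_closed[of "act g a"] add assms(1)
    by (simp add: act_add act_smult act_word_elt del: plus_fun_apply in_lists_conv_set)
qed

text \<open>From here on membership in W stays folded, the form in which it occurs in the premises
  of the rules on words.\<close>

declare in_lists_conv_set [simp del]

lemma R_simps [simp]:
  "\<one>\<^bsub>R\<^esub> = bas [] \<one>\<^bsub>G\<^esub>"
  "\<zero>\<^bsub>R\<^esub> = 0"
  "f \<oplus>\<^bsub>R\<^esub> h = f + h"
  "s \<odot>\<^bsub>R\<^esub> f = sc s f"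
  by (auto simp: skew_group_calg_def bas_def sc_def fun_eq_iff)

lemma R_carrier: "f \<in> carrier R \<longleftrightarrow> (\<forall>g\<in>carrier G. f g \<in> carrier TA) \<and> (\<forall>g. g \<notin> carrier G \<longrightarrow> f g = 0)"
  by (simp add: skew_group_calg_def)

lemma R_carrier_app: "f \<in> carrier R \<Longrightarrow> f g \<in> carrier TA"
  using TA.zero_closed by (cases "g \<in> carrier G") (auto simp: R_carrier)

lemma R_mult:
  assumes "f \<in> carrier R" "h \<in> carrier R"
  shows "f \<otimes>\<^bsub>R\<^esub> h = (\<lambda>k. if k \<in> carrier G
    then \<Sum>g\<in>carrier G. f g \<otimes>\<^bsub>TA\<^esub> act g (h (inv\<^bsub>G\<^esub> g \<otimes>\<^bsub>G\<^esub> k)) else 0)"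
proof -
  have "finsum TA (\<lambda>g. f g \<otimes>\<^bsub>TA\<^esub> act g (h (inv\<^bsub>G\<^esub> g \<otimes>\<^bsub>G\<^esub> k))) (carrier G)
    = (\<Sum>g\<in>carrier G. f g \<otimes>\<^bsub>TA\<^esub> act g (h (inv\<^bsub>G\<^esub> g \<otimes>\<^bsub>G\<^esub> k)))" for k
    using assms by (intro free_calg_finsum finG TA.m_closed act_carrier R_carrier_app) auto
  then show ?thesis by (simp add: skew_group_calg_def cong: if_cong)
qed

lemma bas_carrier [simp]: "u \<in> W \<Longrightarrow> g \<in> carrier G \<Longrightarrow> bas u g \<in> carrier R"
  using TA.zero_closed by (auto simp: R_carrier bas_def)

lemma R_add_closed: "f \<in> carrier R \<Longrightarrow> h \<in> carrier R \<Longrightarrow> f + h \<in> carrier R"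
  using TA.a_closed by (auto simp: R_carrier)

lemma R_smult_closed: "f \<in> carrier R \<Longrightarrow> sc s f \<in> carrier R"
  by (auto simp: R_carrier sc_def fun_eq_iff intro: free_calg_smult_closed)

lemma R_zero_closed: "0 \<in> carrier R"
  using TA.zero_closed by (auto simp: R_carrier)

lemma R_uminus_closed: "f \<in> carrier R \<Longrightarrow> - f \<in> carrier R"
  by (simp add: uminus_eq_sc R_smult_closed)

lemma R_diff_closed: "f \<in> carrier R \<Longrightarrow> h \<in> carrier R \<Longrightarrow> f - h \<in> carrier R"
  using R_add_closed[of f "-h"] R_uminus_closed by simp

lemma R_sum_closed: "(\<And>x. x \<in> S \<Longrightarrow> f x \<in> carrier R) \<Longrightarrow> (\<Sum>x\<in>S. f x) \<in> carrier R"
  by (induction S rule: infinite_finite_induct) (auto intro: R_add_closed R_zero_closed)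

lemma R_mult_closed:
  assumes "f \<in> carrier R" "h \<in> carrier R"
  shows "f \<otimes>\<^bsub>R\<^esub> h \<in> carrier R"
proof -
  have "(\<Sum>g\<in>carrier G. f g \<otimes>\<^bsub>TA\<^esub> act g (h (inv\<^bsub>G\<^esub> g \<otimes>\<^bsub>G\<^esub> k))) \<in> carrier TA" for k
  proof -
    have *: "f g \<otimes>\<^bsub>TA\<^esub> act g (h (inv\<^bsub>G\<^esub> g \<otimes>\<^bsub>G\<^esub> k)) \<in> carrier TA" if "g \<in> carrier G" for g
      using assms that by (intro TA.m_closed act_carrier R_carrier_app)
    have "finsum TA (\<lambda>g. f g \<otimes>\<^bsub>TA\<^esub> act g (h (inv\<^bsub>G\<^esub> g \<otimes>\<^bsub>G\<^esub> k))) (carrier G) \<in> carrier TA"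
      using * by (intro TA.finsum_closed) auto
    then show ?thesis using free_calg_finsum[OF finG *] by simp
  qed
  then show ?thesis unfolding R_mult[OF assms] by (simp add: R_carrier)
qed

lemma R_distrib:
  assumes "f \<in> carrier R" "f' \<in> carrier R" "h \<in> carrier R"
  shows "(f + f') \<otimes>\<^bsub>R\<^esub> h = f \<otimes>\<^bsub>R\<^esub> h + f' \<otimes>\<^bsub>R\<^esub> h"
    and "h \<otimes>\<^bsub>R\<^esub> (f + f') = h \<otimes>\<^bsub>R\<^esub> f + h \<otimes>\<^bsub>R\<^esub> f'"
proof -
  have *: "f g \<in> carrier TA" "f' g \<in> carrier TA" "h g \<in> carrier TA"
    "g \<in> carrier G \<Longrightarrow> act g (f k) \<in> carrier TA" "g \<in> carrier G \<Longrightarrow> act g (f' k) \<in> carrier TA"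
    "g \<in> carrier G \<Longrightarrow> act g (h k) \<in> carrier TA" for g k
    using assms by (auto intro: R_carrier_app act_carrier)
  show "(f + f') \<otimes>\<^bsub>R\<^esub> h = f \<otimes>\<^bsub>R\<^esub> h + f' \<otimes>\<^bsub>R\<^esub> h"
  proof
    fix k
    show "((f + f') \<otimes>\<^bsub>R\<^esub> h) k = (f \<otimes>\<^bsub>R\<^esub> h + f' \<otimes>\<^bsub>R\<^esub> h) k"
      using assms * TA.l_distr[unfolded free_calg_simps]
      by (simp add: R_mult R_add_closed sum.distrib[symmetric])
  qed
  show "h \<otimes>\<^bsub>R\<^esub> (f + f') = h \<otimes>\<^bsub>R\<^esub> f + h \<otimes>\<^bsub>R\<^esub> f'"
  proof
    fix k
    show "(h \<otimes>\<^bsub>R\<^esub> (f + f')) k = (h \<otimes>\<^bsub>R\<^esub> f + h \<otimes>\<^bsub>R\<^esub> f') k"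
      using assms * TA.r_distr[unfolded free_calg_simps]
      by (simp add: R_mult R_add_closed sum.distrib[symmetric] act_add)
  qed
qed

lemma R_smult_mult:
  assumes "f \<in> carrier R" "h \<in> carrier R"
  shows "sc s f \<otimes>\<^bsub>R\<^esub> h = sc s (f \<otimes>\<^bsub>R\<^esub> h)"
    and "f \<otimes>\<^bsub>R\<^esub> sc s h = sc s (f \<otimes>\<^bsub>R\<^esub> h)"
proof -
  have app: "(sum F S) w = (\<Sum>g\<in>S. F g w)" for F :: "'g \<Rightarrow> nat list \<Rightarrow> complex" and S w
    by (induction S rule: infinite_finite_induct) auto
  show "sc s f \<otimes>\<^bsub>R\<^esub> h = sc s (f \<otimes>\<^bsub>R\<^esub> h)"
    "f \<otimes>\<^bsub>R\<^esub> sc s h = sc s (f \<otimes>\<^bsub>R\<^esub> h)"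
    using assms R_smult_closed by (auto simp: R_mult sc_def fun_eq_iff act_smult free_calg_smult_mult app sum_distrib_left)
qed

lemma bas_mult:
  assumes "u \<in> W" "g \<in> carrier G" "v \<in> W" "h \<in> carrier G"
  shows "bas u g \<otimes>\<^bsub>R\<^esub> bas v h = sc (cw g v) (bas (u @ pw g v) (g \<otimes>\<^bsub>G\<^esub> h))"
proof
  fix k
  have zero: "0 \<otimes>\<^bsub>TA\<^esub> b = 0" "b \<otimes>\<^bsub>TA\<^esub> 0 = 0" for b
    by (auto simp: free_calg_mult fun_eq_iff)
  show "(bas u g \<otimes>\<^bsub>R\<^esub> bas v h) k = sc (cw g v) (bas (u @ pw g v) (g \<otimes>\<^bsub>G\<^esub> h)) k"
  proof (cases "k \<in> carrier G")
    case True
    have "(bas u g \<otimes>\<^bsub>R\<^esub> bas v h) k = (\<Sum>g'\<in>carrier G. bas u g g' \<otimes>\<^bsub>TA\<^esub> act g' (bas v h (inv\<^bsub>G\<^esub> g' \<otimes>\<^bsub>G\<^esub> k)))"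
      using assms True by (simp add: R_mult)
    also have "\<dots> = (\<Sum>g'\<in>carrier G. if g' = g then word_elt u \<otimes>\<^bsub>TA\<^esub> act g (bas v h (inv\<^bsub>G\<^esub> g \<otimes>\<^bsub>G\<^esub> k)) else 0)"
      by (intro sum.cong) (auto simp: bas_def zero)
    also have "\<dots> = word_elt u \<otimes>\<^bsub>TA\<^esub> act g (bas v h (inv\<^bsub>G\<^esub> g \<otimes>\<^bsub>G\<^esub> k))"
      using assms finG by simp
    also have "\<dots> = (if k = g \<otimes>\<^bsub>G\<^esub> h then word_elt u \<otimes>\<^bsub>TA\<^esub> act g (word_elt v) else 0)"
    proof -
      have "inv\<^bsub>G\<^esub> g \<otimes>\<^bsub>G\<^esub> k = h \<longleftrightarrow> k = g \<otimes>\<^bsub>G\<^esub> h"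
        using assms True by (metis G.inv_closed G.inv_solve_left)
      then show ?thesis by (auto simp: bas_def zero)
    qed
    also have "\<dots> = sc (cw g v) (bas (u @ pw g v) (g \<otimes>\<^bsub>G\<^esub> h)) k"
      using assms by (auto simp: act_word_elt free_calg_smult_mult word_elt_mult bas_def sc_def)
    finally show ?thesis .
  next
    case False
    then have "(bas u g \<otimes>\<^bsub>R\<^esub> bas v h) k = 0"
      using assms by (simp add: R_mult)
    moreover have "k \<noteq> g \<otimes>\<^bsub>G\<^esub> h" using False assms by auto
    ultimately show ?thesis by (simp add: bas_def sc_def zero_fun_def)
  qed
qed

text \<open>The counterpart of \<open>free_calg_induct\<close> for R: bilinear statements reduce to
  the basis elements \<open>bas u g\<close>.\<close>

lemma R_induct [consumes 1, case_names zero add]: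
  assumes f: "f \<in> carrier R" and zero: "P 0"
    and add: "\<And>f u g s. f \<in> carrier R \<Longrightarrow> u \<in> W \<Longrightarrow> g \<in> carrier G \<Longrightarrow> P f \<Longrightarrow> P (f + sc s (bas u g))"
  shows "P f"
proof -
  \<comment> \<open>The component at g grows word by word from 0 while all other components stay
    unchanged.\<close>
  have step: "P (f(g := a))" if "f \<in> carrier R" "P f" "f g = 0" "g \<in> carrier G" "a \<in> carrier TA" for f g a
    using \<open>a \<in> carrier TA\<close>
  proof (induction rule: free_calg_induct)
    case zero
    then show ?case using that by (metis fun_upd_triv)
  next
    case (add a u s)
    have "f(g := a) \<in> carrier R" using that add by (auto simp: R_carrier)
    moreover have "f(g := a + (\<lambda>w. s * word_elt u w)) = f(g := a) + sc s (bas u g)"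
      by (auto simp: fun_eq_iff bas_def sc_def)
    ultimately show ?case using assms(3)[of "f(g := a)" u g s] add that by metis
  qed
  have "P (\<lambda>g. if g \<in> S then f g else 0)" if "finite S" "S \<subseteq> carrier G" for S
    using that
  proof (induction S rule: finite_induct)
    case empty
    then show ?case using zero by (simp add: zero_fun_def)
  next
    case (insert g S)
    let ?f = "\<lambda>g. if g \<in> S then f g else 0"
    have "?f \<in> carrier R" using f TA.zero_closed by (auto simp: R_carrier)
    then have "P (?f(g := f g))"
      using step[of ?f g "f g"] insert f by (auto simp: R_carrier)
    moreover have "?f(g := f g) = (\<lambda>h. if h \<in> insert g S then f h else 0)" by auto
    ultimately show ?case by simp
  qed
  from this[OF finG] have "P (\<lambda>g. if g \<in> carrier G then f g else 0)" by simp
  moreover have "(\<lambda>g. if g \<in> carrier G then f g else 0) = f" using f by (auto simp: R_carrier)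
  ultimately show ?thesis by simp
qed

lemma R_zero_mult: "h \<in> carrier R \<Longrightarrow> 0 \<otimes>\<^bsub>R\<^esub> h = 0" "h \<in> carrier R \<Longrightarrow> h \<otimes>\<^bsub>R\<^esub> 0 = 0"
  using R_smult_mult[of 0 h 0] R_smult_mult[of h 0 0] R_zero_closed by (simp_all add: sc_simps)

lemma R_bilinear_simps:
  assumes "f \<in> carrier R" "h \<in> carrier R" "f' \<in> carrier R"
  shows "(f + sc s f') \<otimes>\<^bsub>R\<^esub> h = f \<otimes>\<^bsub>R\<^esub> h + sc s (f' \<otimes>\<^bsub>R\<^esub> h)"
    and "h \<otimes>\<^bsub>R\<^esub> (f + sc s f') = h \<otimes>\<^bsub>R\<^esub> f + sc s (h \<otimes>\<^bsub>R\<^esub> f')"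
  by (simp_all only: R_distrib[OF assms(1) R_smult_closed[OF assms(3)] assms(2)]
    R_smult_mult(1)[OF assms(3,2)] R_smult_mult(2)[OF assms(2,3)])

text \<open>On basis elements associativity amounts to the cocycle identity \<open>cw_mult\<close>
  for the scalars, together with \<open>pw_mult\<close> for the words.\<close>

lemma bas_assoc:
  assumes "u \<in> W" "g \<in> carrier G" "v \<in> W" "h \<in> carrier G" "w \<in> W" "k \<in> carrier G"
  shows "bas u g \<otimes>\<^bsub>R\<^esub> bas v h \<otimes>\<^bsub>R\<^esub> bas w k = bas u g \<otimes>\<^bsub>R\<^esub> (bas v h \<otimes>\<^bsub>R\<^esub> bas w k)"
proof -
  have W: "u @ pw g v \<in> W" "v @ pw h w \<in> W" using assms by (simp_all only: append_in_lists_conv pw_W)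
  have "bas u g \<otimes>\<^bsub>R\<^esub> bas v h \<otimes>\<^bsub>R\<^esub> bas w k
      = sc (cw g v * cw (g \<otimes>\<^bsub>G\<^esub> h) w) (bas (u @ pw g v @ pw g (pw h w)) (g \<otimes>\<^bsub>G\<^esub> h \<otimes>\<^bsub>G\<^esub> k))"
    using assms W
    by (simp add: bas_mult pw_mult R_smult_mult sc_simps del: append_in_lists_conv)
  moreover have "bas u g \<otimes>\<^bsub>R\<^esub> (bas v h \<otimes>\<^bsub>R\<^esub> bas w k)
      = sc (cw h w * cw g (v @ pw h w)) (bas (u @ pw g (v @ pw h w)) (g \<otimes>\<^bsub>G\<^esub> (h \<otimes>\<^bsub>G\<^esub> k)))"
    using assms W
    by (simp add: bas_mult R_smult_mult sc_simps del: append_in_lists_conv cw_simps pw_simps)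
  ultimately show ?thesis
    using assms by (simp add: cw_mult G.m_assoc mult.assoc mult.commute mult.left_commute
      del: append_in_lists_conv)
qed

lemma R_assoc:
  assumes "x \<in> carrier R" "y \<in> carrier R" "z \<in> carrier R"
  shows "x \<otimes>\<^bsub>R\<^esub> y \<otimes>\<^bsub>R\<^esub> z = x \<otimes>\<^bsub>R\<^esub> (y \<otimes>\<^bsub>R\<^esub> z)"
  using assms(1)
proof (induction rule: R_induct)
  case zero
  then show ?case using assms by (simp add: R_zero_mult R_mult_closed del: zero_fun_apply)
next
  case (add f u g s)
  have "bas u g \<otimes>\<^bsub>R\<^esub> y \<otimes>\<^bsub>R\<^esub> z = bas u g \<otimes>\<^bsub>R\<^esub> (y \<otimes>\<^bsub>R\<^esub> z)"
    using assms(2)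
  proof (induction rule: R_induct)
    case zero
    then show ?case using assms add by (simp add: R_zero_mult R_mult_closed del: zero_fun_apply plus_fun_apply)
  next
    case (add f' v h s')
    have "bas u g \<otimes>\<^bsub>R\<^esub> bas v h \<otimes>\<^bsub>R\<^esub> z = bas u g \<otimes>\<^bsub>R\<^esub> (bas v h \<otimes>\<^bsub>R\<^esub> z)"
      using assms(3)
    proof (induction rule: R_induct)
      case zero
      then show ?case using \<open>u \<in> W\<close> \<open>v \<in> W\<close> \<open>g \<in> carrier G\<close> \<open>h \<in> carrier G\<close>
        by (simp add: R_zero_mult R_mult_closed del: zero_fun_apply plus_fun_apply)
    next
      case (add f'' w k s'')
      then show ?case using \<open>u \<in> W\<close> \<open>v \<in> W\<close> \<open>g \<in> carrier G\<close> \<open>h \<in> carrier G\<close>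
        by (simp add: R_bilinear_simps R_mult_closed bas_assoc del: zero_fun_apply plus_fun_apply)
    qed
    then show ?case using add \<open>u \<in> W\<close> \<open>g \<in> carrier G\<close> assms
      by (simp add: R_bilinear_simps R_mult_closed del: zero_fun_apply plus_fun_apply)
  qed
  then show ?case using add assms
    by (simp add: R_bilinear_simps R_mult_closed del: zero_fun_apply plus_fun_apply)
qed

lemma R_one_mult:
  assumes "x \<in> carrier R"
  shows "bas [] \<one>\<^bsub>G\<^esub> \<otimes>\<^bsub>R\<^esub> x = x" and "x \<otimes>\<^bsub>R\<^esub> bas [] \<one>\<^bsub>G\<^esub> = x"
proof -
  have N: "[] \<in> W" by simp
  show "bas [] \<one>\<^bsub>G\<^esub> \<otimes>\<^bsub>R\<^esub> x = x"
    using assms by (induction rule: R_induct)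
      (use N in \<open>simp_all add: R_zero_mult R_bilinear_simps bas_mult sc_simps
        del: zero_fun_apply plus_fun_apply\<close>)
  show "x \<otimes>\<^bsub>R\<^esub> bas [] \<one>\<^bsub>G\<^esub> = x"
    using assms by (induction rule: R_induct)
      (use N in \<open>simp_all add: R_zero_mult R_bilinear_simps bas_mult sc_simps
        del: zero_fun_apply plus_fun_apply\<close>)
qed

lemma R_ring: "ring R"
proof (intro ringI abelian_groupI monoidI)
  fix x assume "x \<in> carrier R"
  then show "\<exists>y\<in>carrier R. y \<oplus>\<^bsub>R\<^esub> x = \<zero>\<^bsub>R\<^esub>"
    using R_uminus_closed by (intro bexI[of _ "-x"]) auto
qed (use R_zero_closed in \<open>auto simp: R_add_closed R_mult_closed R_assoc R_distrib R_one_mult add.assoc add.commute\<close>)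

sublocale R: ring R by (rule R_ring)

lemma R_neg: "f \<in> carrier R \<Longrightarrow> \<ominus>\<^bsub>R\<^esub> f = - f"
  using R_uminus_closed by (intro R.minus_equality) auto

lemma R_minus: "f \<in> carrier R \<Longrightarrow> h \<in> carrier R \<Longrightarrow> f \<ominus>\<^bsub>R\<^esub> h = f - h"
  by (simp add: a_minus_def R_neg)

lemma R_finite_support:
  assumes "f \<in> carrier R"
  shows "finite {(g, w). f g w \<noteq> 0}"
proof -
  have "{(g, w). f g w \<noteq> 0} \<subseteq> Sigma (carrier G) (\<lambda>g. {w. f g w \<noteq> 0})"
    using assms by (auto simp: R_carrier)
  moreover have "finite (Sigma (carrier G) (\<lambda>g. {w. f g w \<noteq> 0}))"
    using assms finG by (auto simp: R_carrier free_calg_carrier)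
  ultimately show ?thesis by (rule finite_subset)
qed

end

section \<open>The diamond lemma\<close>

text \<open>The measure for swaps: exchanging the two letters of a descent keeps the length of a
  word and lowers this number by one.\<close>

fun inversions :: "nat list \<Rightarrow> nat" where
  "inversions [] = 0"
| "inversions (x # xs) = length (filter (\<lambda>y. y < x) xs) + inversions xs"

lemma inversions_swap: "j < i \<Longrightarrow> inversions (u @ [i, j] @ v) = Suc (inversions (u @ [j, i] @ v))"
  by (induction u) auto

lemma not_sorted_descent:
  fixes w :: "'a::linorder list"
  assumes "\<not> sorted w"
  shows "\<exists>u i j v. w = u @ [i, j] @ v \<and> j < i"
proof -
  obtain d where d: "Suc d < length w" "w ! Suc d < w ! d"
    using assms by (auto simp: sorted_iff_nth_Suc not_le)
  then have "w = take d w @ [w ! d, w ! Suc d] @ drop (Suc (Suc d)) w"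
    by (simp add: Cons_nth_drop_Suc)
  with d show ?thesis by blast
qed

lemma descent_not_sorted: "j < i \<Longrightarrow> \<not> sorted (u @ [i, j] @ v)"
  for i j :: "'a::linorder"
  by (auto simp: sorted_append)

text \<open>Two rewritable pairs in one word either share a letter or are disjoint. These are the
  two kinds of ambiguity in the diamond lemma.\<close>

lemma two_factor_cases:
  assumes "u1 @ [i1, j1] @ v1 = u2 @ [i2, j2] @ v2" "length u1 < length u2"
  shows "(u2 = u1 @ [i1] \<and> i2 = j1 \<and> v1 = j2 # v2) \<or> (\<exists>s. u2 = u1 @ [i1, j1] @ s \<and> v1 = s @ [i2, j2] @ v2)"
proof -
  obtain z where z: "u2 = u1 @ z" "[i1, j1] @ v1 = z @ [i2, j2] @ v2"
    using assms by (auto simp: append_eq_append_conv2)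
  then show ?thesis using assms(2) by (cases z; cases "tl z") auto
qed

section \<open>The relations of H and linear functionals on the skew group algebra\<close>

locale quantum_data = monomial_action +
  fixes q :: "nat \<Rightarrow> nat \<Rightarrow> complex" and \<kappa> :: "nat \<Rightarrow> nat \<Rightarrow> 'a \<Rightarrow> complex"
  assumes q_p: "g \<in> carrier G \<Longrightarrow> i < N \<Longrightarrow> j < N \<Longrightarrow> q (p g i) (p g j) = q i j"
    and q_sym: "i < N \<Longrightarrow> j < N \<Longrightarrow> q i j * q j i = 1"
    and q_refl: "i < N \<Longrightarrow> q i i = 1"
    and k_skew: "i < N \<Longrightarrow> j < N \<Longrightarrow> \<kappa> i j g = - q i j * \<kappa> j i g"
    and k_outside: "g \<notin> carrier G \<Longrightarrow> \<kappa> i j g = 0"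
begin

text \<open>The identity \<kappa>(^h v_i, ^h v_j) = h \<kappa>(v_i, v_j) h^-1 in the group algebra,
  compared at the coefficient of h g h^-1.\<close>

definition equivariant :: bool where
  "equivariant \<longleftrightarrow> (\<forall>h\<in>carrier G. \<forall>g\<in>carrier G. \<forall>i<N. \<forall>j<N.
     c h i * c h j * \<kappa> (p h i) (p h j) (h \<otimes>\<^bsub>G\<^esub> g \<otimes>\<^bsub>G\<^esub> inv\<^bsub>G\<^esub> h) = \<kappa> i j g)"

text \<open>Evaluating at an arbitrary \<open>\<nu>\<close> expresses an identity between vectors of \<open>V\<close>; the identity
  is what comes out when \<open>v\<^sub>i v\<^sub>j v\<^sub>k\<close> is reordered in the two possible ways.\<close>

definition jacobi_at :: "nat \<Rightarrow> nat \<Rightarrow> nat \<Rightarrow> 'a \<Rightarrow> (nat \<Rightarrow> complex) \<Rightarrow> bool" where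
  "jacobi_at i j k h \<nu> \<longleftrightarrow>
     \<kappa> j k h * (q i j * q i k * c h i * \<nu> (p h i) - \<nu> i)
     + \<kappa> i k h * (q i j * \<nu> j - q j k * c h j * \<nu> (p h j))
     + \<kappa> i j h * (c h k * \<nu> (p h k) - q j k * q i k * \<nu> k) = 0"

lemma bij_betw_conjugation:
  assumes h: "h \<in> carrier G"
  shows "bij_betw (\<lambda>f. h \<otimes>\<^bsub>G\<^esub> f \<otimes>\<^bsub>G\<^esub> inv\<^bsub>G\<^esub> h) (carrier G) (carrier G)" (is "bij_betw ?b _ _")
proof (rule bij_betw_byWitness[where f' = "\<lambda>f. inv\<^bsub>G\<^esub> h \<otimes>\<^bsub>G\<^esub> f \<otimes>\<^bsub>G\<^esub> h"])
  have "inv\<^bsub>G\<^esub> h \<otimes>\<^bsub>G\<^esub> (h \<otimes>\<^bsub>G\<^esub> a) = a" "h \<otimes>\<^bsub>G\<^esub> (inv\<^bsub>G\<^esub> h \<otimes>\<^bsub>G\<^esub> a) = a" if "a \<in> carrier G" for a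
    using h that by (simp_all flip: G.m_assoc)
  then show "\<forall>a\<in>carrier G. inv\<^bsub>G\<^esub> h \<otimes>\<^bsub>G\<^esub> ?b a \<otimes>\<^bsub>G\<^esub> h = a"
    "\<forall>a\<in>carrier G. ?b (inv\<^bsub>G\<^esub> h \<otimes>\<^bsub>G\<^esub> a \<otimes>\<^bsub>G\<^esub> h) = a"
    using h by (simp_all add: G.m_assoc)
qed (use h in auto)

lemma k_refl: "i < N \<Longrightarrow> \<kappa> i i g = 0"
  using k_skew[of i i g] q_refl[of i] by auto

text \<open>The linear functional on R with the value F w g at the basis element
  \<open>bas w g\<close>.\<close>

definition ev :: "(nat list \<Rightarrow> 'a \<Rightarrow> complex) \<Rightarrow> ('a \<Rightarrow> nat list \<Rightarrow> complex) \<Rightarrow> complex" where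
  "ev F f = (\<Sum>(g, w)\<in>{(g, w). f g w \<noteq> 0}. f g w * F w g)"

lemma ev_superset:
  assumes "finite S" "{(g, w). f g w \<noteq> 0} \<subseteq> S"
  shows "ev F f = (\<Sum>(g, w)\<in>S. f g w * F w g)"
  unfolding ev_def by (rule sum.mono_neutral_left[OF assms]) auto

lemma ev_zero [simp]: "ev F 0 = 0"
  by (simp add: ev_def)

lemma ev_add:
  assumes "f \<in> carrier R" "f' \<in> carrier R"
  shows "ev F (f + f') = ev F f + ev F f'"
proof -
  let ?S = "{(g, w). f g w \<noteq> 0} \<union> {(g, w). f' g w \<noteq> 0}"
  have "finite ?S" using assms R_finite_support by blast
  then show ?thesis
    by (subst (1 2 3) ev_superset[of ?S]) (auto simp: case_prod_unfold algebra_simps sum.distrib)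
qed

lemma ev_smult:
  assumes "f \<in> carrier R"
  shows "ev F (sc s f) = s * ev F f"
proof -
  have "finite {(g, w). f g w \<noteq> 0}" using assms R_finite_support by blast
  then show ?thesis
    by (subst (1 2) ev_superset[of "{(g, w). f g w \<noteq> 0}"])
       (auto simp: sc_def case_prod_unfold sum_distrib_left mult.assoc)
qed

lemma ev_bas [simp]: "ev F (bas u g) = F u g"
proof -
  have "ev F (bas u g) = (\<Sum>(h, w)\<in>{(g, u)}. bas u g h w * F w h)"
    by (rule ev_superset) (auto simp: bas_def word_elt_def split: if_splits)
  then show ?thesis by (simp add: bas_def word_elt_def)
qed

lemma ev_sum: "(\<And>x. x \<in> S \<Longrightarrow> f x \<in> carrier R) \<Longrightarrow> ev F (\<Sum>x\<in>S. f x) = (\<Sum>x\<in>S. ev F (f x))"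
  by (induction S rule: infinite_finite_induct) (auto simp: ev_add R_sum_closed)

text \<open>A functional composed with multiplication from both sides by basis elements is again of
  the form \<open>ev F'\<close>. Here a is moved through w, and a h through v. This lets relations
  be evaluated in context by \<open>ev_rgen\<close>.\<close>

lemma ev_context:
  assumes "f \<in> carrier R" "u \<in> W" "a \<in> carrier G" "v \<in> W" "b \<in> carrier G"
  shows "ev F (bas u a \<otimes>\<^bsub>R\<^esub> f \<otimes>\<^bsub>R\<^esub> bas v b)
    = ev (\<lambda>w h. cw a w * cw (a \<otimes>\<^bsub>G\<^esub> h) v * F (u @ pw a w @ pw (a \<otimes>\<^bsub>G\<^esub> h) v) (a \<otimes>\<^bsub>G\<^esub> h \<otimes>\<^bsub>G\<^esub> b)) f"
    (is "_ = ev ?F f")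
  using assms(1)
proof (induction rule: R_induct)
  case zero
  show ?case using assms by (simp add: R_zero_mult del: zero_fun_apply)
next
  case (add f w h s)
  have W: "u @ pw a w \<in> W" using assms add by simp
  have "bas u a \<otimes>\<^bsub>R\<^esub> bas w h \<otimes>\<^bsub>R\<^esub> bas v b
      = sc (cw a w) (bas (u @ pw a w) (a \<otimes>\<^bsub>G\<^esub> h) \<otimes>\<^bsub>R\<^esub> bas v b)"
    using assms add W by (simp only: bas_mult R_smult_mult(1) bas_carrier G.m_closed)
  then have "ev F (bas u a \<otimes>\<^bsub>R\<^esub> bas w h \<otimes>\<^bsub>R\<^esub> bas v b) = cw a w * ev F (bas (u @ pw a w) (a \<otimes>\<^bsub>G\<^esub> h) \<otimes>\<^bsub>R\<^esub> bas v b)"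
    using assms add W by (simp only: ev_smult R_mult_closed bas_carrier G.m_closed)
  also have "\<dots> = ?F w h"
    using assms add W by (simp add: bas_mult ev_smult)
  finally have e: "ev F (bas u a \<otimes>\<^bsub>R\<^esub> bas w h \<otimes>\<^bsub>R\<^esub> bas v b) = ?F w h" .
  have c: "bas u a \<in> carrier R" "bas v b \<in> carrier R" "bas w h \<in> carrier R"
    "bas u a \<otimes>\<^bsub>R\<^esub> f \<in> carrier R" "bas u a \<otimes>\<^bsub>R\<^esub> bas w h \<in> carrier R"
    using assms add by (simp_all add: R_mult_closed)
  have "bas u a \<otimes>\<^bsub>R\<^esub> (f + sc s (bas w h)) \<otimes>\<^bsub>R\<^esub> bas v b
    = bas u a \<otimes>\<^bsub>R\<^esub> f \<otimes>\<^bsub>R\<^esub> bas v b + sc s (bas u a \<otimes>\<^bsub>R\<^esub> bas w h \<otimes>\<^bsub>R\<^esub> bas v b)"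
    by (simp only: R_bilinear_simps c \<open>f \<in> carrier R\<close>)
  then have "ev F (bas u a \<otimes>\<^bsub>R\<^esub> (f + sc s (bas w h)) \<otimes>\<^bsub>R\<^esub> bas v b)
    = ev F (bas u a \<otimes>\<^bsub>R\<^esub> f \<otimes>\<^bsub>R\<^esub> bas v b) + s * ?F w h"
    by (simp only: ev_add ev_smult R_mult_closed R_smult_closed c e)
  also have "\<dots> = ev ?F (f + sc s (bas w h))"
    by (simp only: ev_add ev_smult R_smult_closed c \<open>f \<in> carrier R\<close> ev_bas add.IH)
  finally show ?case .
qed

text \<open>Spelled out as a function exactly as in \<open>Hqk_ideal\<close>, so that the two ideals
  coincide by unfolding; \<open>rgen_eq\<close> is the form for computing.\<close>

definition rgen :: "nat \<Rightarrow> nat \<Rightarrow> 'a \<Rightarrow> nat list \<Rightarrow> complex" where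
  "rgen i j = (\<lambda>g w. (if g = \<one>\<^bsub>G\<^esub> then word_elt [i, j] w - q i j * word_elt [j, i] w else 0)
     - \<kappa> i j g * word_elt [] w)"

definition J :: "('a \<Rightarrow> nat list \<Rightarrow> complex) set" where
  "J = genideal R {rgen i j | i j. i < N \<and> j < N}"

definition kelt :: "nat \<Rightarrow> nat \<Rightarrow> 'a \<Rightarrow> nat list \<Rightarrow> complex" where
  "kelt i j = (\<Sum>h\<in>carrier G. sc (\<kappa> i j h) (bas [] h))"

lemma kelt_eq: "kelt i j g w = \<kappa> i j g * word_elt [] w"
proof -
  have "kelt i j g w = (\<Sum>h\<in>carrier G. if h = g then \<kappa> i j g * word_elt [] w else 0)"
    unfolding kelt_def sum_fun_apply by (intro sum.cong) (auto simp: bas_def sc_def)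
  then show ?thesis using finG k_outside by auto
qed

lemma kelt_carrier [simp]: "kelt i j \<in> carrier R"
  unfolding kelt_def by (intro R_sum_closed R_smult_closed) simp

lemma rgen_eq: "rgen i j = bas [i, j] \<one>\<^bsub>G\<^esub> + (sc (- q i j) (bas [j, i] \<one>\<^bsub>G\<^esub>) + sc (- 1) (kelt i j))"
  by (auto simp: fun_eq_iff rgen_def kelt_eq bas_def sc_def)

lemma rgen_carrier [simp]: "i < N \<Longrightarrow> j < N \<Longrightarrow> rgen i j \<in> carrier R"
  unfolding rgen_eq by (intro R_add_closed R_smult_closed) auto

lemma ev_rgen:
  assumes "i < N" "j < N"
  shows "ev F (rgen i j) = F [i, j] \<one>\<^bsub>G\<^esub> - q i j * F [j, i] \<one>\<^bsub>G\<^esub> - (\<Sum>h\<in>carrier G. \<kappa> i j h * F [] h)"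
proof -
  have "ev F (kelt i j) = (\<Sum>h\<in>carrier G. \<kappa> i j h * F [] h)"
    unfolding kelt_def by (subst ev_sum) (auto intro!: R_smult_closed sum.cong simp: ev_smult)
  moreover have "[i, j] \<in> W" "[j, i] \<in> W" using assms by auto
  ultimately show ?thesis
    unfolding rgen_eq by (simp add: ev_add ev_smult R_add_closed R_smult_closed)
qed

lemma J_ideal: "ideal J R"
  unfolding J_def by (rule R.genideal_ideal) auto

lemma rgen_J: "i < N \<Longrightarrow> j < N \<Longrightarrow> rgen i j \<in> J"
  unfolding J_def by (rule subsetD[OF R.genideal_self]) auto

lemma J_carrier: "f \<in> J \<Longrightarrow> f \<in> carrier R"
  using J_ideal by (simp add: ideal.Icarr)

end

text \<open>\<Phi> is an arbitrary prescription on sorted words. The Jacobi identity appears for k <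
  j < i because two overlapping descents are three consecutive letters in decreasing order.\<close>

locale pbw_data = quantum_data +
  fixes \<Phi> :: "nat list \<Rightarrow> 'a \<Rightarrow> complex"
  assumes equivariant: equivariant
    and jacobi: "h \<in> carrier G \<Longrightarrow> k < j \<Longrightarrow> j < i \<Longrightarrow> i < N \<Longrightarrow> jacobi_at i j k h \<nu>"
begin

abbreviation some_descent :: "nat list \<Rightarrow> nat list \<times> nat \<times> nat \<times> nat list" where
  "some_descent w \<equiv> SOME x. case x of (u, i, j, v) \<Rightarrow> w = u @ [i, j] @ v \<and> j < i"

lemma some_descent:
  assumes "\<not> sorted w" "some_descent w = (u, i, j, v)"
  shows "w = u @ [i, j] @ v \<and> j < i"
proof -
  have "case some_descent w of (u, i, j, v) \<Rightarrow> w = u @ [i, j] @ v \<and> j < i"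
    by (rule someI_ex) (use not_sorted_descent[OF assms(1)] in auto)
  with assms(2) show ?thesis by simp
qed

text \<open>The descent that is rewritten is chosen arbitrarily; that any other choice gives the same
  value is the content of the theorem \<open>rel\<close> below.\<close>

function L :: "nat list \<Rightarrow> 'a \<Rightarrow> complex" where
  "L w g = (if sorted w then \<Phi> w g else case some_descent w of (u, i, j, v) \<Rightarrow>
     q i j * L (u @ [j, i] @ v) g
     + (\<Sum>h\<in>carrier G. \<kappa> i j h * cw h v * L (u @ pw h v) (h \<otimes>\<^bsub>G\<^esub> g)))"
  by pat_completeness auto
termination
\<comment> \<open>Swapping a descent loses an inversion at equal length. The terms coming from
  \<kappa> lose two letters, whatever happens to their inversions.\<close>
proof (relation "inv_image (less_than <*lex*> less_than) (\<lambda>(w, g). (length w, inversions w))", goal_cases)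
  case 1
  then show ?case by auto
next
  case (2 w g u y i z j v)
  then have "w = u @ [i, j] @ v \<and> j < i" by (intro some_descent) simp_all
  then show ?case using inversions_swap[of j i u v] by simp
next
  case (3 w g u y i z j v h)
  then have "w = u @ [i, j] @ v \<and> j < i" by (intro some_descent) simp_all
  then show ?case by simp
qed

declare L.simps [simp del]

text \<open>The contribution of \<kappa>(v_i, v_j) standing between u and v: each h in it is moved
  to the right through v and joins g.\<close>

definition K :: "nat list \<Rightarrow> nat \<Rightarrow> nat \<Rightarrow> nat list \<Rightarrow> 'a \<Rightarrow> complex" where
  "K u i j v g = (\<Sum>h\<in>carrier G. \<kappa> i j h * cw h v * L (u @ pw h v) (h \<otimes>\<^bsub>G\<^esub> g))"

definition rel :: "nat list \<Rightarrow> nat \<Rightarrow> nat \<Rightarrow> nat list \<Rightarrow> 'a \<Rightarrow> bool" where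
  "rel u i j v g \<longleftrightarrow> L (u @ [i, j] @ v) g = q i j * L (u @ [j, i] @ v) g + K u i j v g"

lemma L_sorted: "sorted w \<Longrightarrow> L w g = \<Phi> w g"
  by (subst L.simps) simp

lemma rel_some_descent:
  assumes "\<not> sorted w"
  obtains u i j v where "w = u @ [i, j] @ v" "j < i" "\<And>g. rel u i j v g"
proof -
  obtain u i j v where eq: "some_descent w = (u, i, j, v)"
      by (rule prod_cases4[of "some_descent w"])
  with some_descent[OF assms eq] have w: "w = u @ [i, j] @ v" "j < i" by auto
  have "rel u i j v g" for g
    unfolding rel_def K_def w(1)[symmetric] by (subst L.simps) (simp add: assms eq del: append.simps)
  with w that show ?thesis by blast
qed

text \<open>Rewriting never lengthens a word, so the values at words shorter than k depend only on
  values of \<Phi> at such words. This is what detects the filtration degree later.\<close>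

lemma L_short:
  assumes "\<And>w g. length w < k \<Longrightarrow> \<Phi> w g = 0"
  shows "length w < k \<Longrightarrow> L w g = 0"
proof (induction w g rule: L.induct)
  case (1 w g)
  show ?case
  proof (cases "sorted w")
    case True
    then show ?thesis using assms 1 by (simp add: L_sorted)
  next
    case False
    obtain u i j v where eq: "some_descent w = (u, i, j, v)"
      by (rule prod_cases4[of "some_descent w"])
    with some_descent[OF False eq] have w: "length w = length (u @ [i, j] @ v)" by simp
    have "L (u @ [j, i] @ v) g = 0"
      using 1(1)[OF False eq[symmetric] refl refl] w 1 by simp
    moreover have "L (u @ pw h v) (h \<otimes>\<^bsub>G\<^esub> g) = 0" if "h \<in> carrier G" for h
      using 1(2)[OF False eq[symmetric] refl refl that] w 1 by simp
    ultimately show ?thesis by (subst L.simps) (simp add: False eq del: append.simps)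
  qed
qed

lemma K_sym: "i < N \<Longrightarrow> j < N \<Longrightarrow> K u j i v g = - q j i * K u i j v g"
  unfolding K_def sum_distrib_left by (intro sum.cong) (auto simp: k_skew[of j i])

text \<open>By q_ij q_ji = 1 and the skewness of \<kappa>, the relation for j, i is a multiple of
  the one for i, j. It therefore suffices to treat descents.\<close>

lemma rel_sym:
  assumes "rel u i j v g" "i < N" "j < N"
  shows "rel u j i v g"
proof -
  have "q j i * L (u @ [i, j] @ v) g = (q i j * q j i) * L (u @ [j, i] @ v) g + q j i * K u i j v g"
    using assms(1) by (simp add: rel_def algebra_simps)
  then show ?thesis using assms by (simp add: rel_def K_sym[of i j] q_sym)
qed

lemma rel_refl: "i < N \<Longrightarrow> rel u i i v g"
  by (simp add: rel_def K_def k_refl q_refl)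

text \<open>Both ways of sorting i, j, k lead to the same multiple of the word with k, j, i. What
  remains is the difference of the six correction terms, which is a sum of Jacobi identities over
  h.\<close>

lemma overlap_ambiguity:
  assumes "k < j" "j < i" "i < N" "g \<in> carrier G"
    and "rel (u @ [j]) i k v g" "rel u j k (i # v) g" "rel u i k (j # v) g" "rel (u @ [k]) i j v g"
  shows "q i j * L (u @ [j, i] @ k # v) g + K u i j (k # v) g
    = q j k * L ((u @ [i]) @ [k, j] @ v) g + K (u @ [i]) j k v g"
proof -
  have "q i j * q i k * K u j k (i # v) g - K (u @ [i]) j k v g
      + (q i j * K (u @ [j]) i k v g - q j k * K u i k (j # v) g)
      + (K u i j (k # v) g - q j k * q i k * K (u @ [k]) i j v g)
    = (\<Sum>h\<in>carrier G. cw h v * (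
     \<kappa> j k h * (q i j * q i k * c h i * L (u @ p h i # pw h v) (h \<otimes>\<^bsub>G\<^esub> g) - L (u @ i # pw h v) (h \<otimes>\<^bsub>G\<^esub> g))
     + \<kappa> i k h * (q i j * L (u @ j # pw h v) (h \<otimes>\<^bsub>G\<^esub> g) - q j k * c h j * L (u @ p h j # pw h v) (h \<otimes>\<^bsub>G\<^esub> g))
     + \<kappa> i j h * (c h k * L (u @ p h k # pw h v) (h \<otimes>\<^bsub>G\<^esub> g) - q j k * q i k * L (u @ k # pw h v) (h \<otimes>\<^bsub>G\<^esub> g))))"
    unfolding K_def by (simp add: sum_distrib_left sum.distrib[symmetric] sum_subtractf[symmetric] algebra_simps)
  \<comment> \<open>For each h the bracket is the Jacobi identity at the test function \<nu> l = L
    (u @ l # pw h v) (h g).\<close>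
  also have "\<dots> = 0"
    using jacobi[OF _ assms(1-3), unfolded jacobi_at_def, of _ "\<lambda>l. L (u @ l # pw _ v) _"]
    by (intro sum.neutral) auto
  finally show ?thesis
    using assms(5-8) unfolding rel_def by (simp add: algebra_simps)
qed

text \<open>The rule a \<kappa>(v_i, v_j) = \<kappa>(^a v_i, ^a v_j) a, seen through L: the sum over
  h is reindexed by conjugation with a, and equivariance removes the conjugation.\<close>

lemma K_conj:
  assumes a: "a \<in> carrier G" and v: "v \<in> W" and b: "b \<in> carrier G" and "i < N" "j < N"
  shows "c a i * c a j * cw a v * K u (p a i) (p a j) (pw a v) (a \<otimes>\<^bsub>G\<^esub> b)
    = (\<Sum>h\<in>carrier G. \<kappa> i j h * cw (a \<otimes>\<^bsub>G\<^esub> h) v * L (u @ pw (a \<otimes>\<^bsub>G\<^esub> h) v) (a \<otimes>\<^bsub>G\<^esub> (h \<otimes>\<^bsub>G\<^esub> b)))"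
proof -
  let ?b = "\<lambda>h. a \<otimes>\<^bsub>G\<^esub> h \<otimes>\<^bsub>G\<^esub> inv\<^bsub>G\<^esub> a"
  have "K u (p a i) (p a j) (pw a v) (a \<otimes>\<^bsub>G\<^esub> b)
    = (\<Sum>h\<in>carrier G. \<kappa> (p a i) (p a j) (?b h) * cw (?b h) (pw a v)
       * L (u @ pw (?b h) (pw a v)) (?b h \<otimes>\<^bsub>G\<^esub> (a \<otimes>\<^bsub>G\<^esub> b)))"
    unfolding K_def by (rule sum.reindex_bij_betw[OF bij_betw_conjugation, symmetric]) (rule a)
  then have "c a i * c a j * cw a v * K u (p a i) (p a j) (pw a v) (a \<otimes>\<^bsub>G\<^esub> b)
    = (\<Sum>h\<in>carrier G. (c a i * c a j * \<kappa> (p a i) (p a j) (?b h)) * (cw (?b h) (pw a v) * cw a v)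
       * L (u @ pw (?b h) (pw a v)) (?b h \<otimes>\<^bsub>G\<^esub> (a \<otimes>\<^bsub>G\<^esub> b)))"
    by (simp add: sum_distrib_left mult.assoc mult.left_commute)
  also have "\<dots> = (\<Sum>h\<in>carrier G. \<kappa> i j h * cw (a \<otimes>\<^bsub>G\<^esub> h) v * L (u @ pw (a \<otimes>\<^bsub>G\<^esub> h) v) (a \<otimes>\<^bsub>G\<^esub> (h \<otimes>\<^bsub>G\<^esub> b)))"
  proof (rule sum.cong)
    fix h assume h: "h \<in> carrier G"
    have e: "?b h \<otimes>\<^bsub>G\<^esub> a = a \<otimes>\<^bsub>G\<^esub> h" using h a by (simp add: G.m_assoc)
    have "c a i * c a j * \<kappa> (p a i) (p a j) (?b h) = \<kappa> i j h"
      using equivariant h assms unfolding equivariant_def by blast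
    moreover have "cw (?b h) (pw a v) * cw a v = cw (a \<otimes>\<^bsub>G\<^esub> h) v"
      using cw_mult[of "?b h" a v] h a v e by simp
    moreover have "pw (?b h) (pw a v) = pw (a \<otimes>\<^bsub>G\<^esub> h) v"
      using pw_mult[of "?b h" a v] h a v e by simp
    moreover have "?b h \<otimes>\<^bsub>G\<^esub> (a \<otimes>\<^bsub>G\<^esub> b) = a \<otimes>\<^bsub>G\<^esub> (h \<otimes>\<^bsub>G\<^esub> b)"
      using G.m_assoc[of "?b h" a b] G.m_assoc[of a h b] h a b e by simp
    ultimately show "(c a i * c a j * \<kappa> (p a i) (p a j) (?b h)) * (cw (?b h) (pw a v) * cw a v)
        * L (u @ pw (?b h) (pw a v)) (?b h \<otimes>\<^bsub>G\<^esub> (a \<otimes>\<^bsub>G\<^esub> b))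
      = \<kappa> i j h * cw (a \<otimes>\<^bsub>G\<^esub> h) v * L (u @ pw (a \<otimes>\<^bsub>G\<^esub> h) v) (a \<otimes>\<^bsub>G\<^esub> (h \<otimes>\<^bsub>G\<^esub> b))"
      by (simp only:)
  qed simp
  finally show ?thesis .
qed

text \<open>The terms in which both of two disjoint pairs are replaced by \<kappa>. Replacing the
  left pair first carries its group element across the right pair; \<open>K_conj\<close> undoes
  this, and then the two orders differ by an exchange of sums.\<close>

lemma K_commute:
  assumes "i < N" "j < N" "k < N" "l < N" "s \<in> W" "v \<in> W" "g \<in> carrier G"
  shows "(\<Sum>h\<in>carrier G. \<kappa> i j h * cw h (s @ [k, l] @ v) * K (u @ pw h s) (p h k) (p h l) (pw h v) (h \<otimes>\<^bsub>G\<^esub> g))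
    = (\<Sum>h\<in>carrier G. \<kappa> k l h * cw h v * K u i j (s @ pw h v) (h \<otimes>\<^bsub>G\<^esub> g))"
proof -
  have inner: "cw h (s @ [k, l] @ v) * K (u @ pw h s) (p h k) (p h l) (pw h v) (h \<otimes>\<^bsub>G\<^esub> g)
     = (\<Sum>f\<in>carrier G. \<kappa> k l f * cw f v * cw h (s @ pw f v) * L (u @ pw h (s @ pw f v)) (h \<otimes>\<^bsub>G\<^esub> (f \<otimes>\<^bsub>G\<^esub> g)))"
    if h: "h \<in> carrier G" for h
  proof -
    have "cw h (s @ [k, l] @ v) * K (u @ pw h s) (p h k) (p h l) (pw h v) (h \<otimes>\<^bsub>G\<^esub> g)
      = cw h s * (c h k * c h l * cw h v * K (u @ pw h s) (p h k) (p h l) (pw h v) (h \<otimes>\<^bsub>G\<^esub> g))"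
      by simp
    also have "\<dots> = (\<Sum>f\<in>carrier G. \<kappa> k l f * cw f v * cw h (s @ pw f v) * L (u @ pw h (s @ pw f v)) (h \<otimes>\<^bsub>G\<^esub> (f \<otimes>\<^bsub>G\<^esub> g)))"
      unfolding K_conj[OF h assms(6,7,3,4)] sum_distrib_left
      by (intro sum.cong) (use h assms in \<open>simp_all add: cw_mult pw_mult mult.assoc mult.left_commute mult.commute\<close>)
    finally show ?thesis .
  qed
  have "(\<Sum>h\<in>carrier G. \<kappa> i j h * cw h (s @ [k, l] @ v) * K (u @ pw h s) (p h k) (p h l) (pw h v) (h \<otimes>\<^bsub>G\<^esub> g))
    = (\<Sum>h\<in>carrier G. \<Sum>f\<in>carrier G. \<kappa> i j h * (\<kappa> k l f * cw f v * cw h (s @ pw f v) * L (u @ pw h (s @ pw f v)) (h \<otimes>\<^bsub>G\<^esub> (f \<otimes>\<^bsub>G\<^esub> g))))"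
    by (intro sum.cong) (simp_all only: mult.assoc inner sum_distrib_left)
  also have "\<dots> = (\<Sum>f\<in>carrier G. \<Sum>h\<in>carrier G. \<kappa> i j h * (\<kappa> k l f * cw f v * cw h (s @ pw f v) * L (u @ pw h (s @ pw f v)) (h \<otimes>\<^bsub>G\<^esub> (f \<otimes>\<^bsub>G\<^esub> g))))"
    by (rule sum.swap)
  also have "\<dots> = (\<Sum>h\<in>carrier G. \<kappa> k l h * cw h v * K u i j (s @ pw h v) (h \<otimes>\<^bsub>G\<^esub> g))"
    unfolding K_def sum_distrib_left by (intro sum.cong) (simp_all add: mult.assoc mult.left_commute)
  finally show ?thesis .
qed

lemma disjoint_ambiguity:
  assumes "i < N" "j < N" "k < N" "l < N" "s \<in> W" "v \<in> W" "g \<in> carrier G"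
    and r1: "rel (u @ [j, i] @ s) k l v g" and r2: "rel u i j (s @ [l, k] @ v) g"
    and r3: "\<And>h. h \<in> carrier G \<Longrightarrow> rel (u @ pw h s) (p h k) (p h l) (pw h v) (h \<otimes>\<^bsub>G\<^esub> g)"
    and r4: "\<And>h. h \<in> carrier G \<Longrightarrow> rel u i j (s @ pw h v) (h \<otimes>\<^bsub>G\<^esub> g)"
  shows "q i j * L (u @ [j, i] @ s @ [k, l] @ v) g + K u i j (s @ [k, l] @ v) g
    = q k l * L ((u @ [i, j] @ s) @ [l, k] @ v) g + K (u @ [i, j] @ s) k l v g"
proof -
  have "K u i j (s @ [k, l] @ v) g = (\<Sum>h\<in>carrier G. \<kappa> i j h * cw h (s @ [k, l] @ v)
      * (q k l * L ((u @ pw h s) @ [p h l, p h k] @ pw h v) (h \<otimes>\<^bsub>G\<^esub> g)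
         + K (u @ pw h s) (p h k) (p h l) (pw h v) (h \<otimes>\<^bsub>G\<^esub> g)))"
    unfolding K_def[of u i j "s @ [k, l] @ v"]
    by (intro sum.cong) (use r3[unfolded rel_def] assms in \<open>simp_all add: q_p\<close>)
  also have "\<dots> = q k l * K u i j (s @ [l, k] @ v) g
      + (\<Sum>h\<in>carrier G. \<kappa> k l h * cw h v * K u i j (s @ pw h v) (h \<otimes>\<^bsub>G\<^esub> g))"
    unfolding K_commute[OF assms(1-7), symmetric] K_def[of u i j "s @ [l, k] @ v"]
    by (simp add: sum_distrib_left sum.distrib[symmetric] algebra_simps)
  finally have 1: "K u i j (s @ [k, l] @ v) g = q k l * K u i j (s @ [l, k] @ v) g
      + (\<Sum>h\<in>carrier G. \<kappa> k l h * cw h v * K u i j (s @ pw h v) (h \<otimes>\<^bsub>G\<^esub> g))" .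
  have "K (u @ [i, j] @ s) k l v g = (\<Sum>h\<in>carrier G. \<kappa> k l h * cw h v
      * (q i j * L (u @ [j, i] @ s @ pw h v) (h \<otimes>\<^bsub>G\<^esub> g) + K u i j (s @ pw h v) (h \<otimes>\<^bsub>G\<^esub> g)))"
    unfolding K_def[of "u @ [i, j] @ s" k l v]
    by (intro sum.cong) (use r4[unfolded rel_def] in simp_all)
  also have "\<dots> = q i j * K (u @ [j, i] @ s) k l v g
      + (\<Sum>h\<in>carrier G. \<kappa> k l h * cw h v * K u i j (s @ pw h v) (h \<otimes>\<^bsub>G\<^esub> g))"
    unfolding K_def[of "u @ [j, i] @ s" k l v]
    by (simp add: sum_distrib_left sum.distrib[symmetric] algebra_simps)
  finally have 2: "K (u @ [i, j] @ s) k l v g = q i j * K (u @ [j, i] @ s) k l v g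
      + (\<Sum>h\<in>carrier G. \<kappa> k l h * cw h v * K u i j (s @ pw h v) (h \<otimes>\<^bsub>G\<^esub> g))" .
  show ?thesis unfolding 1 2 using r1 r2 by (simp add: rel_def algebra_simps)
qed

text \<open>At the descent chosen in the recursion the relation holds by construction. Any other
  descent of w is compared with it by \<open>confluent\<close>, whose proof uses the relation only
  for words that are smaller in the termination order.\<close>

lemma rel_descent:
  "w = u @ [i, j] @ v \<Longrightarrow> j < i \<Longrightarrow> w \<in> W \<Longrightarrow> g \<in> carrier G \<Longrightarrow> rel u i j v g"
proof (induction "(length w, inversions w)" arbitrary: w u i j v g
    rule: wf_induct_rule[OF wf_lex_prod[OF wf_less_than wf_less_than]])
  case (1 w u i j v g)
  have shorter: "rel u' i' j' v' g'"
    if "length (u' @ [i', j'] @ v') < length w" "u' @ [i', j'] @ v' \<in> W" "g' \<in> carrier G" for u' i' j' v' g'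
  proof -
    have *: "i' < N" "j' < N" using that(2) by auto
    consider "j' < i'" | "i' = j'" | "i' < j'" by linarith
    then show ?thesis
    proof cases
      case 1
      with "1.hyps"[of "u' @ [i', j'] @ v'" u' i' j' v' g'] that show ?thesis by simp
    next
      case 2
      with rel_refl * show ?thesis by simp
    next
      case 3
      with "1.hyps"[of "u' @ [j', i'] @ v'" u' j' i' v' g'] that have "rel u' j' i' v' g'" by simp
      with rel_sym * show ?thesis by blast
    qed
  qed
  have fewer: "rel u' i' j' v' g"
    if "length (u' @ [i', j'] @ v') = length w" "inversions (u' @ [i', j'] @ v') < inversions w"
      "u' @ [i', j'] @ v' \<in> W" "j' < i'" for u' i' j' v'
    using "1.hyps"[of "u' @ [i', j'] @ v'" u' i' j' v' g] that "1.prems" by simp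
  have confluent: "q i1 j1 * L (u1 @ [j1, i1] @ v1) g + K u1 i1 j1 v1 g
      = q i2 j2 * L (u2 @ [j2, i2] @ v2) g + K u2 i2 j2 v2 g"
    if w1: "w = u1 @ [i1, j1] @ v1" "j1 < i1" and w2: "w = u2 @ [i2, j2] @ v2" "j2 < i2"
      and less: "length u1 < length u2" for u1 i1 j1 v1 u2 i2 j2 v2
    using two_factor_cases[OF w1(1)[unfolded w2(1), symmetric] less]
  proof (elim disjE exE conjE)
    assume e: "u2 = u1 @ [i1]" "i2 = j1" "v1 = j2 # v2"
    have W: "u1 \<in> W" "v2 \<in> W" "i1 < N" "j1 < N" "j2 < N" using \<open>w \<in> W\<close> w1 e by auto
    have w: "w = u1 @ [i1, j1] @ j2 # v2" "w = (u1 @ [i1]) @ [j1, j2] @ v2" using w1 e by simp_all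
    have inv: "inversions w = Suc (inversions (u1 @ [j1, i1] @ j2 # v2))"
      "inversions w = Suc (inversions ((u1 @ [i1]) @ [j2, j1] @ v2))"
      "inversions ((u1 @ [j1]) @ [i1, j2] @ v2) = Suc (inversions ((u1 @ [j1]) @ [j2, i1] @ v2))"
      "inversions (u1 @ [i1, j2] @ j1 # v2) = Suc (inversions (u1 @ [j2, i1] @ j1 # v2))"
      using inversions_swap[of j1 i1 u1 "j2 # v2"] inversions_swap[of j2 j1 "u1 @ [i1]" v2]
        inversions_swap[of j2 i1 "u1 @ [j1]" v2] inversions_swap[of j2 i1 u1 "j1 # v2"]
        w1(2) w2(2) w e by simp_all
    have "rel (u1 @ [j1]) i1 j2 v2 g" "rel u1 j1 j2 (i1 # v2) g"
      "rel u1 i1 j2 (j1 # v2) g" "rel (u1 @ [j2]) i1 j1 v2 g"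
      by (rule fewer; use inv w1(2) w2(2) w e W in simp)+
    then show ?thesis
      using overlap_ambiguity[of j2 j1 i1 g u1 v2] w1(2) w2(2) e W \<open>g \<in> carrier G\<close> by simp
  next
    fix s assume e: "u2 = u1 @ [i1, j1] @ s" "v1 = s @ [i2, j2] @ v2"
    have W: "u1 \<in> W" "v2 \<in> W" "s \<in> W" "i1 < N" "j1 < N" "i2 < N" "j2 < N" using \<open>w \<in> W\<close> w1 e by auto
    have inv: "inversions w = Suc (inversions ((u1 @ [j1, i1] @ s) @ [i2, j2] @ v2))"
      "inversions w = Suc (inversions (u1 @ [i1, j1] @ s @ [j2, i2] @ v2))"
      using inversions_swap[of j1 i1 u1 "s @ [i2, j2] @ v2"] inversions_swap[of j2 i2 "u1 @ [i1, j1] @ s" v2]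
        w1 w2 e by simp_all
    have "rel (u1 @ [j1, i1] @ s) i2 j2 v2 g" "rel u1 i1 j1 (s @ [j2, i2] @ v2) g"
      by (rule fewer; use inv w1 w2 e W in simp)+
    moreover have "rel (u1 @ pw h s) (p h i2) (p h j2) (pw h v2) (h \<otimes>\<^bsub>G\<^esub> g)" if "h \<in> carrier G" for h
      by (rule shorter; use w1 e W that \<open>g \<in> carrier G\<close> in \<open>simp add: p_less\<close>)
    moreover have "rel u1 i1 j1 (s @ pw h v2) (h \<otimes>\<^bsub>G\<^esub> g)" if "h \<in> carrier G" for h
      by (rule shorter; use w1 e W that \<open>g \<in> carrier G\<close> in simp)
    ultimately show ?thesis
      unfolding e by (intro disjoint_ambiguity) (use W \<open>g \<in> carrier G\<close> in auto)
  qed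
  have "\<not> sorted w" using descent_not_sorted "1.prems" by metis
  then obtain u0 i0 j0 v0 where d: "w = u0 @ [i0, j0] @ v0" "j0 < i0" "\<And>g. rel u0 i0 j0 v0 g"
    using rel_some_descent by blast
  consider "length u < length u0" | "length u0 < length u" | "length u = length u0" by linarith
  then show ?case
  proof cases
    case 3
    then have "u = u0" "i = i0" "j = j0" "v = v0"
      using d(1) "1.prems"(1) by (auto simp: append_eq_append_conv)
    with d show ?thesis by simp
  qed (use confluent[OF "1.prems"(1,2) d(1,2)] confluent[OF d(1,2) "1.prems"(1,2)] d
      "1.prems"(1) in \<open>simp_all add: rel_def del: append.simps\<close>)
qed

theorem rel:
  assumes "u \<in> W" "v \<in> W" "i < N" "j < N" "g \<in> carrier G"
  shows "rel u i j v g"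
proof -
  consider "j < i" | "i = j" | "i < j" by linarith
  then show ?thesis
  proof cases
    case 1
    with assms show ?thesis by (intro rel_descent[OF refl]) auto
  next
    case 2
    with assms rel_refl show ?thesis by simp
  next
    case 3
    with assms have "rel u j i v g" by (intro rel_descent[OF refl]) auto
    with assms rel_sym show ?thesis by blast
  qed
qed

text \<open>Moving a to the right turns the relation for i, j into a multiple of the one for p a i,
  p a j, by the invariance of q and \<open>K_conj\<close>. The latter relation is respected by L
  between u and the image of v.\<close>

lemma ev_L_context_bas:
  assumes "u \<in> W" "a \<in> carrier G" "v \<in> W" "b \<in> carrier G" "i < N" "j < N"
  shows "ev L (bas u a \<otimes>\<^bsub>R\<^esub> rgen i j \<otimes>\<^bsub>R\<^esub> bas v b) = 0"
proof -
  have conj: "(\<Sum>h\<in>carrier G. \<kappa> i j h * (cw (a \<otimes>\<^bsub>G\<^esub> h) v * L (u @ pw (a \<otimes>\<^bsub>G\<^esub> h) v) (a \<otimes>\<^bsub>G\<^esub> h \<otimes>\<^bsub>G\<^esub> b)))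
    = c a i * c a j * cw a v * K u (p a i) (p a j) (pw a v) (a \<otimes>\<^bsub>G\<^esub> b)"
    unfolding K_conj[OF assms(2-6)] using assms by (intro sum.cong) (simp_all add: G.m_assoc mult.assoc)
  have "rel u (p a i) (p a j) (pw a v) (a \<otimes>\<^bsub>G\<^esub> b)"
    using assms by (intro rel) (auto simp: p_less)
  then have "L (u @ [p a i, p a j] @ pw a v) (a \<otimes>\<^bsub>G\<^esub> b)
      = q i j * L (u @ [p a j, p a i] @ pw a v) (a \<otimes>\<^bsub>G\<^esub> b) + K u (p a i) (p a j) (pw a v) (a \<otimes>\<^bsub>G\<^esub> b)"
    using assms by (simp add: rel_def q_p)
  then show ?thesis
    using assms conj by (simp add: ev_context ev_rgen algebra_simps)
qed

lemma ev_L_context: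
  assumes "x \<in> carrier R" "y \<in> carrier R" "i < N" "j < N"
  shows "ev L (x \<otimes>\<^bsub>R\<^esub> rgen i j \<otimes>\<^bsub>R\<^esub> y) = 0"
  using assms(1)
proof (induction rule: R_induct)
  case zero
  show ?case using assms by (simp add: R_zero_mult del: zero_fun_apply)
next
  case (add f u a s)
  have b: "ev L (bas u a \<otimes>\<^bsub>R\<^esub> rgen i j \<otimes>\<^bsub>R\<^esub> y) = 0"
    using assms(2)
  proof (induction rule: R_induct)
    case zero
    show ?case using assms add by (simp add: R_zero_mult R_mult_closed del: zero_fun_apply)
  next
    case (add f' v b s')
    then show ?case
      using \<open>u \<in> W\<close> \<open>a \<in> carrier G\<close> assms ev_L_context_bas[of u a v b i j]
      by (simp add: R_bilinear_simps ev_add ev_smult R_mult_closed R_smult_closed del: plus_fun_apply)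
  qed
  have c: "rgen i j \<in> carrier R" "bas u a \<in> carrier R" "f \<in> carrier R"
     "f \<otimes>\<^bsub>R\<^esub> rgen i j \<in> carrier R" "bas u a \<otimes>\<^bsub>R\<^esub> rgen i j \<in> carrier R"
    using add assms by (simp_all add: R_mult_closed)
  have "ev L ((f + sc s (bas u a)) \<otimes>\<^bsub>R\<^esub> rgen i j \<otimes>\<^bsub>R\<^esub> y) = 0"
    by (simp only: R_bilinear_simps ev_add ev_smult R_mult_closed R_smult_closed c assms(2) b add.IH) simp
  then show ?case .
qed

theorem ev_L_J:
  assumes "f \<in> J"
  shows "ev L f = 0"
proof -
  \<comment> \<open>Being killed by \<open>ev L\<close> is not by itself stable under
    multiplication. Asking for it in all two-sided contexts gives an ideal, which contains the
    generators.\<close>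
  let ?I = "{f \<in> carrier R. \<forall>x\<in>carrier R. \<forall>y\<in>carrier R. ev L (x \<otimes>\<^bsub>R\<^esub> f \<otimes>\<^bsub>R\<^esub> y) = 0}"
  have "ideal ?I R"
  proof (rule idealI)
    show "ring R" by (rule R_ring)
    show "subgroup ?I (add_monoid R)"
    proof (rule R.add.subgroupI)
      show "?I \<noteq> {}" using R_zero_closed by (auto intro!: exI[of _ 0] simp: R_zero_mult R_mult_closed)
      fix f assume f: "f \<in> ?I"
      show "\<ominus>\<^bsub>R\<^esub> f \<in> ?I"
      proof -
        have "ev L (x \<otimes>\<^bsub>R\<^esub> sc (- 1) f \<otimes>\<^bsub>R\<^esub> y) = 0" if "x \<in> carrier R" "y \<in> carrier R" for x y
          using f that by (simp add: R_smult_mult R_mult_closed ev_smult)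
        with f show ?thesis by (simp add: R_neg uminus_eq_sc R_smult_closed)
      qed
      fix f' assume f': "f' \<in> ?I"
      show "f \<oplus>\<^bsub>R\<^esub> f' \<in> ?I"
        using f f' by (auto simp: R_distrib R_mult_closed R_add_closed ev_add)
    qed auto
    fix f z assume f: "f \<in> ?I" and z: "z \<in> carrier R"
    have "x \<otimes>\<^bsub>R\<^esub> (z \<otimes>\<^bsub>R\<^esub> f) \<otimes>\<^bsub>R\<^esub> y = (x \<otimes>\<^bsub>R\<^esub> z) \<otimes>\<^bsub>R\<^esub> f \<otimes>\<^bsub>R\<^esub> y"
      "x \<otimes>\<^bsub>R\<^esub> (f \<otimes>\<^bsub>R\<^esub> z) \<otimes>\<^bsub>R\<^esub> y = x \<otimes>\<^bsub>R\<^esub> f \<otimes>\<^bsub>R\<^esub> (z \<otimes>\<^bsub>R\<^esub> y)"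
      if "x \<in> carrier R" "y \<in> carrier R" for x y
      using f z that by (simp_all add: R_assoc R_mult_closed)
    with f z show "z \<otimes>\<^bsub>R\<^esub> f \<in> ?I" "f \<otimes>\<^bsub>R\<^esub> z \<in> ?I"
      by (auto simp: R_mult_closed)
  qed
  then have "J \<subseteq> ?I" unfolding J_def
    by (rule R.genideal_minimal) (auto simp: ev_L_context)
  with assms have "ev L (bas [] \<one>\<^bsub>G\<^esub> \<otimes>\<^bsub>R\<^esub> f \<otimes>\<^bsub>R\<^esub> bas [] \<one>\<^bsub>G\<^esub>) = 0" "f \<in> carrier R"
    by auto
  then show ?thesis by (simp add: R_one_mult)
qed

end

section \<open>Quotient algebras and associated graded algebras\<close>

locale complex_algebra = ring A for A :: "'a calg" +
  assumes smult_closed: "x \<in> carrier A \<Longrightarrow> s \<odot>\<^bsub>A\<^esub> x \<in> carrier A"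
    and smult_add: "x \<in> carrier A \<Longrightarrow> y \<in> carrier A \<Longrightarrow> s \<odot>\<^bsub>A\<^esub> (x \<oplus>\<^bsub>A\<^esub> y) = s \<odot>\<^bsub>A\<^esub> x \<oplus>\<^bsub>A\<^esub> s \<odot>\<^bsub>A\<^esub> y"
    and smult_mult: "x \<in> carrier A \<Longrightarrow> y \<in> carrier A \<Longrightarrow> (s \<odot>\<^bsub>A\<^esub> x) \<otimes>\<^bsub>A\<^esub> y = s \<odot>\<^bsub>A\<^esub> (x \<otimes>\<^bsub>A\<^esub> y)"

lemma coset_eq_iff:
  assumes "additive_subgroup P A" "abelian_group A" "x \<in> carrier A" "y \<in> carrier A"
  shows "P +>\<^bsub>A\<^esub> x = P +>\<^bsub>A\<^esub> y \<longleftrightarrow> x \<ominus>\<^bsub>A\<^esub> y \<in> P"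
proof -
  interpret abelian_subgroup P A
    using assms by (intro abelian_subgroupI3)
  show ?thesis
  proof
    assume "P +>\<^bsub>A\<^esub> x = P +>\<^bsub>A\<^esub> y"
    then have "x \<in> P +>\<^bsub>A\<^esub> y" using a_rcos_self[OF assms(3)] by simp
    then show "x \<ominus>\<^bsub>A\<^esub> y \<in> P" using assms(3,4) by (simp add: a_rcos_module a_minus_def)
  next
    assume "x \<ominus>\<^bsub>A\<^esub> y \<in> P"
    then have "x \<in> P +>\<^bsub>A\<^esub> y" using assms(3,4) by (simp add: a_rcos_module a_minus_def)
    then show "P +>\<^bsub>A\<^esub> x = P +>\<^bsub>A\<^esub> y" using a_repr_independence assms(4) a_subgroup by blast
  qed
qed

locale quotient_algebra = complex_algebra A + ideal I A for I and A :: "'a calg"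
begin

abbreviation Q where "Q \<equiv> quot_calg A I"
abbreviation proj where "proj x \<equiv> I +>\<^bsub>A\<^esub> x"

lemma I_smult: "x \<in> I \<Longrightarrow> s \<odot>\<^bsub>A\<^esub> x \<in> I"
proof -
  assume x: "x \<in> I"
  then have "(s \<odot>\<^bsub>A\<^esub> \<one>\<^bsub>A\<^esub>) \<otimes>\<^bsub>A\<^esub> x \<in> I" by (intro I_l_closed smult_closed) auto
  with x show ?thesis by (simp add: smult_mult a_subset)
qed

lemma Q_ring: "ring Q"
  by (rule ring_transfer[OF quotient_is_ring]) (simp_all add: quot_calg_def)

lemma Q_carrier: "carrier Q = proj ` carrier A"
  by (auto simp: quot_calg_def FactRing_def A_RCOSETS_def')

lemma proj_closed [simp]: "x \<in> carrier A \<Longrightarrow> proj x \<in> carrier Q"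
  by (simp add: Q_carrier)

lemma proj_add: "x \<in> carrier A \<Longrightarrow> y \<in> carrier A \<Longrightarrow> proj x \<oplus>\<^bsub>Q\<^esub> proj y = proj (x \<oplus>\<^bsub>A\<^esub> y)"
  by (simp add: quot_calg_def FactRing_def a_rcos_sum)

lemma proj_mult: "x \<in> carrier A \<Longrightarrow> y \<in> carrier A \<Longrightarrow> proj x \<otimes>\<^bsub>Q\<^esub> proj y = proj (x \<otimes>\<^bsub>A\<^esub> y)"
  by (simp add: quot_calg_def FactRing_def rcoset_mult_add)

lemma proj_one: "\<one>\<^bsub>Q\<^esub> = proj \<one>\<^bsub>A\<^esub>"
  by (simp add: quot_calg_def FactRing_def)

lemma proj_zero: "\<zero>\<^bsub>Q\<^esub> = proj \<zero>\<^bsub>A\<^esub>"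
  using a_coset_add_zero[OF a_subset] by (simp add: quot_calg_def FactRing_def)

lemma proj_eq_iff: "x \<in> carrier A \<Longrightarrow> y \<in> carrier A \<Longrightarrow> proj x = proj y \<longleftrightarrow> x \<ominus>\<^bsub>A\<^esub> y \<in> I"
  by (rule coset_eq_iff) (rule is_additive_subgroup, rule abelian_group_axioms)

text \<open>The union in the definition of \<open>quot_calg\<close> collapses to one coset, because
  I is closed under scalars.\<close>

lemma proj_smult:
  assumes "x \<in> carrier A"
  shows "s \<odot>\<^bsub>Q\<^esub> proj x = proj (s \<odot>\<^bsub>A\<^esub> x)"
proof -
  have "s \<odot>\<^bsub>Q\<^esub> proj x = (\<Union>y\<in>proj x. proj (s \<odot>\<^bsub>A\<^esub> y))"
    by (simp add: quot_calg_def)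
  also have "\<dots> = proj (s \<odot>\<^bsub>A\<^esub> x)"
  proof -
    have "proj (s \<odot>\<^bsub>A\<^esub> y) = proj (s \<odot>\<^bsub>A\<^esub> x)" if "y \<in> proj x" for y
    proof -
      obtain i where i: "i \<in> I" "y = i \<oplus>\<^bsub>A\<^esub> x" using \<open>y \<in> proj x\<close> by (auto simp: a_r_coset_def')
      then have "i \<in> carrier A" using a_subset by blast
      then have "s \<odot>\<^bsub>A\<^esub> y \<ominus>\<^bsub>A\<^esub> s \<odot>\<^bsub>A\<^esub> x = s \<odot>\<^bsub>A\<^esub> i"
        using i assms by (simp add: smult_add smult_closed a_minus_def a_assoc r_neg)
      with i I_smult assms \<open>i \<in> carrier A\<close> show ?thesis by (simp add: proj_eq_iff smult_closed)
    qed
    moreover have "x \<in> proj x" using assms by (rule a_rcos_self)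
    ultimately show ?thesis by blast
  qed
  finally show ?thesis .
qed

lemma Q_algebra: "complex_algebra Q"
proof (intro complex_algebra.intro Q_ring complex_algebra_axioms.intro)
  fix s X Y assume "X \<in> carrier Q"
  then obtain x where x: "x \<in> carrier A" "X = proj x" by (auto simp: Q_carrier)
  then show "s \<odot>\<^bsub>Q\<^esub> X \<in> carrier Q" by (simp add: proj_smult smult_closed)
  assume "Y \<in> carrier Q"
  then obtain y where y: "y \<in> carrier A" "Y = proj y" by (auto simp: Q_carrier)
  with x show "s \<odot>\<^bsub>Q\<^esub> (X \<oplus>\<^bsub>Q\<^esub> Y) = s \<odot>\<^bsub>Q\<^esub> X \<oplus>\<^bsub>Q\<^esub> s \<odot>\<^bsub>Q\<^esub> Y"
    "(s \<odot>\<^bsub>Q\<^esub> X) \<otimes>\<^bsub>Q\<^esub> Y = s \<odot>\<^bsub>Q\<^esub> (X \<otimes>\<^bsub>Q\<^esub> Y)"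
    by (simp_all add: proj_smult proj_add proj_mult smult_closed smult_add smult_mult)
qed

lemma proj_finsum:
  assumes "finite S" "\<And>x. x \<in> S \<Longrightarrow> f x \<in> carrier A"
  shows "finsum Q (\<lambda>x. proj (f x)) S = proj (finsum A f S)"
proof -
  interpret Q: ring Q by (rule Q_ring)
  show ?thesis
    using assms by (induction S rule: finite_induct) (auto simp: proj_zero proj_add Pi_def)
qed

end

section \<open>The associated graded algebra of a filtered algebra\<close>

locale filtered_algebra = complex_algebra A for A :: "'a calg" +
  fixes F :: "nat \<Rightarrow> 'a set"
  assumes F_subgroup: "additive_subgroup (F k) A"
    and F_Suc: "F k \<subseteq> F (Suc k)"
    and F_mult: "x \<in> F i \<Longrightarrow> y \<in> F j \<Longrightarrow> x \<otimes>\<^bsub>A\<^esub> y \<in> F (i + j)"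
    and F_one: "\<one>\<^bsub>A\<^esub> \<in> F 0"
    and F_smult: "x \<in> F k \<Longrightarrow> s \<odot>\<^bsub>A\<^esub> x \<in> F k"
begin

abbreviation P where "P \<equiv> filt_pred A F"
text \<open>Elements of \<open>gr\<close> are handled below through \<open>cls\<close>, that is,
  through a sequence of representatives with one entry per degree.\<close>

abbreviation gr where "gr \<equiv> assoc_graded A F"

definition cls :: "(nat \<Rightarrow> 'a) \<Rightarrow> nat \<Rightarrow> 'a set" where "cls x = (\<lambda>k. P k +>\<^bsub>A\<^esub> x k)"

lemma F_carrier: "x \<in> F k \<Longrightarrow> x \<in> carrier A"
  using additive_subgroup.a_subset[OF F_subgroup] by blast

lemma P_subgroup: "additive_subgroup (P k) A"
  by (cases k) (use F_subgroup in \<open>auto simp: filt_pred_def additive_subgroup_def add.triv_subgroup\<close>)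

lemma P_F: "P k \<subseteq> F k"
  using F_Suc additive_subgroup.zero_closed[OF F_subgroup] by (cases k) (auto simp: filt_pred_def)

lemma P_carrier: "x \<in> P k \<Longrightarrow> x \<in> carrier A"
  using P_F F_carrier by blast

lemma P_smult: "x \<in> P k \<Longrightarrow> s \<odot>\<^bsub>A\<^esub> x \<in> P k"
proof (cases k)
  case 0
  assume "x \<in> P k"
  then have "x = \<zero>\<^bsub>A\<^esub>" using 0 by (simp add: filt_pred_def)
  \<comment> \<open>That s 0 = 0 is derived from (s 0) 0 = s (0 0).\<close>
  moreover have "s \<odot>\<^bsub>A\<^esub> \<zero>\<^bsub>A\<^esub> = (s \<odot>\<^bsub>A\<^esub> \<zero>\<^bsub>A\<^esub>) \<otimes>\<^bsub>A\<^esub> \<zero>\<^bsub>A\<^esub>"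
    using smult_mult[of "\<zero>\<^bsub>A\<^esub>" "\<zero>\<^bsub>A\<^esub>" s] by simp
  then have "s \<odot>\<^bsub>A\<^esub> \<zero>\<^bsub>A\<^esub> = \<zero>\<^bsub>A\<^esub>" using smult_closed[of "\<zero>\<^bsub>A\<^esub>" s] by simp
  ultimately show ?thesis using 0 by (simp add: filt_pred_def)
qed (auto simp: filt_pred_def F_smult)

lemma P_mult: "x \<in> P i \<Longrightarrow> y \<in> F j \<Longrightarrow> x \<otimes>\<^bsub>A\<^esub> y \<in> P (i + j)"
  "x \<in> F i \<Longrightarrow> y \<in> P j \<Longrightarrow> x \<otimes>\<^bsub>A\<^esub> y \<in> P (i + j)"
proof -
  show "x \<otimes>\<^bsub>A\<^esub> y \<in> P (i + j)" if "x \<in> P i" "y \<in> F j"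
  proof (cases i)
    case 0
    with that F_carrier[of y j] additive_subgroup.zero_closed[OF P_subgroup] show ?thesis
      by (simp add: filt_pred_def)
  next
    case (Suc l)
    with that F_mult show ?thesis by (simp add: filt_pred_def)
  qed
  show "x \<otimes>\<^bsub>A\<^esub> y \<in> P (i + j)" if "x \<in> F i" "y \<in> P j"
  proof (cases j)
    case 0
    with that F_carrier[of x i] additive_subgroup.zero_closed[OF P_subgroup] show ?thesis
      by (simp add: filt_pred_def)
  next
    case (Suc l)
    with that F_mult show ?thesis by (simp add: filt_pred_def)
  qed
qed

lemma cls_eq_iff:
  assumes "\<And>k. x k \<in> carrier A" "\<And>k. y k \<in> carrier A"
  shows "cls x = cls y \<longleftrightarrow> (\<forall>k. x k \<ominus>\<^bsub>A\<^esub> y k \<in> P k)"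
  unfolding cls_def fun_eq_iff by (simp add: coset_eq_iff[OF P_subgroup abelian_group_axioms assms])

lemma P_coset_zero: "x \<in> P k \<Longrightarrow> P k +>\<^bsub>A\<^esub> x = P k"
proof -
  assume x: "x \<in> P k"
  have "P k +>\<^bsub>A\<^esub> \<zero>\<^bsub>A\<^esub> = P k"
    using additive_subgroup.a_subset[OF P_subgroup] by (rule a_coset_add_zero)
  moreover have "P k +>\<^bsub>A\<^esub> x = P k +>\<^bsub>A\<^esub> \<zero>\<^bsub>A\<^esub>"
    using x P_carrier by (subst coset_eq_iff[OF P_subgroup abelian_group_axioms]) (auto simp: a_minus_def)
  ultimately show ?thesis by simp
qed

lemma coset_eq_P_iff: "x \<in> carrier A \<Longrightarrow> P k +>\<^bsub>A\<^esub> x = P k \<longleftrightarrow> x \<in> P k"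
  using P_coset_zero coset_eq_iff[OF P_subgroup abelian_group_axioms, of x "\<zero>\<^bsub>A\<^esub>" k]
    P_coset_zero[OF additive_subgroup.zero_closed[OF P_subgroup]] by (auto simp: a_minus_def)

lemma gr_carrier:
  "a \<in> carrier gr \<longleftrightarrow> (\<exists>x. (\<forall>k. x k \<in> F k) \<and> finite {k. x k \<notin> P k} \<and> a = cls x)" (is "?L \<longleftrightarrow> ?R")
proof
  assume ?L
  then have a: "\<forall>k. \<exists>x\<in>F k. a k = P k +>\<^bsub>A\<^esub> x" "finite {k. a k \<noteq> P k}"
    by (auto simp: assoc_graded_def)
  from a(1) obtain x where x: "\<And>k. x k \<in> F k" "\<And>k. a k = P k +>\<^bsub>A\<^esub> x k" by metis
  moreover have "{k. x k \<notin> P k} = {k. a k \<noteq> P k}"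
    using x(2) coset_eq_P_iff[OF F_carrier[OF x(1)]] by simp
  ultimately show ?R using a(2) by (intro exI[of _ x]) (auto simp: cls_def)
next
  assume ?R
  then obtain x where x: "\<forall>k. x k \<in> F k" "finite {k. x k \<notin> P k}" "a = cls x" by blast
  moreover have "{k. x k \<notin> P k} = {k. a k \<noteq> P k}"
    using x(3) coset_eq_P_iff[OF F_carrier[OF x(1)[rule_format]]] by (simp add: cls_def)
  ultimately show ?L by (auto simp: assoc_graded_def cls_def)
qed

lemma cls_mem: "x k \<in> carrier A \<Longrightarrow> y \<in> cls x k \<longleftrightarrow> (\<exists>i\<in>P k. y = i \<oplus>\<^bsub>A\<^esub> x k)"
  by (auto simp: cls_def a_r_coset_def')

lemma cls_self: "x k \<in> carrier A \<Longrightarrow> x k \<in> cls x k"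
  using additive_subgroup.zero_closed[OF P_subgroup] by (force simp: cls_mem)

lemma gr_add:
  assumes "\<And>k. x k \<in> carrier A" "\<And>k. y k \<in> carrier A"
  shows "cls x \<oplus>\<^bsub>gr\<^esub> cls y = cls (\<lambda>k. x k \<oplus>\<^bsub>A\<^esub> y k)"
proof
  fix k
  interpret abelian_subgroup "P k" A
    by (rule abelian_subgroupI3[OF P_subgroup abelian_group_axioms])
  show "(cls x \<oplus>\<^bsub>gr\<^esub> cls y) k = cls (\<lambda>k. x k \<oplus>\<^bsub>A\<^esub> y k) k"
    using assms by (simp add: assoc_graded_def cls_def a_rcos_sum)
qed

lemma gr_one: "\<one>\<^bsub>gr\<^esub> = cls (\<lambda>k. if k = 0 then \<one>\<^bsub>A\<^esub> else \<zero>\<^bsub>A\<^esub>)"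
  by (auto simp: assoc_graded_def cls_def P_coset_zero additive_subgroup.zero_closed[OF P_subgroup] fun_eq_iff)

lemma gr_smult:
  assumes "\<And>k. x k \<in> carrier A"
  shows "s \<odot>\<^bsub>gr\<^esub> cls x = cls (\<lambda>k. s \<odot>\<^bsub>A\<^esub> x k)"
proof
  fix k
  have "P k +>\<^bsub>A\<^esub> (s \<odot>\<^bsub>A\<^esub> y) = P k +>\<^bsub>A\<^esub> (s \<odot>\<^bsub>A\<^esub> x k)" if "y \<in> cls x k" for y
  proof -
    obtain i where i: "i \<in> P k" "y = i \<oplus>\<^bsub>A\<^esub> x k" using \<open>y \<in> cls x k\<close> assms by (auto simp: cls_mem)
    then have "s \<odot>\<^bsub>A\<^esub> y \<ominus>\<^bsub>A\<^esub> s \<odot>\<^bsub>A\<^esub> x k = s \<odot>\<^bsub>A\<^esub> i"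
      using assms P_carrier by (simp add: smult_add smult_closed a_minus_def a_assoc r_neg)
    then show ?thesis
      using i assms P_carrier P_smult
      by (subst coset_eq_iff[OF P_subgroup abelian_group_axioms]) (auto simp: smult_closed)
  qed
  moreover have "(s \<odot>\<^bsub>gr\<^esub> cls x) k = (\<Union>y\<in>cls x k. P k +>\<^bsub>A\<^esub> (s \<odot>\<^bsub>A\<^esub> y))"
    by (simp add: assoc_graded_def)
  moreover have "x k \<in> cls x k" using assms by (rule cls_self)
  ultimately show "(s \<odot>\<^bsub>gr\<^esub> cls x) k = cls (\<lambda>k. s \<odot>\<^bsub>A\<^esub> x k) k"
    unfolding cls_def[of "\<lambda>k. s \<odot>\<^bsub>A\<^esub> x k"] by blast
qed

lemma P_finsum_diff:
  assumes "finite S" "\<And>x. x \<in> S \<Longrightarrow> f x \<in> carrier A" "\<And>x. x \<in> S \<Longrightarrow> g x \<in> carrier A"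
    "\<And>x. x \<in> S \<Longrightarrow> f x \<ominus>\<^bsub>A\<^esub> g x \<in> P k"
  shows "finsum A f S \<ominus>\<^bsub>A\<^esub> finsum A g S \<in> P k"
  using assms
proof (induction S rule: finite_induct)
  case empty
  then show ?case using additive_subgroup.zero_closed[OF P_subgroup] by (simp add: a_minus_def)
next
  case (insert x S)
  have c: "finsum A f S \<in> carrier A" "finsum A g S \<in> carrier A" "f x \<in> carrier A" "g x \<in> carrier A"
    using insert by (auto intro!: finsum_closed)
  have "finsum A f (insert x S) \<ominus>\<^bsub>A\<^esub> finsum A g (insert x S)
      = (f x \<oplus>\<^bsub>A\<^esub> finsum A f S) \<ominus>\<^bsub>A\<^esub> (g x \<oplus>\<^bsub>A\<^esub> finsum A g S)"
    using insert by (simp add: Pi_def)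
  also have "\<dots> = (f x \<ominus>\<^bsub>A\<^esub> g x) \<oplus>\<^bsub>A\<^esub> (finsum A f S \<ominus>\<^bsub>A\<^esub> finsum A g S)"
    using c by (simp add: a_minus_def minus_add a_ac)
  finally show ?case
    using insert additive_subgroup.a_closed[OF P_subgroup] by simp
qed

lemma mult_diff_P:
  assumes "x \<in> F i" "y \<in> F j" "x' \<in> F i" "y' \<in> F j" "x' \<ominus>\<^bsub>A\<^esub> x \<in> P i" "y' \<ominus>\<^bsub>A\<^esub> y \<in> P j"
  shows "x' \<otimes>\<^bsub>A\<^esub> y' \<ominus>\<^bsub>A\<^esub> x \<otimes>\<^bsub>A\<^esub> y \<in> P (i + j)"
proof -
  have c: "x \<in> carrier A" "y \<in> carrier A" "x' \<in> carrier A" "y' \<in> carrier A"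
    using assms F_carrier by auto
  have "x' \<otimes>\<^bsub>A\<^esub> y' \<ominus>\<^bsub>A\<^esub> x \<otimes>\<^bsub>A\<^esub> y = (x' \<ominus>\<^bsub>A\<^esub> x) \<otimes>\<^bsub>A\<^esub> y' \<oplus>\<^bsub>A\<^esub> x \<otimes>\<^bsub>A\<^esub> (y' \<ominus>\<^bsub>A\<^esub> y)"
    using c by algebra
  moreover have "(x' \<ominus>\<^bsub>A\<^esub> x) \<otimes>\<^bsub>A\<^esub> y' \<in> P (i + j)" "x \<otimes>\<^bsub>A\<^esub> (y' \<ominus>\<^bsub>A\<^esub> y) \<in> P (i + j)"
    using assms by (auto intro: P_mult)
  ultimately show ?thesis using additive_subgroup.a_closed[OF P_subgroup] by simp
qed

text \<open>The product in \<open>assoc_graded\<close> is a union over all choices of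
  representatives. By \<open>mult_diff_P\<close> every choice gives the same coset, so the union is
  that coset.\<close>

lemma gr_mult:
  assumes x: "\<And>k. x k \<in> F k" and y: "\<And>k. y k \<in> F k"
  shows "cls x \<otimes>\<^bsub>gr\<^esub> cls y = cls (\<lambda>k. finsum A (\<lambda>j. x j \<otimes>\<^bsub>A\<^esub> y (k - j)) {..k})"
proof
  fix k
  have c: "x k \<in> carrier A" "y k \<in> carrier A" for k using x y F_carrier by auto
  have same: "P k +>\<^bsub>A\<^esub> finsum A (\<lambda>j. x' j \<otimes>\<^bsub>A\<^esub> y' (k - j)) {..k} = cls (\<lambda>k. finsum A (\<lambda>j. x j \<otimes>\<^bsub>A\<^esub> y (k - j)) {..k}) k"
    if "\<forall>j\<le>k. x' j \<in> cls x j \<and> y' j \<in> cls y j" for x' y'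
  proof -
    have 1: "x' j \<in> F j \<and> x' j \<ominus>\<^bsub>A\<^esub> x j \<in> P j" "y' j \<in> F j \<and> y' j \<ominus>\<^bsub>A\<^esub> y j \<in> P j" if "j \<le> k" for j
    proof -
      obtain i i' where i: "i \<in> P j" "x' j = i \<oplus>\<^bsub>A\<^esub> x j" "i' \<in> P j" "y' j = i' \<oplus>\<^bsub>A\<^esub> y j"
        using \<open>\<forall>j\<le>k. _\<close> \<open>j \<le> k\<close> c by (auto simp: cls_mem)
      moreover have "x' j \<ominus>\<^bsub>A\<^esub> x j = i" "y' j \<ominus>\<^bsub>A\<^esub> y j = i'"
        using i c P_carrier by (simp_all add: a_minus_def a_assoc r_neg)
      ultimately show "x' j \<in> F j \<and> x' j \<ominus>\<^bsub>A\<^esub> x j \<in> P j" "y' j \<in> F j \<and> y' j \<ominus>\<^bsub>A\<^esub> y j \<in> P j"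
        using x y P_F additive_subgroup.a_closed[OF F_subgroup] by (metis subsetD)+
    qed
    have "x' j \<otimes>\<^bsub>A\<^esub> y' (k - j) \<ominus>\<^bsub>A\<^esub> x j \<otimes>\<^bsub>A\<^esub> y (k - j) \<in> P k" if "j \<le> k" for j
      using mult_diff_P[of "x j" j "y (k - j)" "k - j" "x' j" "y' (k - j)"] 1[of j] 1[of "k - j"] x y that by simp
    moreover have "x' j \<otimes>\<^bsub>A\<^esub> y' (k - j) \<in> carrier A" "x j \<otimes>\<^bsub>A\<^esub> y (k - j) \<in> carrier A" if "j \<le> k" for j
      using 1[of j] 1[of "k - j"] that F_carrier c by auto
    ultimately show ?thesis
      unfolding cls_def
      by (subst coset_eq_iff[OF P_subgroup abelian_group_axioms]) (auto intro!: P_finsum_diff finsum_closed)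
  qed
  have "(cls x \<otimes>\<^bsub>gr\<^esub> cls y) k = (\<Union>{P k +>\<^bsub>A\<^esub> (\<Oplus>\<^bsub>A\<^esub>j\<in>{..k}. x' j \<otimes>\<^bsub>A\<^esub> y' (k - j)) | x' y'.
       \<forall>j\<le>k. x' j \<in> cls x j \<and> y' j \<in> cls y j})"
    by (simp add: assoc_graded_def)
  also have "\<dots> = cls (\<lambda>k. finsum A (\<lambda>j. x j \<otimes>\<^bsub>A\<^esub> y (k - j)) {..k}) k"
  proof -
    have "{P k +>\<^bsub>A\<^esub> (\<Oplus>\<^bsub>A\<^esub>j\<in>{..k}. x' j \<otimes>\<^bsub>A\<^esub> y' (k - j)) | x' y'. \<forall>j\<le>k. x' j \<in> cls x j \<and> y' j \<in> cls y j}
      = {cls (\<lambda>k. finsum A (\<lambda>j. x j \<otimes>\<^bsub>A\<^esub> y (k - j)) {..k}) k}"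
    proof -
      have e: "\<forall>j\<le>k. x j \<in> cls x j \<and> y j \<in> cls y j" using cls_self c by blast
      show ?thesis using same same[OF e, symmetric] e by blast
    qed
    then show ?thesis by simp
  qed
  finally show "(cls x \<otimes>\<^bsub>gr\<^esub> cls y) k = cls (\<lambda>k. finsum A (\<lambda>j. x j \<otimes>\<^bsub>A\<^esub> y (k - j)) {..k}) k" .
qed

end

text \<open>Two surjections from the same algebra with the same fibres have isomorphic images; the
  isomorphism sends a to the image under \<theta> of any preimage of a under \<psi>.\<close>

lemma iso_from_common_kernel:
  assumes R: "\<And>x y. x \<in> C \<Longrightarrow> y \<in> C \<Longrightarrow> x \<otimes>\<^bsub>R\<^esub> y \<in> C" "\<And>x y. x \<in> C \<Longrightarrow> y \<in> C \<Longrightarrow> x \<oplus>\<^bsub>R\<^esub> y \<in> C" "\<one>\<^bsub>R\<^esub> \<in> C"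
      "\<And>x s. x \<in> C \<Longrightarrow> s \<odot>\<^bsub>R\<^esub> x \<in> C"
    and A: "carrier A = \<psi> ` C" "\<And>x y. x \<in> C \<Longrightarrow> y \<in> C \<Longrightarrow> \<psi> (x \<otimes>\<^bsub>R\<^esub> y) = \<psi> x \<otimes>\<^bsub>A\<^esub> \<psi> y"
      "\<And>x y. x \<in> C \<Longrightarrow> y \<in> C \<Longrightarrow> \<psi> (x \<oplus>\<^bsub>R\<^esub> y) = \<psi> x \<oplus>\<^bsub>A\<^esub> \<psi> y" "\<psi> \<one>\<^bsub>R\<^esub> = \<one>\<^bsub>A\<^esub>"
      "\<And>x s. x \<in> C \<Longrightarrow> \<psi> (s \<odot>\<^bsub>R\<^esub> x) = s \<odot>\<^bsub>A\<^esub> \<psi> x"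
    and B: "carrier B = \<theta> ` C" "\<And>x y. x \<in> C \<Longrightarrow> y \<in> C \<Longrightarrow> \<theta> (x \<otimes>\<^bsub>R\<^esub> y) = \<theta> x \<otimes>\<^bsub>B\<^esub> \<theta> y"
      "\<And>x y. x \<in> C \<Longrightarrow> y \<in> C \<Longrightarrow> \<theta> (x \<oplus>\<^bsub>R\<^esub> y) = \<theta> x \<oplus>\<^bsub>B\<^esub> \<theta> y" "\<theta> \<one>\<^bsub>R\<^esub> = \<one>\<^bsub>B\<^esub>"
      "\<And>x s. x \<in> C \<Longrightarrow> \<theta> (s \<odot>\<^bsub>R\<^esub> x) = s \<odot>\<^bsub>B\<^esub> \<theta> x"
    and eq: "\<And>x y. x \<in> C \<Longrightarrow> y \<in> C \<Longrightarrow> \<psi> x = \<psi> y \<longleftrightarrow> \<theta> x = \<theta> y"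
  obtains \<phi> where "\<phi> \<in> calg_iso A B" "\<And>x. x \<in> C \<Longrightarrow> \<phi> (\<psi> x) = \<theta> x"
proof -
  define \<phi> where "\<phi> a = \<theta> (SOME x. x \<in> C \<and> \<psi> x = a)" for a
  have \<phi>: "\<phi> (\<psi> x) = \<theta> x" if "x \<in> C" for x
  proof -
    have "(SOME y. y \<in> C \<and> \<psi> y = \<psi> x) \<in> C \<and> \<psi> (SOME y. y \<in> C \<and> \<psi> y = \<psi> x) = \<psi> x"
      by (rule someI[of _ x]) (use that in simp)
    then show ?thesis unfolding \<phi>_def using eq that by blast
  qed
  have "\<phi> \<in> Ring.ring_hom A B"
    by (rule ring_hom_memI) (auto simp: A(1) B(1) \<phi> R simp flip: A(2-4) B(2-4))
  moreover have "bij_betw \<phi> (carrier A) (carrier B)"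
    unfolding bij_betw_def A(1) B(1) by (auto simp: inj_on_def \<phi> eq image_image)
  moreover have "\<phi> (s \<odot>\<^bsub>A\<^esub> a) = s \<odot>\<^bsub>B\<^esub> \<phi> a" if "a \<in> carrier A" for s a
    using that by (auto simp: A(1) \<phi> R(4) simp flip: A(5) B(5))
  ultimately have "\<phi> \<in> calg_iso A B" by (simp add: calg_iso_def ring_iso_def)
  then show thesis using \<phi> that by blast
qed

section \<open>The two graded quotients of the skew group algebra\<close>

context monomial_action begin

lemma TA_algebra: "complex_algebra TA"
proof (intro complex_algebra.intro complex_algebra_axioms.intro TA.ring_axioms)
  fix s and a b :: "nat list \<Rightarrow> complex" assume "a \<in> carrier TA"
  then show "s \<odot>\<^bsub>TA\<^esub> a \<in> carrier TA" by (simp add: free_calg_smult_closed)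
  show "s \<odot>\<^bsub>TA\<^esub> (a \<oplus>\<^bsub>TA\<^esub> b) = s \<odot>\<^bsub>TA\<^esub> a \<oplus>\<^bsub>TA\<^esub> s \<odot>\<^bsub>TA\<^esub> b" by (simp add: fun_eq_iff algebra_simps)
  show "(s \<odot>\<^bsub>TA\<^esub> a) \<otimes>\<^bsub>TA\<^esub> b = s \<odot>\<^bsub>TA\<^esub> (a \<otimes>\<^bsub>TA\<^esub> b)" by (simp add: free_calg_smult_mult)
qed

lemma sc_add: "sc s (f + h) = sc s f + sc s h"
  by (simp add: sc_def fun_eq_iff algebra_simps)

lemma R_algebra: "complex_algebra R"
  by (intro complex_algebra.intro complex_algebra_axioms.intro R.ring_axioms)
     (auto simp: R_smult_closed sc_add R_smult_mult)

lemma act_mult: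
  assumes g: "g \<in> carrier G" and a: "a \<in> carrier TA" and b: "b \<in> carrier TA"
  shows "act g (a \<otimes>\<^bsub>TA\<^esub> b) = act g a \<otimes>\<^bsub>TA\<^esub> act g b"
  using a
proof (induction rule: free_calg_induct)
  case zero
  have "0 \<otimes>\<^bsub>TA\<^esub> x = 0" for x by (simp add: free_calg_mult fun_eq_iff)
  then show "act g (0 \<otimes>\<^bsub>TA\<^esub> b) = act g 0 \<otimes>\<^bsub>TA\<^esub> act g b" by (simp del: zero_fun_apply)
next
  case (add a u s)
  have word: "act g (word_elt u \<otimes>\<^bsub>TA\<^esub> b) = act g (word_elt u) \<otimes>\<^bsub>TA\<^esub> act g b"
    using b
  proof (induction rule: free_calg_induct)
    case zero
    have "x \<otimes>\<^bsub>TA\<^esub> 0 = 0" for x by (simp add: free_calg_mult fun_eq_iff)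
    then show "act g (word_elt u \<otimes>\<^bsub>TA\<^esub> 0) = act g (word_elt u) \<otimes>\<^bsub>TA\<^esub> act g 0" by (simp del: zero_fun_apply)
  next
    case (add b v t)
    have "act g (word_elt u \<otimes>\<^bsub>TA\<^esub> word_elt v) = act g (word_elt u) \<otimes>\<^bsub>TA\<^esub> act g (word_elt v)"
      using \<open>u \<in> W\<close> \<open>v \<in> W\<close> g
      by (simp add: act_word_elt word_elt_mult free_calg_smult_mult) (simp add: fun_eq_iff)
    moreover have "x \<otimes>\<^bsub>TA\<^esub> (y + (\<lambda>w. t * z w)) = x \<otimes>\<^bsub>TA\<^esub> y + (\<lambda>w. t * (x \<otimes>\<^bsub>TA\<^esub> z) w)" for x y z
      by (simp add: free_calg_mult fun_eq_iff algebra_simps sum.distrib sum_distrib_left)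
    ultimately show "act g (word_elt u \<otimes>\<^bsub>TA\<^esub> (b + (\<lambda>w. t * word_elt v w)))
        = act g (word_elt u) \<otimes>\<^bsub>TA\<^esub> act g (b + (\<lambda>w. t * word_elt v w))"
      using add.IH by (simp only: act_add act_smult)
  qed
  have "(y + (\<lambda>w. s * z w)) \<otimes>\<^bsub>TA\<^esub> x = y \<otimes>\<^bsub>TA\<^esub> x + (\<lambda>w. s * (z \<otimes>\<^bsub>TA\<^esub> x) w)" for x y z
    by (simp add: free_calg_mult fun_eq_iff algebra_simps sum.distrib sum_distrib_left)
  with word show "act g ((a + (\<lambda>w. s * word_elt u w)) \<otimes>\<^bsub>TA\<^esub> b) = act g (a + (\<lambda>w. s * word_elt u w)) \<otimes>\<^bsub>TA\<^esub> act g b"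
    using add.IH by (simp only: act_add act_smult)
qed

lemma act_inv:
  assumes "g \<in> carrier G" "a \<in> carrier TA"
  shows "act g (act (inv\<^bsub>G\<^esub> g) a) = a"
  using assms(2)
proof (induction rule: free_calg_induct)
  case zero
  show "act g (act (inv\<^bsub>G\<^esub> g) 0) = 0" by (simp del: zero_fun_apply)
next
  case (add a u s)
  have "cw (inv\<^bsub>G\<^esub> g) u * cw g (pw (inv\<^bsub>G\<^esub> g) u) = 1"
    using cw_mult[of g "inv\<^bsub>G\<^esub> g" u] assms \<open>u \<in> W\<close> by (simp add: mult.commute)
  then have "act g (act (inv\<^bsub>G\<^esub> g) (word_elt u)) = word_elt u"
    using assms \<open>u \<in> W\<close> by (simp add: act_word_elt act_smult fun_eq_iff flip: mult.assoc)
  with add.IH show "act g (act (inv\<^bsub>G\<^esub> g) (a + (\<lambda>w. s * word_elt u w))) = a + (\<lambda>w. s * word_elt u w)"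
    by (simp only: act_add act_smult)
qed

text \<open>The element a g of R. For g = 1 this embeds the tensor algebra into R as a subalgebra,
  which lets ideals be pulled back along it.\<close>

definition single :: "'g \<Rightarrow> (nat list \<Rightarrow> complex) \<Rightarrow> 'g \<Rightarrow> nat list \<Rightarrow> complex" where
  "single g a = (\<lambda>h. if h = g then a else 0)"

lemma single_carrier [simp]: "g \<in> carrier G \<Longrightarrow> a \<in> carrier TA \<Longrightarrow> single g a \<in> carrier R"
  using TA.zero_closed by (auto simp: R_carrier single_def)

lemma single_add: "single g (a + b) = single g a + single g b"
  by (auto simp: single_def fun_eq_iff)

lemma act_one: "a \<in> carrier TA \<Longrightarrow> act \<one>\<^bsub>G\<^esub> a = a"
proof
  fix w assume a: "a \<in> carrier TA"
  show "act \<one>\<^bsub>G\<^esub> a w = a w"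
  proof (cases "w \<in> W")
    case True
    then show ?thesis by (simp add: act_eq)
  next
    case False
    with a have "a w = 0" by (auto simp: free_calg_carrier)
    with False show ?thesis by (simp add: act_outside)
  qed
qed

lemma single_mult:
  assumes "g \<in> carrier G" "h \<in> carrier G" "a \<in> carrier TA" "b \<in> carrier TA"
  shows "single g a \<otimes>\<^bsub>R\<^esub> single h b = single (g \<otimes>\<^bsub>G\<^esub> h) (a \<otimes>\<^bsub>TA\<^esub> act g b)"
proof
  fix k
  have zero: "0 \<otimes>\<^bsub>TA\<^esub> x = 0" "x \<otimes>\<^bsub>TA\<^esub> 0 = 0" for x
    by (auto simp: free_calg_mult fun_eq_iff)
  show "(single g a \<otimes>\<^bsub>R\<^esub> single h b) k = single (g \<otimes>\<^bsub>G\<^esub> h) (a \<otimes>\<^bsub>TA\<^esub> act g b) k"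
  proof (cases "k \<in> carrier G")
    case True
    then have "(single g a \<otimes>\<^bsub>R\<^esub> single h b) k
        = (\<Sum>g'\<in>carrier G. if g' = g then a \<otimes>\<^bsub>TA\<^esub> act g (single h b (inv\<^bsub>G\<^esub> g \<otimes>\<^bsub>G\<^esub> k)) else 0)"
      unfolding R_mult[OF single_carrier single_carrier, OF assms(1,3) assms(2,4)]
      by (auto simp: single_def zero intro!: sum.cong)
    also have "\<dots> = a \<otimes>\<^bsub>TA\<^esub> act g (single h b (inv\<^bsub>G\<^esub> g \<otimes>\<^bsub>G\<^esub> k))"
      using assms finG by simp
    also have "\<dots> = single (g \<otimes>\<^bsub>G\<^esub> h) (a \<otimes>\<^bsub>TA\<^esub> act g b) k"
    proof -
      have "inv\<^bsub>G\<^esub> g \<otimes>\<^bsub>G\<^esub> k = h \<longleftrightarrow> k = g \<otimes>\<^bsub>G\<^esub> h"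
        using assms True by (metis G.inv_closed G.inv_solve_left)
      then show ?thesis by (auto simp: single_def zero)
    qed
    finally show ?thesis .
  next
    case False
    then have "(single g a \<otimes>\<^bsub>R\<^esub> single h b) k = 0" using assms by (simp add: R_mult)
    moreover have "k \<noteq> g \<otimes>\<^bsub>G\<^esub> h" using False assms by auto
    ultimately show ?thesis by (simp add: single_def)
  qed
qed

lemma R_finsum:
  assumes "finite S" "\<And>x. x \<in> S \<Longrightarrow> f x \<in> carrier R"
  shows "finsum R f S = (\<Sum>x\<in>S. f x)"
  using assms
proof (induction S rule: finite_induct)
  case (insert x S)
  then have "finsum R f (insert x S) = f x \<oplus>\<^bsub>R\<^esub> finsum R f S" by (intro R.finsum_insert) auto
  with insert show ?case by simp
qed simp

lemma R_eq_sum_single: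
  assumes "f \<in> carrier R"
  shows "f = (\<Sum>g\<in>carrier G. single g (f g))"
proof
  fix h
  have "(\<Sum>g\<in>carrier G. single g (f g)) h = (\<Sum>g\<in>carrier G. if g = h then f h else 0)"
    by (subst sum_fun_apply) (auto simp: single_def intro!: sum.cong)
  then show "f h = (\<Sum>g\<in>carrier G. single g (f g)) h"
    using assms finG by (auto simp: R_carrier)
qed

section \<open>The grading of the skew group algebra by word length\<close>

definition hcomp :: "nat \<Rightarrow> ('g \<Rightarrow> nat list \<Rightarrow> complex) \<Rightarrow> 'g \<Rightarrow> nat list \<Rightarrow> complex" where
  "hcomp k f = (\<lambda>g w. if length w = k then f g w else 0)"

lemma hcomp_carrier [simp]: "f \<in> carrier R \<Longrightarrow> hcomp k f \<in> carrier R"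
  unfolding R_carrier free_calg_carrier hcomp_def fun_eq_iff
  by (auto elim!: ballE intro: finite_subset[rotated])

lemma hcomp_add: "hcomp k (f + h) = hcomp k f + hcomp k h"
  by (auto simp: hcomp_def fun_eq_iff)

lemma hcomp_sc: "hcomp k (sc s f) = sc s (hcomp k f)"
  by (auto simp: hcomp_def sc_def fun_eq_iff)

lemma hcomp_zero [simp]: "hcomp k 0 = 0"
  by (auto simp: hcomp_def fun_eq_iff)

lemma hcomp_diff: "hcomp k (f - h) = hcomp k f - hcomp k h"
  by (auto simp: hcomp_def fun_eq_iff)

lemma hcomp_hcomp: "hcomp j (hcomp k f) = (if j = k then hcomp k f else 0)"
  by (auto simp: hcomp_def fun_eq_iff)

lemma hcomp_sum: "hcomp k (\<Sum>x\<in>S. f x) = (\<Sum>x\<in>S. hcomp k (f x))"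
  by (induction S rule: infinite_finite_induct) (auto simp: hcomp_add simp del: zero_fun_apply plus_fun_apply)

lemma hcomp_bas: "hcomp k (bas u g) = (if length u = k then bas u g else 0)"
  by (auto simp: hcomp_def bas_def word_elt_def fun_eq_iff)

lemma hcomp_mult_bas:
  assumes "u \<in> W" "g \<in> carrier G" "v \<in> W" "h \<in> carrier G"
  shows "hcomp k (bas u g \<otimes>\<^bsub>R\<^esub> bas v h) = (\<Sum>j\<le>k. hcomp j (bas u g) \<otimes>\<^bsub>R\<^esub> hcomp (k - j) (bas v h))"
proof -
  have "(\<Sum>j\<le>k. hcomp j (bas u g) \<otimes>\<^bsub>R\<^esub> hcomp (k - j) (bas v h))
     = (\<Sum>j\<le>k. if j = length u then (if length u + length v = k then bas u g \<otimes>\<^bsub>R\<^esub> bas v h else 0) else 0)"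
    using assms by (intro sum.cong) (auto simp: hcomp_bas R_zero_mult R_zero_closed)
  also have "\<dots> = (if length u + length v = k then bas u g \<otimes>\<^bsub>R\<^esub> bas v h else 0)"
    by auto
  also have "\<dots> = hcomp k (bas u g \<otimes>\<^bsub>R\<^esub> bas v h)"
    using assms by (simp add: bas_mult hcomp_sc hcomp_bas sc_simps)
  finally show ?thesis by simp
qed

text \<open>Group elements act letter by letter and so preserve the length of words; on basis
  elements a single summand survives.\<close>

lemma hcomp_mult:
  assumes "f \<in> carrier R" "h \<in> carrier R"
  shows "hcomp k (f \<otimes>\<^bsub>R\<^esub> h) = (\<Sum>j\<le>k. hcomp j f \<otimes>\<^bsub>R\<^esub> hcomp (k - j) h)"
  using assms(1)
proof (induction rule: R_induct)
  case zero
  show "hcomp k (0 \<otimes>\<^bsub>R\<^esub> h) = (\<Sum>j\<le>k. hcomp j 0 \<otimes>\<^bsub>R\<^esub> hcomp (k - j) h)"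
    using assms by (simp add: R_zero_mult del: zero_fun_apply)
next
  case (add f u g s)
  have word: "hcomp k (bas u g \<otimes>\<^bsub>R\<^esub> h) = (\<Sum>j\<le>k. hcomp j (bas u g) \<otimes>\<^bsub>R\<^esub> hcomp (k - j) h)"
    using assms(2)
  proof (induction rule: R_induct)
    case zero
    show "hcomp k (bas u g \<otimes>\<^bsub>R\<^esub> 0) = (\<Sum>j\<le>k. hcomp j (bas u g) \<otimes>\<^bsub>R\<^esub> hcomp (k - j) 0)"
      using add by (simp add: R_zero_mult del: zero_fun_apply)
  next
    case (add h v g' t)
    have "hcomp k (bas u g \<otimes>\<^bsub>R\<^esub> (h + sc t (bas v g'))) = hcomp k (bas u g \<otimes>\<^bsub>R\<^esub> h) + sc t (hcomp k (bas u g \<otimes>\<^bsub>R\<^esub> bas v g'))"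
      using add \<open>u \<in> W\<close> \<open>g \<in> carrier G\<close> by (simp add: R_bilinear_simps hcomp_add hcomp_sc)
    also have "\<dots> = (\<Sum>j\<le>k. hcomp j (bas u g) \<otimes>\<^bsub>R\<^esub> hcomp (k - j) h + sc t (hcomp j (bas u g) \<otimes>\<^bsub>R\<^esub> hcomp (k - j) (bas v g')))"
      using add \<open>u \<in> W\<close> \<open>g \<in> carrier G\<close> by (simp add: hcomp_mult_bas sum.distrib sc_sum)
    also have "\<dots> = (\<Sum>j\<le>k. hcomp j (bas u g) \<otimes>\<^bsub>R\<^esub> hcomp (k - j) (h + sc t (bas v g')))"
      using add \<open>u \<in> W\<close> \<open>g \<in> carrier G\<close> by (simp add: hcomp_add hcomp_sc R_bilinear_simps)
    finally show "hcomp k (bas u g \<otimes>\<^bsub>R\<^esub> (h + sc t (bas v g')))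
      = (\<Sum>j\<le>k. hcomp j (bas u g) \<otimes>\<^bsub>R\<^esub> hcomp (k - j) (h + sc t (bas v g')))" .
  qed
  have "hcomp k ((f + sc s (bas u g)) \<otimes>\<^bsub>R\<^esub> h) = hcomp k (f \<otimes>\<^bsub>R\<^esub> h) + sc s (hcomp k (bas u g \<otimes>\<^bsub>R\<^esub> h))"
    using add assms by (simp add: R_bilinear_simps hcomp_add hcomp_sc)
  also have "\<dots> = (\<Sum>j\<le>k. hcomp j f \<otimes>\<^bsub>R\<^esub> hcomp (k - j) h + sc s (hcomp j (bas u g) \<otimes>\<^bsub>R\<^esub> hcomp (k - j) h))"
    by (simp add: add.IH word sum.distrib sc_sum)
  also have "\<dots> = (\<Sum>j\<le>k. hcomp j (f + sc s (bas u g)) \<otimes>\<^bsub>R\<^esub> hcomp (k - j) h)"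
    using add assms by (simp add: hcomp_add hcomp_sc R_bilinear_simps)
  finally show "hcomp k ((f + sc s (bas u g)) \<otimes>\<^bsub>R\<^esub> h) = (\<Sum>j\<le>k. hcomp j (f + sc s (bas u g)) \<otimes>\<^bsub>R\<^esub> hcomp (k - j) h)" .
qed

lemma finite_hcomp_support:
  assumes "f \<in> carrier R"
  shows "finite {k. hcomp k f \<noteq> 0}"
proof -
  have "{k. hcomp k f \<noteq> 0} \<subseteq> (\<lambda>(g, w). length w) ` {(g, w). f g w \<noteq> 0}"
  proof
    fix k assume "k \<in> {k. hcomp k f \<noteq> 0}"
    then obtain g w where "hcomp k f g w \<noteq> 0" by (auto simp: fun_eq_iff)
    then show "k \<in> (\<lambda>(g, w). length w) ` {(g, w). f g w \<noteq> 0}"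
      by (intro image_eqI[of _ _ "(g, w)"]) (auto simp: hcomp_def split: if_splits)
  qed
  then show ?thesis using R_finite_support[OF assms] by (rule finite_subset[OF _ finite_imageI])
qed

text \<open>The bound is strict so that \<open>Rlt 0\<close> is zero: the preimage of step k of the
  filtration is described by \<open>Rlt (Suc k)\<close>, and the step before it by
  \<open>Rlt k\<close>, also for k = 0.\<close>

definition Rlt :: "nat \<Rightarrow> ('g \<Rightarrow> nat list \<Rightarrow> complex) set" where
  "Rlt k = {f \<in> carrier R. \<forall>g w. f g w \<noteq> 0 \<longrightarrow> length w < k}"

definition Rhom :: "nat \<Rightarrow> ('g \<Rightarrow> nat list \<Rightarrow> complex) set" where
  "Rhom k = {f \<in> carrier R. \<forall>g w. f g w \<noteq> 0 \<longrightarrow> length w = k}"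

lemma Rlt_carrier: "f \<in> Rlt k \<Longrightarrow> f \<in> carrier R"
  by (simp add: Rlt_def)

lemma Rlt_zero_iff: "f \<in> Rlt 0 \<longleftrightarrow> f = 0"
  using R_zero_closed by (auto simp: Rlt_def) (auto simp: fun_eq_iff)

lemma Rlt_closed:
  "0 \<in> Rlt k" "f \<in> Rlt k \<Longrightarrow> h \<in> Rlt k \<Longrightarrow> f + h \<in> Rlt k" "f \<in> Rlt k \<Longrightarrow> sc s f \<in> Rlt k"
  using R_zero_closed R_add_closed R_smult_closed
  by (auto simp: Rlt_def sc_def) (metis add_0)+

lemma Rlt_mono: "f \<in> Rlt k \<Longrightarrow> k \<le> l \<Longrightarrow> f \<in> Rlt l"
  by (force simp: Rlt_def)

lemma R_mult_support:
  assumes "f \<in> carrier R" "h \<in> carrier R" "(f \<otimes>\<^bsub>R\<^esub> h) k w \<noteq> 0"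
  shows "\<exists>g u g' v. f g u \<noteq> 0 \<and> h g' v \<noteq> 0 \<and> length w = length u + length v"
proof -
  have "(\<Sum>g\<in>carrier G. (f g \<otimes>\<^bsub>TA\<^esub> act g (h (inv\<^bsub>G\<^esub> g \<otimes>\<^bsub>G\<^esub> k))) w) \<noteq> 0"
    using assms by (auto simp: R_mult sum_fun_apply split: if_splits)
  then obtain g where g: "g \<in> carrier G" "(f g \<otimes>\<^bsub>TA\<^esub> act g (h (inv\<^bsub>G\<^esub> g \<otimes>\<^bsub>G\<^esub> k))) w \<noteq> 0"
    by (rule sum.not_neutral_contains_not_neutral)
  then have "(\<Sum>j\<le>length w. f g (take j w) * act g (h (inv\<^bsub>G\<^esub> g \<otimes>\<^bsub>G\<^esub> k)) (drop j w)) \<noteq> 0"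
    by (simp add: free_calg_mult)
  then obtain j where j: "j \<le> length w" "f g (take j w) * act g (h (inv\<^bsub>G\<^esub> g \<otimes>\<^bsub>G\<^esub> k)) (drop j w) \<noteq> 0"
    by (metis (no_types, lifting) atMost_iff sum.not_neutral_contains_not_neutral)
  then have "drop j w \<in> W" using act_outside by fastforce
  with j g have "h (inv\<^bsub>G\<^esub> g \<otimes>\<^bsub>G\<^esub> k) (pw (inv\<^bsub>G\<^esub> g) (drop j w)) \<noteq> 0" by (auto simp: act_eq)
  moreover have "f g (take j w) \<noteq> 0" using j by simp
  moreover have "length w = length (take j w) + length (pw (inv\<^bsub>G\<^esub> g) (drop j w))" using j by simp
  ultimately show ?thesis by blast
qed

text \<open>A factor of degree at most i times one of degree less than j, the combination that
  occurs when lower order terms are multiplied.\<close>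

lemma Rlt_mult:
  assumes "f \<in> Rlt (Suc i)" "h \<in> Rlt j"
  shows "f \<otimes>\<^bsub>R\<^esub> h \<in> Rlt (i + j)" "h \<otimes>\<^bsub>R\<^esub> f \<in> Rlt (j + i)"
proof -
  have c: "f \<in> carrier R" "h \<in> carrier R" using assms Rlt_carrier by auto
  have l: "f g w \<noteq> 0 \<Longrightarrow> length w \<le> i" "h g w \<noteq> 0 \<Longrightarrow> length w < j" for g w
    using assms by (fastforce simp: Rlt_def)+
  show "f \<otimes>\<^bsub>R\<^esub> h \<in> Rlt (i + j)"
    using R_mult_support[OF c] l R_mult_closed[OF c] unfolding Rlt_def by fastforce
  show "h \<otimes>\<^bsub>R\<^esub> f \<in> Rlt (j + i)"
    using R_mult_support[OF c(2,1)] l R_mult_closed[OF c(2,1)] unfolding Rlt_def by fastforce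
qed

lemma hcomp_Rlt: "f \<in> carrier R \<Longrightarrow> hcomp k f \<in> Rlt (Suc k)"
  by (auto simp: Rlt_def) (auto simp: hcomp_def split: if_splits)

lemma diff_hcomp_Rlt: "f \<in> Rlt (Suc k) \<Longrightarrow> f - hcomp k f \<in> Rlt k"
  using R_diff_closed[of f "hcomp k f"] by (auto simp: Rlt_def) (auto simp: hcomp_def less_Suc_eq split: if_splits)

lemma hcomp_Rhom: "f \<in> carrier R \<Longrightarrow> hcomp k f \<in> Rhom k"
  by (auto simp: Rhom_def) (auto simp: hcomp_def split: if_splits)

lemma Rhom_hcomp: "f \<in> Rhom k \<Longrightarrow> hcomp j f = (if j = k then f else 0)"
  by (auto simp: Rhom_def hcomp_def fun_eq_iff)

lemma Rhom_carrier: "f \<in> Rhom k \<Longrightarrow> f \<in> carrier R"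
  by (simp add: Rhom_def)

end

section \<open>The projections of T(V) x G onto gr H and onto S_q(V) x G\<close>

context quantum_data begin

definition I0 :: "(nat list \<Rightarrow> complex) set" where
  "I0 = genideal TA {(\<lambda>w. word_elt [i, j] w - q i j * word_elt [j, i] w) | i j. i < N \<and> j < N}"

definition tgen :: "nat \<Rightarrow> nat \<Rightarrow> nat list \<Rightarrow> complex" where
  "tgen i j = (\<lambda>w. word_elt [i, j] w - q i j * word_elt [j, i] w)"

lemma I0_eq: "I0 = genideal TA {tgen i j | i j. i < N \<and> j < N}"
  by (simp add: I0_def tgen_def)

lemma tgen_eq: "tgen i j = word_elt [i, j] + (\<lambda>w. - q i j * word_elt [j, i] w)"
  by (simp add: tgen_def fun_eq_iff)

lemma tgen_carrier [simp]: "i < N \<Longrightarrow> j < N \<Longrightarrow> tgen i j \<in> carrier TA"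
  using TA.a_closed[of "word_elt [i, j]" "\<lambda>w. - q i j * word_elt [j, i] w"]
  unfolding tgen_eq by (simp add: free_calg_smult_closed del: mult_minus_left)

lemma I0_ideal: "ideal I0 TA"
  unfolding I0_eq by (rule TA.genideal_ideal) auto

lemma tgen_I0: "i < N \<Longrightarrow> j < N \<Longrightarrow> tgen i j \<in> I0"
  unfolding I0_eq by (rule subsetD[OF TA.genideal_self]) auto

sublocale HQ: quotient_algebra J R
  by (intro quotient_algebra.intro R_algebra J_ideal)

sublocale SQ: quotient_algebra I0 TA
  by (intro quotient_algebra.intro TA_algebra I0_ideal)

abbreviation H :: "('a \<Rightarrow> nat list \<Rightarrow> complex) set calg" where "H \<equiv> quot_calg R J"
abbreviation S :: "(nat list \<Rightarrow> complex) set calg" where "S \<equiv> quot_calg TA I0"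

definition Sact :: "'a \<Rightarrow> (nat list \<Rightarrow> complex) set \<Rightarrow> (nat list \<Rightarrow> complex) set" where
  "Sact g X = act g ` X"

abbreviation SG :: "('a \<Rightarrow> (nat list \<Rightarrow> complex) set) calg" where "SG \<equiv> skew_group_calg S G Sact"

definition Hfilt :: "nat \<Rightarrow> ('a \<Rightarrow> nat list \<Rightarrow> complex) set set" where
  "Hfilt k = {HQ.proj f | f. f \<in> carrier R \<and> (\<forall>g w. f g w \<noteq> 0 \<longrightarrow> length w \<le> k)}"

definition SGcomp :: "nat \<Rightarrow> ('a \<Rightarrow> (nat list \<Rightarrow> complex) set) set" where
  "SGcomp k = {f \<in> carrier SG. \<forall>g\<in>carrier G. \<exists>a\<in>carrier TA. (\<forall>w. a w \<noteq> 0 \<longrightarrow> length w = k) \<and> f g = SQ.proj a}"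

definition qdh :: bool where
  "qdh \<longleftrightarrow> graded_isomorphic (assoc_graded H Hfilt) (assoc_graded_comp H Hfilt) SG SGcomp"

lemma J_closed: "0 \<in> J" "f \<in> J \<Longrightarrow> h \<in> J \<Longrightarrow> f + h \<in> J" "f \<in> J \<Longrightarrow> sc s f \<in> J"
  "f \<in> J \<Longrightarrow> h \<in> J \<Longrightarrow> f - h \<in> J"
proof -
  show 1: "0 \<in> J" "\<And>f h. f \<in> J \<Longrightarrow> h \<in> J \<Longrightarrow> f + h \<in> J" "\<And>f s. f \<in> J \<Longrightarrow> sc s f \<in> J" for f h s
    using HQ.zero_closed HQ.a_closed HQ.I_smult by simp_all
  show "f \<in> J \<Longrightarrow> h \<in> J \<Longrightarrow> f - h \<in> J"
    using 1(2)[of f "- h"] 1(3)[of h "-1"] by (simp add: uminus_eq_sc[symmetric])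
qed

lemma J_mult: "f \<in> J \<Longrightarrow> h \<in> carrier R \<Longrightarrow> f \<otimes>\<^bsub>R\<^esub> h \<in> J" "f \<in> J \<Longrightarrow> h \<in> carrier R \<Longrightarrow> h \<otimes>\<^bsub>R\<^esub> f \<in> J"
  by (auto intro: HQ.I_r_closed HQ.I_l_closed)

lemma Hfilt_eq: "Hfilt k = HQ.proj ` Rlt (Suc k)"
  by (auto simp: Hfilt_def Rlt_def less_Suc_eq_le)

lemma proj_eq: "f \<in> carrier R \<Longrightarrow> h \<in> carrier R \<Longrightarrow> HQ.proj f = HQ.proj h \<longleftrightarrow> f - h \<in> J"
  by (simp add: HQ.proj_eq_iff R_minus)

lemma filtered: "filtered_algebra H Hfilt"
proof (intro filtered_algebra.intro HQ.Q_algebra filtered_algebra_axioms.intro)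
  interpret Q: ring H by (rule HQ.Q_ring)
  show "additive_subgroup (Hfilt k) H" for k
  proof (intro additive_subgroup.intro Q.add.subgroupI)
    show "Hfilt k \<subseteq> carrier H" using Rlt_carrier by (auto simp: Hfilt_eq)
    show "Hfilt k \<noteq> {}" using Rlt_closed(1) by (auto simp: Hfilt_eq)
    fix x assume "x \<in> Hfilt k"
    then obtain f where f: "f \<in> Rlt (Suc k)" "x = HQ.proj f" by (auto simp: Hfilt_eq)
    have "HQ.proj (- f) \<oplus>\<^bsub>H\<^esub> HQ.proj f = \<zero>\<^bsub>H\<^esub>"
      using f Rlt_carrier R_uminus_closed by (simp add: HQ.proj_add HQ.proj_zero)
    then have "\<ominus>\<^bsub>H\<^esub> x = HQ.proj (- f)"
      using f Rlt_carrier R_uminus_closed by (intro Q.minus_equality) auto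
    moreover have "- f \<in> Rlt (Suc k)" using f Rlt_closed(3)[of f _ "-1"] by (simp add: uminus_eq_sc)
    ultimately show "\<ominus>\<^bsub>H\<^esub> x \<in> Hfilt k" by (auto simp: Hfilt_eq)
    fix y assume "y \<in> Hfilt k"
    then obtain h where h: "h \<in> Rlt (Suc k)" "y = HQ.proj h" by (auto simp: Hfilt_eq)
    show "x \<oplus>\<^bsub>H\<^esub> y \<in> Hfilt k"
      using f h Rlt_carrier Rlt_closed(2) by (auto simp: Hfilt_eq HQ.proj_add)
  qed
  show "Hfilt k \<subseteq> Hfilt (Suc k)" for k
    unfolding Hfilt_eq using Rlt_mono[of _ "Suc k" "Suc (Suc k)"] by (intro image_mono subsetI) simp
  show "x \<otimes>\<^bsub>H\<^esub> y \<in> Hfilt (i + j)" if "x \<in> Hfilt i" "y \<in> Hfilt j" for x y i j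
  proof -
    from that obtain f h where *: "f \<in> Rlt (Suc i)" "x = HQ.proj f" "h \<in> Rlt (Suc j)" "y = HQ.proj h"
      by (auto simp: Hfilt_eq)
    have "f \<otimes>\<^bsub>R\<^esub> h \<in> Rlt (Suc (i + j))" using Rlt_mult(1)[of f i h "Suc j"] * by simp
    then show ?thesis using * Rlt_carrier by (auto simp: Hfilt_eq HQ.proj_mult)
  qed
  have "bas [] \<one>\<^bsub>G\<^esub> \<in> Rlt (Suc 0)"
    using bas_carrier[of "[]" "\<one>\<^bsub>G\<^esub>"] by (auto simp: Rlt_def) (auto simp: bas_def word_elt_def split: if_splits)
  then show "\<one>\<^bsub>H\<^esub> \<in> Hfilt 0" by (auto simp: Hfilt_eq HQ.proj_one)
  show "s \<odot>\<^bsub>H\<^esub> x \<in> Hfilt k" if "x \<in> Hfilt k" for x s k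
    using that Rlt_carrier Rlt_closed(3) by (auto simp: Hfilt_eq HQ.proj_smult)
qed

sublocale HF: filtered_algebra H Hfilt by (rule filtered)

lemma HP_eq: "HF.P k = HQ.proj ` Rlt k"
proof (cases k)
  case 0
  have "Rlt 0 = {0}" using Rlt_zero_iff by blast
  with 0 show ?thesis by (simp add: filt_pred_def HQ.proj_zero)
qed (simp add: filt_pred_def Hfilt_eq)

lemma proj_in_HP: "f \<in> carrier R \<Longrightarrow> HQ.proj f \<in> HF.P k \<longleftrightarrow> (\<exists>r\<in>Rlt k. f - r \<in> J)"
  using proj_eq Rlt_carrier by (auto simp: HP_eq image_iff)

text \<open>The projection of R onto gr H. Each homogeneous component is sent to its own degree,
  which is what makes the map multiplicative although H is only filtered.\<close>

definition Psi :: "('a \<Rightarrow> nat list \<Rightarrow> complex) \<Rightarrow> nat \<Rightarrow> ('a \<Rightarrow> nat list \<Rightarrow> complex) set set" where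
  "Psi f = HF.cls (\<lambda>k. HQ.proj (hcomp k f))"

definition Theta :: "('a \<Rightarrow> nat list \<Rightarrow> complex) \<Rightarrow> 'a \<Rightarrow> (nat list \<Rightarrow> complex) set" where
  "Theta f = (\<lambda>g. SQ.proj (f g))"

lemma proj_hcomp_F: "f \<in> carrier R \<Longrightarrow> HQ.proj (hcomp k f) \<in> Hfilt k"
  using hcomp_Rlt by (auto simp: Hfilt_eq)

lemma proj_minus: "f \<in> carrier R \<Longrightarrow> h \<in> carrier R \<Longrightarrow> HQ.proj f \<ominus>\<^bsub>H\<^esub> HQ.proj h = HQ.proj (f - h)"
proof -
  assume *: "f \<in> carrier R" "h \<in> carrier R"
  then have "\<ominus>\<^bsub>H\<^esub> HQ.proj h = HQ.proj (- h)"
    by (intro HF.minus_equality) (auto simp: HQ.proj_add HQ.proj_zero R_uminus_closed)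
  with * show ?thesis by (simp add: a_minus_def HQ.proj_add R_uminus_closed)
qed

lemma Psi_eq_iff:
  assumes "f \<in> carrier R" "h \<in> carrier R"
  shows "Psi f = Psi h \<longleftrightarrow> (\<forall>k. \<exists>r\<in>Rlt k. hcomp k (f - h) - r \<in> J)"
proof -
  have "Psi f = Psi h \<longleftrightarrow> (\<forall>k. HQ.proj (hcomp k f) \<ominus>\<^bsub>H\<^esub> HQ.proj (hcomp k h) \<in> HF.P k)"
    unfolding Psi_def using assms by (intro HF.cls_eq_iff) simp_all
  also have "\<dots> \<longleftrightarrow> (\<forall>k. HQ.proj (hcomp k (f - h)) \<in> HF.P k)"
    using assms by (simp only: proj_minus hcomp_carrier hcomp_diff)
  also have "\<dots> \<longleftrightarrow> (\<forall>k. \<exists>r\<in>Rlt k. hcomp k (f - h) - r \<in> J)"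
    using assms by (simp only: proj_in_HP hcomp_carrier R_diff_closed)
  finally show ?thesis .
qed

lemma Psi_carrier: "carrier HF.gr = Psi ` carrier R"
proof (intro equalityI subsetI)
  fix a assume "a \<in> Psi ` carrier R"
  then obtain f where f: "f \<in> carrier R" "a = Psi f" by blast
  have "{k. HQ.proj (hcomp k f) \<notin> HF.P k} \<subseteq> {k. hcomp k f \<noteq> 0}"
    using Rlt_closed(1) by (auto simp: HP_eq)
  then have "finite {k. HQ.proj (hcomp k f) \<notin> HF.P k}"
    using finite_hcomp_support[OF f(1)] by (rule finite_subset)
  then show "a \<in> carrier HF.gr"
    unfolding HF.gr_carrier using f proj_hcomp_F[OF f(1)]
    by (intro exI[of _ "\<lambda>k. HQ.proj (hcomp k f)"]) (simp add: Psi_def)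
next
  fix a assume "a \<in> carrier HF.gr"
  then obtain x where x: "\<forall>k. x k \<in> Hfilt k" "finite {k. x k \<notin> HF.P k}" "a = HF.cls x"
    unfolding HF.gr_carrier by blast
  from x(1) have "\<forall>k. \<exists>f. f \<in> Rlt (Suc k) \<and> x k = HQ.proj f" by (auto simp: Hfilt_eq)
  then obtain f where f: "\<And>k. f k \<in> Rlt (Suc k)" "\<And>k. x k = HQ.proj (f k)" by metis
  let ?K = "{k. x k \<notin> HF.P k}"
  \<comment> \<open>Modulo the preceding filtration step a representative in degree k only matters
    through its component of degree k. Restricting to the finite set of nonzero degrees makes the
    sum an element of R.\<close>
  define e where "e = (\<Sum>k\<in>?K. hcomp k (f k))"
  have e: "e \<in> carrier R" unfolding e_def using Rlt_carrier[OF f(1)] by (intro R_sum_closed) simp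
  have he: "hcomp k e = (if k \<in> ?K then hcomp k (f k) else 0)" for k
  proof -
    have "hcomp k e = (\<Sum>l\<in>?K. if l = k then hcomp k (f k) else 0)"
      unfolding e_def hcomp_sum by (intro sum.cong) (auto simp: hcomp_hcomp)
    then show ?thesis using x(2) by simp
  qed
  have "x k \<ominus>\<^bsub>H\<^esub> HQ.proj (hcomp k e) \<in> HF.P k" for k
  proof (cases "k \<in> ?K")
    case True
    have "HQ.proj (f k - hcomp k (f k)) \<in> HF.P k"
      using diff_hcomp_Rlt[OF f(1)] by (auto simp: HP_eq)
    then show ?thesis using True f Rlt_carrier[OF f(1)] by (simp add: proj_minus he)
  next
    case False
    then have "x k \<in> HF.P k" by simp
    moreover have "x k \<ominus>\<^bsub>H\<^esub> HQ.proj (hcomp k e) = x k"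
      using False f Rlt_carrier[OF f(1)] R_zero_closed by (simp add: he proj_minus)
    ultimately show ?thesis by simp
  qed
  then have "a = Psi e"
    unfolding Psi_def x(3) using x(1) e HF.F_carrier by (subst HF.cls_eq_iff) auto
  with e show "a \<in> Psi ` carrier R" by blast
qed

lemma Psi_hom:
  assumes "f \<in> carrier R" "h \<in> carrier R"
  shows "Psi (f + h) = Psi f \<oplus>\<^bsub>HF.gr\<^esub> Psi h" "Psi (f \<otimes>\<^bsub>R\<^esub> h) = Psi f \<otimes>\<^bsub>HF.gr\<^esub> Psi h"
    "Psi (sc s f) = s \<odot>\<^bsub>HF.gr\<^esub> Psi f" "Psi (bas [] \<one>\<^bsub>G\<^esub>) = \<one>\<^bsub>HF.gr\<^esub>"
proof -
  show "Psi (f + h) = Psi f \<oplus>\<^bsub>HF.gr\<^esub> Psi h"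
    unfolding Psi_def using assms by (subst HF.gr_add) (auto simp: HQ.proj_add hcomp_add)
  show "Psi (sc s f) = s \<odot>\<^bsub>HF.gr\<^esub> Psi f"
    unfolding Psi_def using assms by (subst HF.gr_smult) (auto simp: HQ.proj_smult hcomp_sc)
  have "HQ.proj (hcomp k (bas [] \<one>\<^bsub>G\<^esub>)) = (if k = 0 then \<one>\<^bsub>H\<^esub> else \<zero>\<^bsub>H\<^esub>)" for k
    by (simp add: hcomp_bas HQ.proj_one HQ.proj_zero)
  then show "Psi (bas [] \<one>\<^bsub>G\<^esub>) = \<one>\<^bsub>HF.gr\<^esub>"
    unfolding Psi_def HF.gr_one by presburger
  have "(\<lambda>k. HQ.proj (hcomp k (f \<otimes>\<^bsub>R\<^esub> h)))
    = (\<lambda>k. finsum H (\<lambda>j. HQ.proj (hcomp j f) \<otimes>\<^bsub>H\<^esub> HQ.proj (hcomp (k - j) h)) {..k})"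
  proof
    fix k
    have "finsum H (\<lambda>j. HQ.proj (hcomp j f \<otimes>\<^bsub>R\<^esub> hcomp (k - j) h)) {..k}
        = HQ.proj (finsum R (\<lambda>j. hcomp j f \<otimes>\<^bsub>R\<^esub> hcomp (k - j) h) {..k})"
      using assms by (intro HQ.proj_finsum) (auto simp: R_mult_closed)
    also have "finsum R (\<lambda>j. hcomp j f \<otimes>\<^bsub>R\<^esub> hcomp (k - j) h) {..k} = hcomp k (f \<otimes>\<^bsub>R\<^esub> h)"
      unfolding hcomp_mult[OF assms] using assms by (intro R_finsum) (auto simp: R_mult_closed)
    finally show "HQ.proj (hcomp k (f \<otimes>\<^bsub>R\<^esub> h))
        = finsum H (\<lambda>j. HQ.proj (hcomp j f) \<otimes>\<^bsub>H\<^esub> HQ.proj (hcomp (k - j) h)) {..k}"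
      using assms by (simp add: HQ.proj_mult)
  qed
  then show "Psi (f \<otimes>\<^bsub>R\<^esub> h) = Psi f \<otimes>\<^bsub>HF.gr\<^esub> Psi h"
    unfolding Psi_def using assms proj_hcomp_F by (subst HF.gr_mult) auto
qed

text \<open>The preimage of I0 under the automorphism is an ideal, and it contains the generators
  because G preserves the parameters q.\<close>

lemma act_I0:
  assumes g: "g \<in> carrier G" and a: "a \<in> I0"
  shows "act g a \<in> I0"
proof -
  let ?K = "{a \<in> carrier TA. act g a \<in> I0}"
  have "ideal ?K TA"
  proof (intro idealI TA.ring_axioms TA.add.subgroupI)
    show "?K \<noteq> {}" using TA.zero_closed SQ.zero_closed by (auto intro!: exI[of _ 0])
    fix a assume a: "a \<in> ?K"
    have "act g (- a) = - act g a" using act_smult[of g "-1" a] by (simp add: fun_Compl_def)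
    moreover have "- act g a \<in> I0" "- a \<in> carrier TA"
      using a SQ.a_inv_closed[of "act g a"] TA.a_inv_closed[of a] act_carrier[OF g, of a] by (simp_all add: free_calg_neg)
    ultimately show "\<ominus>\<^bsub>TA\<^esub> a \<in> ?K" using a by (simp add: free_calg_neg)
    fix b assume b: "b \<in> ?K"
    then show "a \<oplus>\<^bsub>TA\<^esub> b \<in> ?K" using a TA.a_closed[of a b] SQ.a_closed[of "act g a" "act g b"] by (simp add: act_add)
  next
    fix a x assume "a \<in> ?K" "x \<in> carrier TA"
    then show "x \<otimes>\<^bsub>TA\<^esub> a \<in> ?K" "a \<otimes>\<^bsub>TA\<^esub> x \<in> ?K"
      using g by (auto simp: act_mult act_carrier SQ.I_l_closed SQ.I_r_closed)
  qed auto
  moreover have "act g (tgen i j) \<in> I0" if "i < N" "j < N" for i j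
  proof -
    have "act g (tgen i j) = (\<lambda>w. c g i * c g j * tgen (p g i) (p g j) w)"
      unfolding tgen_eq act_add act_smult using g that
      by (simp add: act_word_elt q_p fun_eq_iff algebra_simps)
    moreover have "tgen (p g i) (p g j) \<in> I0" using g that by (intro tgen_I0 p_less)
    ultimately show ?thesis using SQ.I_smult[of "tgen (p g i) (p g j)" "c g i * c g j"] by simp
  qed
  ultimately have "I0 \<subseteq> ?K" by (subst I0_eq, intro TA.genideal_minimal) auto
  with a show ?thesis by blast
qed

text \<open>\<open>Sact\<close> takes images of cosets, so the image must be a whole coset and not
  just part of one. This requires \<open>act g\<close> to map I0 onto itself, which the inverse of g
  provides.\<close>

lemma Sact_proj:
  assumes g: "g \<in> carrier G" and a: "a \<in> carrier TA"
  shows "Sact g (SQ.proj a) = SQ.proj (act g a)"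
proof -
  have "act g ` I0 = I0"
  proof (intro equalityI subsetI)
    fix b assume "b \<in> I0"
    moreover from this have "b = act g (act (inv\<^bsub>G\<^esub> g) b)" using act_inv[OF g, of b] SQ.Icarr by simp
    ultimately show "b \<in> act g ` I0" using act_I0[of "inv\<^bsub>G\<^esub> g" b] g by blast
  qed (use g act_I0 in auto)
  then have "SQ.proj (act g a) = (\<Union>b\<in>act g ` I0. {b + act g a})"
    by (simp add: a_r_coset_def')
  also have "\<dots> = Sact g (SQ.proj a)"
    unfolding Sact_def by (auto simp: a_r_coset_def' act_add image_iff)
  finally show ?thesis by simp
qed

lemma Theta_carrier: "carrier SG = Theta ` carrier R"
proof (intro equalityI subsetI)
  fix f assume "f \<in> carrier SG"
  then have f: "\<forall>g\<in>carrier G. f g \<in> carrier S" "\<forall>g. g \<notin> carrier G \<longrightarrow> f g = \<zero>\<^bsub>S\<^esub>"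
    by (auto simp: skew_group_calg_def)
  then have "\<forall>g. \<exists>a. a \<in> carrier TA \<and> f g = SQ.proj a \<and> (g \<notin> carrier G \<longrightarrow> a = 0)"
    using TA.zero_closed by (fastforce simp: SQ.Q_carrier SQ.proj_zero)
  then obtain a where "\<And>g. a g \<in> carrier TA" "\<And>g. f g = SQ.proj (a g)" "\<And>g. g \<notin> carrier G \<Longrightarrow> a g = 0" by metis
  then show "f \<in> Theta ` carrier R"
    by (intro image_eqI[of _ _ a]) (auto simp: R_carrier Theta_def)
next
  fix a assume "a \<in> Theta ` carrier R"
  then obtain f where f: "f \<in> carrier R" "a = Theta f" by blast
  have "a g \<in> carrier S" for g using f R_carrier_app by (simp add: Theta_def)
  moreover have "a g = \<zero>\<^bsub>S\<^esub>" if "g \<notin> carrier G" for g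
    using f that by (simp add: Theta_def R_carrier SQ.proj_zero)
  ultimately show "a \<in> carrier SG" by (simp add: skew_group_calg_def)
qed

lemma Theta_hom:
  assumes "f \<in> carrier R" "h \<in> carrier R"
  shows "Theta (f + h) = Theta f \<oplus>\<^bsub>SG\<^esub> Theta h" "Theta (f \<otimes>\<^bsub>R\<^esub> h) = Theta f \<otimes>\<^bsub>SG\<^esub> Theta h"
    "Theta (sc s f) = s \<odot>\<^bsub>SG\<^esub> Theta f" "Theta (bas [] \<one>\<^bsub>G\<^esub>) = \<one>\<^bsub>SG\<^esub>"
proof -
  have c: "f g \<in> carrier TA" "h g \<in> carrier TA" for g using assms R_carrier_app by auto
  show "Theta (f + h) = Theta f \<oplus>\<^bsub>SG\<^esub> Theta h"
    using c by (simp add: skew_group_calg_def Theta_def SQ.proj_add fun_eq_iff)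
  show "Theta (sc s f) = s \<odot>\<^bsub>SG\<^esub> Theta f"
    using c by (simp add: skew_group_calg_def Theta_def SQ.proj_smult sc_def fun_eq_iff)
  show "Theta (bas [] \<one>\<^bsub>G\<^esub>) = \<one>\<^bsub>SG\<^esub>"
    by (auto simp: skew_group_calg_def Theta_def SQ.proj_one SQ.proj_zero bas_def fun_eq_iff)
  show "Theta (f \<otimes>\<^bsub>R\<^esub> h) = Theta f \<otimes>\<^bsub>SG\<^esub> Theta h"
  proof
    fix k
    show "Theta (f \<otimes>\<^bsub>R\<^esub> h) k = (Theta f \<otimes>\<^bsub>SG\<^esub> Theta h) k"
    proof (cases "k \<in> carrier G")
      case True
      have t: "f g \<otimes>\<^bsub>TA\<^esub> act g (h (inv\<^bsub>G\<^esub> g \<otimes>\<^bsub>G\<^esub> k)) \<in> carrier TA" if "g \<in> carrier G" for g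
        using c that act_carrier by auto
      have "(Theta f \<otimes>\<^bsub>SG\<^esub> Theta h) k
          = finsum S (\<lambda>g. SQ.proj (f g) \<otimes>\<^bsub>S\<^esub> Sact g (SQ.proj (h (inv\<^bsub>G\<^esub> g \<otimes>\<^bsub>G\<^esub> k)))) (carrier G)"
        using True by (simp add: skew_group_calg_def Theta_def)
      also have "\<dots> = finsum S (\<lambda>g. SQ.proj (f g \<otimes>\<^bsub>TA\<^esub> act g (h (inv\<^bsub>G\<^esub> g \<otimes>\<^bsub>G\<^esub> k)))) (carrier G)"
      proof -
        interpret Q: ring S by (rule SQ.Q_ring)
        show ?thesis
          by (rule Q.finsum_cong') (use c t in \<open>auto simp: Sact_proj SQ.proj_mult act_carrier\<close>)
      qed
      also have "\<dots> = SQ.proj (finsum TA (\<lambda>g. f g \<otimes>\<^bsub>TA\<^esub> act g (h (inv\<^bsub>G\<^esub> g \<otimes>\<^bsub>G\<^esub> k))) (carrier G))"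
        using finG t by (rule SQ.proj_finsum)
      also have "\<dots> = Theta (f \<otimes>\<^bsub>R\<^esub> h) k"
        using True by (simp add: skew_group_calg_def Theta_def)
      finally show ?thesis by simp
    next
      case False
      then show ?thesis using R_mult_closed[OF assms]
        by (simp add: Theta_def R_carrier SQ.proj_zero[symmetric]) (simp add: skew_group_calg_def SQ.proj_zero)
    qed
  qed
qed

lemma Theta_eq_iff:
  assumes "f \<in> carrier R" "h \<in> carrier R"
  shows "Theta f = Theta h \<longleftrightarrow> (\<forall>g. (f - h) g \<in> I0)"
proof -
  have c: "f g \<in> carrier TA" "h g \<in> carrier TA" for g using assms R_carrier_app by auto
  then show ?thesis
    by (simp add: Theta_def fun_eq_iff[of "\<lambda>g. SQ.proj (f g)"] SQ.proj_eq_iff a_minus_def free_calg_neg)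
qed

lemma gr_comp: "assoc_graded_comp H Hfilt k = Psi ` Rhom k"
proof (intro equalityI subsetI)
  fix a assume "a \<in> Psi ` Rhom k"
  then obtain f where f: "f \<in> Rhom k" "a = Psi f" by blast
  have "a j = HF.P j" if "j \<noteq> k" for j
    using that f HF.P_coset_zero[of "HQ.proj 0" j] Rlt_closed(1) by (simp add: Psi_def HF.cls_def Rhom_hcomp HP_eq)
  then show "a \<in> assoc_graded_comp H Hfilt k"
    using f Rhom_carrier by (auto simp: assoc_graded_comp_def Psi_carrier)
next
  fix a assume "a \<in> assoc_graded_comp H Hfilt k"
  then obtain f where f: "f \<in> carrier R" "a = Psi f" "\<And>j. j \<noteq> k \<Longrightarrow> a j = HF.P j"
    by (auto simp: assoc_graded_comp_def Psi_carrier)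
  \<comment> \<open>Discarding all components of f except the one of degree k does not change its
    class, since the others vanish in gr H.\<close>
  have "\<exists>r\<in>Rlt j. hcomp j (f - hcomp k f) - r \<in> J" for j
  proof (cases "j = k")
    case True
    then show ?thesis using Rlt_closed(1) J_closed(1) by (intro bexI[of _ 0]) (auto simp: hcomp_diff hcomp_hcomp)
  next
    case False
    have "HQ.proj (hcomp j f) \<in> HF.P j"
      using f(3)[OF False] f(1) HF.coset_eq_P_iff[of "HQ.proj (hcomp j f)" j] by (simp add: f(2) Psi_def HF.cls_def)
    then show ?thesis using f(1) False by (simp add: proj_in_HP hcomp_diff hcomp_hcomp)
  qed
  then have "a = Psi (hcomp k f)" using f by (simp add: Psi_eq_iff)
  then show "a \<in> Psi ` Rhom k" using hcomp_Rhom[OF f(1)] by blast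
qed

lemma SG_comp: "SGcomp k = Theta ` Rhom k"
proof (intro equalityI subsetI)
  fix f assume f: "f \<in> SGcomp k"
  then have "f \<in> carrier SG" and "\<forall>g\<in>carrier G. \<exists>a\<in>carrier TA. (\<forall>w. a w \<noteq> 0 \<longrightarrow> length w = k) \<and> f g = SQ.proj a"
    by (auto simp: SGcomp_def)
  then have "\<forall>g. \<exists>a. a \<in> carrier TA \<and> (\<forall>w. a w \<noteq> 0 \<longrightarrow> length w = k) \<and> f g = SQ.proj a \<and> (g \<notin> carrier G \<longrightarrow> a = 0)"
    using TA.zero_closed by (fastforce simp: skew_group_calg_def SQ.proj_zero)
  then obtain a where "\<And>g. a g \<in> carrier TA" "\<And>g w. a g w \<noteq> 0 \<Longrightarrow> length w = k" "\<And>g. f g = SQ.proj (a g)"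
    "\<And>g. g \<notin> carrier G \<Longrightarrow> a g = 0" by metis
  then show "f \<in> Theta ` Rhom k"
    by (intro image_eqI[of _ _ a]) (auto simp: Rhom_def R_carrier Theta_def)
next
  fix f assume "f \<in> Theta ` Rhom k"
  then obtain a where a: "a \<in> Rhom k" "f = Theta a" by blast
  then have "f \<in> carrier SG" using Theta_carrier Rhom_carrier by blast
  moreover have "\<exists>b\<in>carrier TA. (\<forall>w. b w \<noteq> 0 \<longrightarrow> length w = k) \<and> f g = SQ.proj b" for g
    using a R_carrier_app by (intro bexI[of _ "a g"]) (auto simp: Rhom_def Theta_def)
  ultimately show "f \<in> SGcomp k" by (simp add: SGcomp_def)
qed

section \<open>The kernel of the projection onto gr H\<close>

definition Lower :: "nat \<Rightarrow> ('a \<Rightarrow> nat list \<Rightarrow> complex) set" where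
  "Lower k = {f \<in> carrier R. \<exists>r\<in>Rlt k. f - r \<in> J}"

text \<open>A homogeneous f of degree k has class 0 in gr H exactly if it lies in
  \<open>Lower k\<close>, so this is the kernel of \<open>Psi\<close>.\<close>

definition Ker :: "('a \<Rightarrow> nat list \<Rightarrow> complex) set" where
  "Ker = {f \<in> carrier R. \<forall>k. hcomp k f \<in> Lower k}"

lemma Psi_eq_iff_Ker: "f \<in> carrier R \<Longrightarrow> h \<in> carrier R \<Longrightarrow> Psi f = Psi h \<longleftrightarrow> f - h \<in> Ker"
  by (simp add: Psi_eq_iff Ker_def Lower_def R_diff_closed)

lemma LowerI: "f \<in> carrier R \<Longrightarrow> r \<in> Rlt k \<Longrightarrow> f - r \<in> J \<Longrightarrow> f \<in> Lower k"
  by (auto simp: Lower_def)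

lemma Lower_closed: "0 \<in> Lower k" "f \<in> Lower k \<Longrightarrow> h \<in> Lower k \<Longrightarrow> f + h \<in> Lower k"
  "f \<in> Lower k \<Longrightarrow> sc s f \<in> Lower k"
proof -
  show "0 \<in> Lower k" using R_zero_closed Rlt_closed(1) J_closed(1) by (intro LowerI[of 0 0]) auto
  show "f + h \<in> Lower k" if fh: "f \<in> Lower k" "h \<in> Lower k"
  proof -
    from fh obtain r r' where "r \<in> Rlt k" "f - r \<in> J" "r' \<in> Rlt k" "h - r' \<in> J" "f \<in> carrier R" "h \<in> carrier R"
      by (auto simp: Lower_def)
    moreover have "f + h - (r + r') = (f - r) + (h - r')" by simp
    ultimately show ?thesis
      by (intro LowerI[of _ "r + r'"]) (simp_all only: Rlt_closed J_closed R_add_closed)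
  qed
  show "sc s f \<in> Lower k" if f: "f \<in> Lower k"
  proof -
    from f obtain r where "r \<in> Rlt k" "f - r \<in> J" "f \<in> carrier R"
      by (auto simp: Lower_def)
    moreover have "sc s f - sc s r = sc s (f - r)" by (auto simp: sc_def fun_eq_iff algebra_simps)
    ultimately show ?thesis
      by (intro LowerI[of _ "sc s r"]) (simp_all only: Rlt_closed J_closed R_smult_closed)
  qed
qed

lemma Lower_sum: "(\<And>x. x \<in> X \<Longrightarrow> f x \<in> Lower k) \<Longrightarrow> (\<Sum>x\<in>X. f x) \<in> Lower k"
  by (induction X rule: infinite_finite_induct) (auto intro: Lower_closed simp del: zero_fun_apply plus_fun_apply)

lemma Lower_mult:
  assumes "f \<in> Lower k" "x \<in> Rlt (Suc j)"
  shows "x \<otimes>\<^bsub>R\<^esub> f \<in> Lower (j + k)" "f \<otimes>\<^bsub>R\<^esub> x \<in> Lower (k + j)"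
proof -
  from assms obtain r where r: "r \<in> Rlt k" "f - r \<in> J" "f \<in> carrier R" by (auto simp: Lower_def)
  have c: "x \<in> carrier R" "r \<in> carrier R" "f - r \<in> carrier R" using assms r Rlt_carrier R_diff_closed by auto
  have "f = (f - r) + r" by simp
  then have "x \<otimes>\<^bsub>R\<^esub> f = x \<otimes>\<^bsub>R\<^esub> (f - r) + x \<otimes>\<^bsub>R\<^esub> r" "f \<otimes>\<^bsub>R\<^esub> x = (f - r) \<otimes>\<^bsub>R\<^esub> x + r \<otimes>\<^bsub>R\<^esub> x"
    using c R_distrib by metis+
  then have d: "x \<otimes>\<^bsub>R\<^esub> f - x \<otimes>\<^bsub>R\<^esub> r \<in> J" "f \<otimes>\<^bsub>R\<^esub> x - r \<otimes>\<^bsub>R\<^esub> x \<in> J"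
    using J_mult[OF r(2) c(1)] by simp_all
  show "x \<otimes>\<^bsub>R\<^esub> f \<in> Lower (j + k)"
    using d(1) Rlt_mult(1)[OF assms(2) r(1)] R_mult_closed[OF c(1) r(3)] by (intro LowerI)
  show "f \<otimes>\<^bsub>R\<^esub> x \<in> Lower (k + j)"
    using d(2) Rlt_mult(2)[OF assms(2) r(1)] R_mult_closed[OF r(3) c(1)] by (intro LowerI)
qed

lemma Ker_carrier: "f \<in> Ker \<Longrightarrow> f \<in> carrier R"
  by (simp add: Ker_def)

lemma Ker_closed: "0 \<in> Ker" "f \<in> Ker \<Longrightarrow> h \<in> Ker \<Longrightarrow> f + h \<in> Ker" "f \<in> Ker \<Longrightarrow> sc s f \<in> Ker"
  by (auto simp: Ker_def hcomp_add hcomp_sc Lower_closed R_add_closed R_smult_closed R_zero_closed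
      simp del: plus_fun_apply zero_fun_apply)

lemma Ker_sum: "(\<And>x. x \<in> X \<Longrightarrow> f x \<in> Ker) \<Longrightarrow> (\<Sum>x\<in>X. f x) \<in> Ker"
  by (induction X rule: infinite_finite_induct) (auto intro: Ker_closed simp del: zero_fun_apply plus_fun_apply)

lemma Ker_mult:
  assumes "f \<in> Ker" "x \<in> carrier R"
  shows "x \<otimes>\<^bsub>R\<^esub> f \<in> Ker" "f \<otimes>\<^bsub>R\<^esub> x \<in> Ker"
proof -
  have f: "f \<in> carrier R" "\<And>k. hcomp k f \<in> Lower k" using assms by (auto simp: Ker_def)
  have "hcomp k (x \<otimes>\<^bsub>R\<^esub> f) \<in> Lower k" for k
    unfolding hcomp_mult[OF assms(2) f(1)]
  proof (rule Lower_sum)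
    fix j assume "j \<in> {..k}"
    then show "hcomp j x \<otimes>\<^bsub>R\<^esub> hcomp (k - j) f \<in> Lower k"
      using Lower_mult(1)[OF f(2)[of "k - j"] hcomp_Rlt[OF assms(2), of j]] by simp
  qed
  moreover have "hcomp k (f \<otimes>\<^bsub>R\<^esub> x) \<in> Lower k" for k
    unfolding hcomp_mult[OF f(1) assms(2)]
  proof (rule Lower_sum)
    fix j assume "j \<in> {..k}"
    then show "hcomp j f \<otimes>\<^bsub>R\<^esub> hcomp (k - j) x \<in> Lower k"
      using Lower_mult(2)[OF f(2)[of j] hcomp_Rlt[OF assms(2), of "k - j"]] by simp
  qed
  ultimately show "x \<otimes>\<^bsub>R\<^esub> f \<in> Ker" "f \<otimes>\<^bsub>R\<^esub> x \<in> Ker"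
    using f(1) assms(2) R_mult_closed by (auto simp: Ker_def)
qed

lemma single_tgen: "single \<one>\<^bsub>G\<^esub> (tgen i j) = rgen i j + kelt i j"
  by (auto simp: single_def tgen_def rgen_def kelt_eq fun_eq_iff)

lemma kelt_Rlt: "0 < k \<Longrightarrow> kelt i j \<in> Rlt k"
  using kelt_carrier unfolding Rlt_def by (auto simp: kelt_eq word_elt_def)

text \<open>The relations of S_q(V) hold in gr H: they differ from the relations of H by
  \<kappa>(v_i, v_j), which has degree 0 and disappears in degree 2.\<close>

lemma single_tgen_Ker:
  assumes "i < N" "j < N"
  shows "single \<one>\<^bsub>G\<^esub> (tgen i j) \<in> Ker"
proof -
  have s: "single \<one>\<^bsub>G\<^esub> (tgen i j) \<in> Rhom 2"
    using single_carrier[of "\<one>\<^bsub>G\<^esub>" "tgen i j"] assms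
    by (auto simp: Rhom_def) (auto simp: single_def tgen_def word_elt_def split: if_splits)
  have "hcomp k (single \<one>\<^bsub>G\<^esub> (tgen i j)) \<in> Lower k" for k
  proof (cases "k = 2")
    case True
    have "single \<one>\<^bsub>G\<^esub> (tgen i j) - kelt i j = rgen i j" by (simp add: single_tgen)
    then show ?thesis
      using True assms rgen_J kelt_Rlt s Rhom_carrier by (auto intro!: LowerI[of _ "kelt i j"] simp: Rhom_hcomp)
  next
    case False
    with s Lower_closed(1) show ?thesis by (simp add: Rhom_hcomp)
  qed
  with s Rhom_carrier show ?thesis by (auto simp: Ker_def)
qed

lemma single_I0_Ker:
  assumes "a \<in> I0"
  shows "single \<one>\<^bsub>G\<^esub> a \<in> Ker"
proof -
  let ?K = "{a \<in> carrier TA. single \<one>\<^bsub>G\<^esub> a \<in> Ker}"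
  have m: "single \<one>\<^bsub>G\<^esub> (a \<otimes>\<^bsub>TA\<^esub> b) = single \<one>\<^bsub>G\<^esub> a \<otimes>\<^bsub>R\<^esub> single \<one>\<^bsub>G\<^esub> b" if "a \<in> carrier TA" "b \<in> carrier TA" for a b
    using that by (simp add: single_mult act_one)
  have "ideal ?K TA"
  proof (intro idealI TA.ring_axioms TA.add.subgroupI)
    have "single \<one>\<^bsub>G\<^esub> 0 = 0" by (auto simp: single_def)
    then show "?K \<noteq> {}" using TA.zero_closed Ker_closed(1) by (auto intro!: exI[of _ 0])
    fix a assume a: "a \<in> ?K"
    have "single \<one>\<^bsub>G\<^esub> (- a) = sc (- 1) (single \<one>\<^bsub>G\<^esub> a)"
      by (auto simp: single_def sc_def fun_eq_iff)
    then show "\<ominus>\<^bsub>TA\<^esub> a \<in> ?K"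
      using a Ker_closed(3) TA.a_inv_closed[of a] by (simp add: free_calg_neg)
    fix b assume "b \<in> ?K"
    then show "a \<oplus>\<^bsub>TA\<^esub> b \<in> ?K"
      using a TA.a_closed[of a b] Ker_closed(2) by (simp add: single_add del: plus_fun_apply)
  next
    fix a x assume "a \<in> ?K" "x \<in> carrier TA"
    then show "x \<otimes>\<^bsub>TA\<^esub> a \<in> ?K" "a \<otimes>\<^bsub>TA\<^esub> x \<in> ?K"
      by (auto simp: m Ker_mult)
  qed auto
  then have "I0 \<subseteq> ?K"
    by (subst I0_eq, intro TA.genideal_minimal) (auto simp: single_tgen_Ker)
  with assms show ?thesis by blast
qed

text \<open>This inclusion of kernels holds for every \<kappa>, so gr H is always a quotient of
  S_q(V) x G. Elements are split by group element and each part is written as its coefficient times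
  g.\<close>

lemma Theta_kernel_Ker:
  assumes "f \<in> carrier R" "\<And>g. f g \<in> I0"
  shows "f \<in> Ker"
proof -
  have "single g (f g) \<in> Ker" if g: "g \<in> carrier G" for g
  proof -
    have "word_elt [] \<in> carrier TA" by simp
    then have "single g (f g) = single \<one>\<^bsub>G\<^esub> (f g) \<otimes>\<^bsub>R\<^esub> single g (word_elt [])"
      using g assms R_carrier_app TA.r_one[of "f g"] by (simp add: single_mult act_one)
    then show ?thesis
      using single_I0_Ker[OF assms(2)[of g]] g by (simp add: Ker_mult)
  qed
  then have "(\<Sum>g\<in>carrier G. single g (f g)) \<in> Ker"
    by (rule Ker_sum)
  then show ?thesis using R_eq_sum_single[OF assms(1)] by simp
qed

text \<open>Swapping descents modulo I0 costs only scalars, so sorted words span S_q(V).\<close>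

lemma word_elt_sort:
  "w \<in> W \<Longrightarrow> \<exists>s. (\<lambda>v. word_elt w v - s * word_elt (sort w) v) \<in> I0"
proof (induction "inversions w" arbitrary: w rule: less_induct)
  case less
  show ?case
  proof (cases "sorted w")
    case True
    then have "(\<lambda>v. word_elt w v - 1 * word_elt (sort w) v) = 0" by (auto simp: sorted_sort_id)
    then show ?thesis using SQ.zero_closed by (intro exI[of _ 1]) simp
  next
    case False
    then obtain u i j v where w: "w = u @ [i, j] @ v" "j < i" using not_sorted_descent by blast
    let ?w' = "u @ [j, i] @ v"
    have W: "u \<in> W" "v \<in> W" "i < N" "j < N" "?w' \<in> W" using less.prems w by auto
    have "inversions ?w' < inversions w" using inversions_swap[OF w(2)] w(1) by simp
    then obtain s where s: "(\<lambda>x. word_elt ?w' x - s * word_elt (sort ?w') x) \<in> I0" using less.hyps W by blast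
    have "mset ?w' = mset w" using w by simp
    then have "sort ?w' = sort w" by (metis mset_sort properties_for_sort sorted_sort)
    with s have s: "(\<lambda>x. word_elt ?w' x - s * word_elt (sort w) x) \<in> I0" by simp
    have "word_elt u \<otimes>\<^bsub>TA\<^esub> tgen i j \<otimes>\<^bsub>TA\<^esub> word_elt v \<in> I0"
      using W tgen_I0 by (intro SQ.I_l_closed SQ.I_r_closed) auto
    also have "word_elt u \<otimes>\<^bsub>TA\<^esub> tgen i j \<otimes>\<^bsub>TA\<^esub> word_elt v = (\<lambda>x. word_elt w x - q i j * word_elt ?w' x)"
    proof -
      have c: "word_elt u \<in> carrier TA" "word_elt v \<in> carrier TA" "word_elt [i, j] \<in> carrier TA"
        "(\<lambda>w. - q i j * word_elt [j, i] w) \<in> carrier TA"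
        using W by (auto intro!: free_calg_smult_closed word_elt_carrier simp del: mult_minus_left)
      have "word_elt u \<otimes>\<^bsub>TA\<^esub> tgen i j = word_elt (u @ [i, j]) + (\<lambda>x. - q i j * word_elt (u @ [j, i]) x)"
        unfolding tgen_eq using TA.r_distr[OF c(3,4,1)] by (simp only: free_calg_simps free_calg_smult_mult word_elt_mult)
      moreover have "(word_elt (u @ [i, j]) + (\<lambda>x. - q i j * word_elt (u @ [j, i]) x)) \<otimes>\<^bsub>TA\<^esub> word_elt v
          = word_elt w + (\<lambda>x. - q i j * word_elt ?w' x)"
        using TA.l_distr[of "word_elt (u @ [i, j])" "\<lambda>x. - q i j * word_elt (u @ [j, i]) x" "word_elt v"] W w(1)
        by (simp add: free_calg_smult_mult word_elt_mult free_calg_smult_closed del: mult_minus_left)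
      ultimately have "word_elt u \<otimes>\<^bsub>TA\<^esub> tgen i j \<otimes>\<^bsub>TA\<^esub> word_elt v = word_elt w + (\<lambda>x. - q i j * word_elt ?w' x)"
        by (simp only:)
      then show ?thesis by (simp add: fun_eq_iff)
    qed
    finally have 1: "(\<lambda>x. word_elt w x - q i j * word_elt ?w' x) \<in> I0" .
    have "(\<lambda>x. q i j * (word_elt ?w' x - s * word_elt (sort w) x)) \<in> I0"
      using SQ.I_smult[OF s, of "q i j"] by simp
    from SQ.a_closed[OF 1 this]
    have "(\<lambda>x. word_elt w x - (q i j * s) * word_elt (sort w) x) \<in> I0"
      by (simp add: plus_fun_def algebra_simps)
    then show ?thesis by blast
  qed
qed

lemma sorted_representative:
  assumes "f \<in> carrier R"
  shows "\<exists>s\<in>carrier R. (\<forall>g w. s g w \<noteq> 0 \<longrightarrow> sorted w) \<and> (\<forall>g. (f - s) g \<in> I0)"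
  using assms
proof (induction rule: R_induct)
  case zero
  show "\<exists>s\<in>carrier R. (\<forall>g w. s g w \<noteq> 0 \<longrightarrow> sorted w) \<and> (\<forall>g. (0 - s) g \<in> I0)"
    using R_zero_closed SQ.zero_closed by (intro bexI[of _ 0]) auto
next
  case (add f u g t)
  then obtain s where s: "s \<in> carrier R" "\<forall>g w. s g w \<noteq> 0 \<longrightarrow> sorted w" "\<forall>g. (f - s) g \<in> I0" by blast
  obtain b where b: "(\<lambda>v. word_elt u v - b * word_elt (sort u) v) \<in> I0" using word_elt_sort add by blast
  have "sort u \<in> W" using add by (auto simp: in_lists_conv_set)
  then have "s + sc (t * b) (bas (sort u) g) \<in> carrier R"
    using s add by (intro R_add_closed R_smult_closed bas_carrier)
  moreover have "sorted w" if "(s + sc (t * b) (bas (sort u) g)) h w \<noteq> 0" for h w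
    using that s(2) by (cases "s h w = 0") (auto simp: sc_def bas_def word_elt_def split: if_splits)
  moreover have "((f + sc t (bas u g)) - (s + sc (t * b) (bas (sort u) g))) h \<in> I0" for h
  proof (cases "h = g")
    case True
    have e: "((f + sc t (bas u g)) - (s + sc (t * b) (bas (sort u) g))) h
        = (f - s) h + (\<lambda>v. t * (word_elt u v - b * word_elt (sort u) v))"
      using True by (auto simp: sc_def bas_def fun_eq_iff algebra_simps)
    show ?thesis unfolding e
      using SQ.a_closed[OF s(3)[rule_format, of h] SQ.I_smult[OF b, of t]] by (simp del: plus_fun_apply)
  next
    case False
    have e: "((f + sc t (bas u g)) - (s + sc (t * b) (bas (sort u) g))) h = (f - s) h"
      using False by (auto simp: sc_def bas_def fun_eq_iff)
    show ?thesis unfolding e using s(3) by blast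
  qed
  ultimately show ?case by (intro bexI[of _ "s + sc (t * b) (bas (sort u) g)"]) blast+
qed

text \<open>If s has a nonzero coefficient at a sorted w0 and g0, let L be prescribed by the
  indicator of this pair. It vanishes on J and on words shorter than w0, but on the component of s
  in the degree of w0 it returns that coefficient.\<close>

lemma Ker_sorted_zero:
  assumes "equivariant" "\<And>h i j k \<nu>. h \<in> carrier G \<Longrightarrow> k < j \<Longrightarrow> j < i \<Longrightarrow> i < N \<Longrightarrow> jacobi_at i j k h \<nu>"
    and s: "s \<in> Ker" "\<And>g w. s g w \<noteq> 0 \<Longrightarrow> sorted w"
  shows "s = 0"
proof (rule ccontr)
  assume "s \<noteq> 0"
  then obtain g0 w0 where 0: "s g0 w0 \<noteq> 0" by (auto simp: fun_eq_iff)
  define \<Phi> :: "nat list \<Rightarrow> 'a \<Rightarrow> complex" where "\<Phi> w g = (if w = w0 \<and> g = g0 then 1 else 0)" for w g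
  interpret D: pbw_data G N p c V q \<kappa> \<Phi>
    by unfold_locales (use assms in auto)
  let ?k = "length w0"
  have c: "s \<in> carrier R" using s Ker_carrier by blast
  from s(1) obtain r where r: "r \<in> Rlt ?k" "hcomp ?k s - r \<in> J" by (auto simp: Ker_def Lower_def)
  have "ev D.L r = 0"
    unfolding ev_def
  proof (rule sum.neutral, clarify)
    fix g w assume "r g w \<noteq> 0"
    then have "length w < ?k" using r(1) by (auto simp: Rlt_def)
    then have "D.L w g = 0" by (rule D.L_short[rotated]) (auto simp: \<Phi>_def)
    then show "r g w * D.L w g = 0" by simp
  qed
  moreover have "ev D.L (hcomp ?k s) = s g0 w0"
  proof -
    have "ev D.L (hcomp ?k s) = (\<Sum>x\<in>{(g, w). hcomp ?k s g w \<noteq> 0}. if x = (g0, w0) then s g0 w0 else 0)"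
      unfolding ev_def using s(2) by (intro sum.cong) (auto simp: hcomp_def D.L_sorted \<Phi>_def split: if_splits)
    also have "\<dots> = s g0 w0"
    proof -
      have "finite {(g, w). hcomp ?k s g w \<noteq> 0}" using c R_finite_support[of "hcomp ?k s"] by simp
      moreover have "(g0, w0) \<in> {(g, w). hcomp ?k s g w \<noteq> 0}" using 0 by (simp add: hcomp_def)
      ultimately show ?thesis by simp
    qed
    finally show ?thesis .
  qed
  moreover have "ev D.L (hcomp ?k s) = ev D.L (hcomp ?k s - r) + ev D.L r"
    using ev_add[of "hcomp ?k s - r" r D.L] c r Rlt_carrier R_diff_closed by simp
  moreover have "ev D.L (hcomp ?k s - r) = 0" using r(2) by (rule D.ev_L_J)
  ultimately show False using 0 by simp
qed

text \<open>Modulo the kernel of \<open>Theta\<close> every f equals a combination s of sorted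
  words. If f lies in \<open>Ker\<close>, then so does s by \<open>Theta_kernel_Ker\<close>, hence s
  = 0. Thus the two kernels agree.\<close>

theorem qdh_if_conditions:
  assumes "equivariant" "\<And>h i j k \<nu>. h \<in> carrier G \<Longrightarrow> k < j \<Longrightarrow> j < i \<Longrightarrow> i < N \<Longrightarrow> jacobi_at i j k h \<nu>"
  shows qdh
proof -
  have Ker: "f \<in> Ker \<longleftrightarrow> (\<forall>g. f g \<in> I0)" if f: "f \<in> carrier R" for f
  proof
    assume "f \<in> Ker"
    obtain s where s: "s \<in> carrier R" "\<And>g w. s g w \<noteq> 0 \<Longrightarrow> sorted w" "\<And>g. (f - s) g \<in> I0"
      using sorted_representative[OF f] by blast
    then have "f - s \<in> Ker" using f by (intro Theta_kernel_Ker R_diff_closed) auto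
    then have "f + sc (- 1) (f - s) \<in> Ker" using \<open>f \<in> Ker\<close> Ker_closed(2,3) by blast
    moreover have "f + sc (- 1) (f - s) = s" by (auto simp: sc_def fun_eq_iff)
    ultimately have "s \<in> Ker" by simp
    then have "s = 0" by (rule Ker_sorted_zero[rotated 2]) (use assms s(2) in auto)
    then show "\<forall>g. f g \<in> I0" using s(3) by simp
  qed (use f Theta_kernel_Ker in blast)
  obtain \<phi> where \<phi>: "\<phi> \<in> calg_iso HF.gr SG" "\<And>f. f \<in> carrier R \<Longrightarrow> \<phi> (Psi f) = Theta f"
  proof (rule iso_from_common_kernel[of "carrier R" R HF.gr Psi SG Theta])
    show "Psi f = Psi h \<longleftrightarrow> Theta f = Theta h" if "f \<in> carrier R" "h \<in> carrier R" for f h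
      using that Ker[of "f - h"] by (simp add: Psi_eq_iff_Ker Theta_eq_iff R_diff_closed)
  qed (auto simp: Psi_carrier Theta_carrier Psi_hom(1-3) Psi_hom(4)[OF R_zero_closed R_zero_closed]
       Theta_hom(1-3) Theta_hom(4)[OF R_zero_closed R_zero_closed] R_mult_closed R_add_closed R_smult_closed
       simp del: plus_fun_apply)
  have "\<phi> ` assoc_graded_comp H Hfilt k = SGcomp k" for k
    unfolding gr_comp SG_comp image_image using \<phi>(2) Rhom_carrier by (intro image_cong) auto
  with \<phi>(1) show ?thesis unfolding qdh_def graded_isomorphic_def by blast
qed

end

section \<open>Necessity of equivariance and of the Jacobi identity\<close>

interpretation scv: vector_space sc
  by unfold_locales (auto simp: sc_def fun_eq_iff algebra_simps)

lemma (in vector_space) finite_dim_surj_imp_inj: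
  assumes B: "finite B" "A = span B"
    and f_add: "\<And>x y. x \<in> A \<Longrightarrow> y \<in> A \<Longrightarrow> f (x + y) = f x + f y"
    and f_scale: "\<And>x s. x \<in> A \<Longrightarrow> f (scale s x) = scale s (f x)"
    and surj: "A \<subseteq> f ` A"
    and x: "x \<in> A" "f x = 0"
  shows "x = 0"
proof -
  obtain C where C: "C \<subseteq> A" "independent C" "A \<subseteq> span C"
    using maximal_independent_subset[of A] by blast
  have finC: "finite C" using independent_span_bound[OF B(1) C(2)] C(1) B(2) by blast
  have AC: "A = span C" using C B(2) by (metis span_minimal subspace_span subset_antisym)
  have f0: "f 0 = 0" using f_scale[of 0 0] B(2) span_zero by simp
  have f_sum: "f (\<Sum>b\<in>S. scale (u b) b) = (\<Sum>b\<in>S. scale (u b) (f b))" if "S \<subseteq> C" for S u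
  proof -
    have "finite S" using that finC finite_subset by blast
    then show ?thesis using that
    proof (induction S rule: finite_induct)
      case (insert b S)
      have "(\<Sum>b\<in>S. scale (u b) b) \<in> A" "scale (u b) b \<in> A"
        unfolding AC using insert by (auto intro!: span_sum span_scale intro: span_base)
      moreover have "b \<in> A" using insert C(1) by blast
      ultimately show ?case using insert by (simp add: f_add f_scale)
    qed (simp add: f0)
  qed
  have rep: "\<exists>u. y = (\<Sum>b\<in>C. scale (u b) b)" if "y \<in> A" for y
    using that unfolding AC span_finite[OF finC] by auto
  have spanf: "A \<subseteq> span (f ` C)"
  proof
    fix y assume "y \<in> A"
    then obtain z where z: "z \<in> A" "y = f z" using surj by blast
    obtain u where "z = (\<Sum>b\<in>C. scale (u b) b)" using rep[OF z(1)] by blast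
    then have "y = (\<Sum>b\<in>C. scale (u b) (f b))" using f_sum[of C u] z(2) by simp
    then show "y \<in> span (f ` C)" by (auto intro!: span_sum span_scale intro: span_base)
  qed
  have le: "card C \<le> card D" if "finite D" "A \<subseteq> span D" for D
    using independent_span_bound[OF that(1) C(2)] C(1) that(2) by blast
  have cardf: "card (f ` C) = card C"
    using le[OF finite_imageI[OF finC] spanf] card_image_le[OF finC, of f] by simp
  then have inj: "inj_on f C" using finC by (simp add: eq_card_imp_inj_on)
  have ind: "independent (f ` C)"
  proof
    assume "dependent (f ` C)"
    then obtain y where y: "y \<in> f ` C" "y \<in> span (f ` C - {y})" by (auto simp: dependent_def)
    then have "span (f ` C - {y}) = span (f ` C)" by (metis insert_Diff span_redundant)
    then have "card C \<le> card (f ` C - {y})" using le[of "f ` C - {y}"] spanf finC by simp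
    moreover have "card (f ` C - {y}) < card (f ` C)" using y(1) finC by (intro card_Diff1_less) auto
    ultimately show False using cardf by simp
  qed
  obtain u where u: "x = (\<Sum>b\<in>C. scale (u b) b)" using rep[OF x(1)] by blast
  have "(\<Sum>y\<in>f ` C. scale (u (the_inv_into C f y)) y) = (\<Sum>b\<in>C. scale (u b) (f b))"
    using inj by (simp add: sum.reindex the_inv_into_f_f)
  also have "\<dots> = 0" using f_sum[of C u] u x(2) by simp
  finally have "u (the_inv_into C f y) = 0" if "y \<in> f ` C" for y
    using independentD[OF ind finite_imageI[OF finC] subset_refl _ that] by simp
  then have "u b = 0" if "b \<in> C" for b
    using that inj the_inv_into_f_f[of f C b] by force
  then show ?thesis using u by simp
qed

context monomial_action begin

lemma R_expand:
  assumes "f \<in> carrier R"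
  shows "f = (\<Sum>(g, w)\<in>{(g, w). f g w \<noteq> 0}. sc (f g w) (bas w g))"
proof (intro ext)
  fix h v
  have fin: "finite {(g, w). f g w \<noteq> 0}" using assms by (rule R_finite_support)
  have "(\<Sum>(g, w)\<in>{(g, w). f g w \<noteq> 0}. sc (f g w) (bas w g)) h v
      = (\<Sum>x\<in>{(g, w). f g w \<noteq> 0}. sc (f (fst x) (snd x)) (bas (snd x) (fst x)) h v)"
    by (simp add: sum_fun_apply case_prod_unfold)
  also have "\<dots> = (\<Sum>x\<in>{(g, w). f g w \<noteq> 0}. if x = (h, v) then f h v else 0)"
    by (intro sum.cong) (auto simp: sc_def bas_def word_elt_def)
  also have "\<dots> = f h v" using fin by simp
  finally show "f h v = (\<Sum>(g, w)\<in>{(g, w). f g w \<noteq> 0}. sc (f g w) (bas w g)) h v" by simp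
qed

lemma Rhom_span:
  defines "B k \<equiv> (\<lambda>(w, g). bas w g) ` ({w \<in> W. length w = k} \<times> carrier G)"
  shows "finite (B k)" "Rhom k = scv.span (B k)"
proof -
  have "finite {w \<in> W. length w = k}"
    using finite_lists_length_eq[of "{..<N}" k] by (simp add: lists_eq_set subset_eq in_lists_conv_set)
  then show "finite (B k)" using finG by (simp add: B_def)
  show "Rhom k = scv.span (B k)"
  proof
    show "scv.span (B k) \<subseteq> Rhom k"
    proof (rule scv.span_minimal)
      have "bas w g \<in> Rhom k" if "w \<in> W" "length w = k" "g \<in> carrier G" for w g
        using bas_carrier[OF that(1,3)] that(2)
        by (auto simp: Rhom_def) (auto simp: bas_def word_elt_def split: if_splits)
      then show "B k \<subseteq> Rhom k" by (auto simp: B_def)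
      show "scv.subspace (Rhom k)"
      proof (rule scv.subspaceI)
        show "0 \<in> Rhom k" using R_zero_closed by (simp add: Rhom_def)
        show "f + h \<in> Rhom k" if "f \<in> Rhom k" "h \<in> Rhom k" for f h
          using that R_add_closed unfolding Rhom_def by (auto simp del: plus_fun_apply) (metis add_0 plus_fun_apply)
        show "sc s f \<in> Rhom k" if "f \<in> Rhom k" for s f
          using that R_smult_closed by (auto simp: Rhom_def) (auto simp: sc_def)
      qed
    qed
    show "Rhom k \<subseteq> scv.span (B k)"
    proof
      fix f assume f: "f \<in> Rhom k"
      have m: "bas w g \<in> B k" if "f g w \<noteq> 0" for g w
      proof -
        have "g \<in> carrier G" using f that by (auto simp: Rhom_def R_carrier)
        moreover have "f g \<in> carrier TA" using f R_carrier_app Rhom_carrier by blast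
        then have "w \<in> W" using that by (auto simp: free_calg_carrier)
        ultimately show ?thesis using f that by (auto simp: B_def Rhom_def)
      qed
      have "(\<Sum>(g, w)\<in>{(g, w). f g w \<noteq> 0}. sc (f g w) (bas w g)) \<in> scv.span (B k)"
        using m by (intro scv.span_sum) (auto intro: scv.span_scale scv.span_base)
      then show "f \<in> scv.span (B k)" using R_expand[OF Rhom_carrier[OF f]] by simp
    qed
  qed
qed

end

section \<open>Consequences of a graded isomorphism in degrees 0 and 1\<close>

context quantum_data begin

text \<open>The generators of I0 are homogeneous of degree 2, and the elements without words of
  length less than 2 form an ideal.\<close>

lemma I0_short:
  assumes "a \<in> I0" "length w < 2"
  shows "a w = 0"
proof -
  let ?K = "{a \<in> carrier TA. \<forall>w. length w < 2 \<longrightarrow> a w = 0}"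
  have "ideal ?K TA"
  proof (intro idealI TA.ring_axioms TA.add.subgroupI)
    show "?K \<noteq> {}" using TA.zero_closed by (auto intro!: exI[of _ 0])
    show "\<ominus>\<^bsub>TA\<^esub> a \<in> ?K" if "a \<in> ?K" for a
      using that TA.a_inv_closed[of a] by (simp add: free_calg_neg)
    show "a \<oplus>\<^bsub>TA\<^esub> b \<in> ?K" if "a \<in> ?K" "b \<in> ?K" for a b
      using that TA.a_closed[of a b] by simp
    show "x \<otimes>\<^bsub>TA\<^esub> a \<in> ?K" "a \<otimes>\<^bsub>TA\<^esub> x \<in> ?K" if "a \<in> ?K" "x \<in> carrier TA" for a x
      using that by (auto simp: free_calg_mult intro!: sum.neutral)
  qed auto
  moreover have "tgen i j w = 0" if "length w < 2" for i j w
  proof -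
    have "w \<noteq> [i, j]" "w \<noteq> [j, i]" using that by auto
    then show ?thesis by (simp add: tgen_def word_elt_def)
  qed
  ultimately have "I0 \<subseteq> ?K"
    by (subst I0_eq, intro TA.genideal_minimal) auto
  with assms show ?thesis by blast
qed

lemma Theta_inj_short:
  assumes "f \<in> Rhom k" "h \<in> Rhom k" "k < 2" "Theta f = Theta h"
  shows "f = h"
proof (intro ext)
  fix g w
  have I: "(f - h) g \<in> I0" using assms Theta_eq_iff Rhom_carrier by metis
  show "f g w = h g w"
  proof (cases "length w = k")
    case True
    then show ?thesis using I0_short[OF I, of w] assms by simp
  next
    case False
    then have "f g w = 0" "h g w = 0" using assms by (auto simp: Rhom_def)
    then show ?thesis by simp
  qed
qed

text \<open>Composing an isomorphism with the two projections from \<open>Rhom k\<close> gives a surjective linear endomorphism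
  of \<open>Rhom k\<close>, since \<open>Theta\<close> is injective there for \<open>k < 2\<close>.\<close>

lemma qdh_Lower_zero:
  assumes qdh and k: "k < 2" and f: "f \<in> Rhom k" "f \<in> Lower k"
  shows "f = 0"
proof -
  obtain \<phi> where \<phi>: "\<phi> \<in> calg_iso HF.gr SG" "\<And>k. \<phi> ` (Psi ` Rhom k) = Theta ` Rhom k"
    using assms(1) unfolding qdh_def graded_isomorphic_def gr_comp SG_comp by blast
  have hom: "a \<in> carrier HF.gr \<Longrightarrow> b \<in> carrier HF.gr \<Longrightarrow> \<phi> (a \<oplus>\<^bsub>HF.gr\<^esub> b) = \<phi> a \<oplus>\<^bsub>SG\<^esub> \<phi> b"
    "a \<in> carrier HF.gr \<Longrightarrow> \<phi> (s \<odot>\<^bsub>HF.gr\<^esub> a) = s \<odot>\<^bsub>SG\<^esub> \<phi> a" for a b s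
    using \<phi>(1) by (auto simp: calg_iso_def ring_iso_def Ring.ring_hom_def)
  have "\<exists>f'. f' \<in> Rhom k \<and> Theta f' = \<phi> (Psi f)" if "f \<in> Rhom k" for f
  proof -
    have "\<phi> (Psi f) \<in> Theta ` Rhom k" using \<phi>(2)[of k] that by blast
    then show ?thesis by (metis imageE)
  qed
  then obtain \<alpha> where \<alpha>: "\<And>f. f \<in> Rhom k \<Longrightarrow> \<alpha> f \<in> Rhom k" "\<And>f. f \<in> Rhom k \<Longrightarrow> Theta (\<alpha> f) = \<phi> (Psi f)"
    by metis
  have sub: "0 \<in> Rhom k" "f \<in> Rhom k \<Longrightarrow> h \<in> Rhom k \<Longrightarrow> f + h \<in> Rhom k" "f \<in> Rhom k \<Longrightarrow> sc s f \<in> Rhom k" for f h s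
    unfolding Rhom_span(2) by (auto intro: scv.span_zero scv.span_add scv.span_scale simp del: plus_fun_apply zero_fun_apply)
  have \<alpha>_add: "\<alpha> (f + h) = \<alpha> f + \<alpha> h" if "f \<in> Rhom k" "h \<in> Rhom k" for f h
  proof (rule Theta_inj_short[OF _ _ k])
    have c: "f \<in> carrier R" "h \<in> carrier R" "\<alpha> f \<in> carrier R" "\<alpha> h \<in> carrier R"
      using that \<alpha>(1) Rhom_carrier by auto
    then show "Theta (\<alpha> (f + h)) = Theta (\<alpha> f + \<alpha> h)"
      using that by (simp add: \<alpha>(2) sub(2) Theta_hom(1) Psi_hom(1) hom(1) Psi_carrier del: plus_fun_apply)
  qed (use that \<alpha>(1) sub(2) in auto)
  have \<alpha>_sc: "\<alpha> (sc s f) = sc s (\<alpha> f)" if "f \<in> Rhom k" for f s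
  proof (rule Theta_inj_short[OF _ _ k])
    have c: "f \<in> carrier R" "\<alpha> f \<in> carrier R" using that \<alpha>(1) Rhom_carrier by auto
    then show "Theta (\<alpha> (sc s f)) = Theta (sc s (\<alpha> f))"
      using that by (simp add: \<alpha>(2) sub(3) Theta_hom(3)[OF _ R_zero_closed] Psi_hom(3)[OF _ R_zero_closed] hom(2) Psi_carrier)
  qed (use that \<alpha>(1) sub(3) in auto)
  have surj: "Rhom k \<subseteq> \<alpha> ` Rhom k"
  proof
    fix f assume f: "f \<in> Rhom k"
    then have "Theta f \<in> \<phi> ` (Psi ` Rhom k)" using \<phi>(2)[of k] by blast
    then obtain h where h: "h \<in> Rhom k" "Theta f = \<phi> (Psi h)" by blast
    then have "f = \<alpha> h" using \<alpha>[OF h(1)] f by (intro Theta_inj_short[OF _ _ k]) auto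
    with h(1) show "f \<in> \<alpha> ` Rhom k" by blast
  qed
  have "f \<in> Ker"
    using f Lower_closed(1) Rhom_carrier by (auto simp: Ker_def Rhom_hcomp)
  then have "Psi f = Psi 0" using f Rhom_carrier R_zero_closed by (subst Psi_eq_iff_Ker) auto
  then have "Theta (\<alpha> f) = Theta (\<alpha> 0)" using \<alpha>(2)[OF f(1)] \<alpha>(2)[OF sub(1)] by simp
  then have "\<alpha> f = \<alpha> 0" by (rule Theta_inj_short[OF \<alpha>(1)[OF f(1)] \<alpha>(1)[OF sub(1)] k])
  also have "\<alpha> 0 = 0" using \<alpha>_sc[OF sub(1), of 0] by (simp add: sc_simps)
  finally show ?thesis
    using scv.finite_dim_surj_imp_inj[where f = \<alpha>, OF Rhom_span(1) Rhom_span(2) \<alpha>_add \<alpha>_sc surj f(1)]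
    by simp
qed

lemma qdh_J_zero:
  assumes qdh "f \<in> J" "k < 2" "\<And>g w. f g w \<noteq> 0 \<Longrightarrow> length w = k"
  shows "f = 0"
proof (rule qdh_Lower_zero[OF assms(1,3)])
  show "f \<in> Rhom k" using assms J_carrier by (auto simp: Rhom_def)
  show "f \<in> Lower k" using assms J_carrier Rlt_closed(1) by (intro LowerI[of _ 0]) auto
qed

text \<open>Coefficients are themselves functionals, so a formula for \<open>ev F\<close> with F
  arbitrary determines an element of R.\<close>

lemma ev_delta: "ev (\<lambda>v h. if v = w \<and> h = g then 1 else 0) f = f g w" if "f \<in> carrier R"
proof -
  have "ev (\<lambda>v h. if v = w \<and> h = g then 1 else 0) f
      = (\<Sum>x\<in>{(h, v). f h v \<noteq> 0}. if x = (g, w) then f g w else 0)"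
    unfolding ev_def by (intro sum.cong) (auto split: if_splits)
  then show ?thesis using R_finite_support[OF that] by simp
qed

lemma ev_diff:
  assumes "f \<in> carrier R" "h \<in> carrier R"
  shows "ev F (f - h) = ev F f - ev F h"
proof -
  have e: "f - h = f + sc (- 1) h" by (auto simp: sc_def fun_eq_iff)
  show ?thesis unfolding e using assms by (simp only: ev_add ev_smult R_smult_closed) simp
qed

lemma qdh_imp_equivariant:
  assumes qdh
  shows equivariant
  unfolding equivariant_def
proof (intro ballI allI impI)
  fix h g i j assume h: "h \<in> carrier G" and g: "g \<in> carrier G" and i: "i < N" and j: "j < N"
  \<comment> \<open>The conjugate of a relation by h minus the corresponding multiple of the
    relation for the moved letters. The words of length 2 cancel, which leaves an element of J
    inside the group algebra.\<close>
  define D where "D = bas [] h \<otimes>\<^bsub>R\<^esub> rgen i j \<otimes>\<^bsub>R\<^esub> bas [] (inv\<^bsub>G\<^esub> h) - sc (c h i * c h j) (rgen (p h i) (p h j))"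
  have P: "p h i < N" "p h j < N" using h i j p_less by auto
  have cc: "bas [] h \<otimes>\<^bsub>R\<^esub> rgen i j \<otimes>\<^bsub>R\<^esub> bas [] (inv\<^bsub>G\<^esub> h) \<in> carrier R" "sc (c h i * c h j) (rgen (p h i) (p h j)) \<in> carrier R"
    using h i j P by (auto intro!: R_mult_closed R_smult_closed)
  have DJ: "D \<in> J"
    unfolding D_def using h i j P by (intro J_closed(4) J_closed(3) J_mult rgen_J bas_carrier) auto
  have evD: "ev F D = (\<Sum>f\<in>carrier G. (c h i * c h j * \<kappa> (p h i) (p h j) (h \<otimes>\<^bsub>G\<^esub> f \<otimes>\<^bsub>G\<^esub> inv\<^bsub>G\<^esub> h) - \<kappa> i j f) * F [] (h \<otimes>\<^bsub>G\<^esub> f \<otimes>\<^bsub>G\<^esub> inv\<^bsub>G\<^esub> h))" for F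
  proof -
    have "(\<Sum>f\<in>carrier G. \<kappa> (p h i) (p h j) f * F [] f)
       = (\<Sum>f\<in>carrier G. \<kappa> (p h i) (p h j) (h \<otimes>\<^bsub>G\<^esub> f \<otimes>\<^bsub>G\<^esub> inv\<^bsub>G\<^esub> h) * F [] (h \<otimes>\<^bsub>G\<^esub> f \<otimes>\<^bsub>G\<^esub> inv\<^bsub>G\<^esub> h))"
      by (rule sum.reindex_bij_betw[OF bij_betw_conjugation[OF h], symmetric])
    then show ?thesis
      unfolding D_def using h i j P cc
      by (simp add: ev_diff ev_smult ev_context ev_rgen q_p sum_distrib_left sum_subtractf algebra_simps)
  qed
  have "D = 0"
  proof (rule qdh_J_zero[OF assms DJ, of 0])
    fix f w assume "D f w \<noteq> 0"
    then have "ev (\<lambda>v h. if v = w \<and> h = f then 1 else 0) D \<noteq> 0" using ev_delta J_carrier[OF DJ] by metis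
    then show "length w = 0" unfolding evD by (cases "w = []") auto
  qed simp
  then have "0 = ev (\<lambda>v f. if v = [] \<and> f = h \<otimes>\<^bsub>G\<^esub> g \<otimes>\<^bsub>G\<^esub> inv\<^bsub>G\<^esub> h then 1 else 0) D" by simp
  also have "\<dots> = (\<Sum>f\<in>carrier G. if f = g then c h i * c h j * \<kappa> (p h i) (p h j) (h \<otimes>\<^bsub>G\<^esub> g \<otimes>\<^bsub>G\<^esub> inv\<^bsub>G\<^esub> h) - \<kappa> i j g else 0)"
    unfolding evD by (intro sum.cong) (use h g in auto)
  also have "\<dots> = c h i * c h j * \<kappa> (p h i) (p h j) (h \<otimes>\<^bsub>G\<^esub> g \<otimes>\<^bsub>G\<^esub> inv\<^bsub>G\<^esub> h) - \<kappa> i j g"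
    using g finG by simp
  finally show "c h i * c h j * \<kappa> (p h i) (p h j) (h \<otimes>\<^bsub>G\<^esub> g \<otimes>\<^bsub>G\<^esub> inv\<^bsub>G\<^esub> h) = \<kappa> i j g" by simp
qed

lemma qdh_imp_jacobi:
  assumes qdh and h: "h \<in> carrier G" and i: "i < N" and j: "j < N" and k: "k < N"
  shows "jacobi_at i j k h \<nu>"
proof -
  define L where "L i r = bas [i] \<one>\<^bsub>G\<^esub> \<otimes>\<^bsub>R\<^esub> r \<otimes>\<^bsub>R\<^esub> bas [] \<one>\<^bsub>G\<^esub>" for i r
  define M where "M r i = bas [] \<one>\<^bsub>G\<^esub> \<otimes>\<^bsub>R\<^esub> r \<otimes>\<^bsub>R\<^esub> bas [i] \<one>\<^bsub>G\<^esub>" for i r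
  \<comment> \<open>Two ways of rewriting v_i v_j v_k into a multiple of v_k v_j v_i, three
    relations for each. All words of length 3 cancel in the difference, and \<kappa> leaves words of
    length 1.\<close>
  define E where "E = (L i (rgen j k) + (sc (q j k) (M (rgen i k) j) + sc (q j k * q i k) (L k (rgen i j))))
    - (M (rgen i j) k + (sc (q i j) (L j (rgen i k)) + sc (q i j * q i k) (M (rgen j k) i)))"
  have LM: "L a (rgen b d) \<in> J" "M (rgen b d) a \<in> J" if "a < N" "b < N" "d < N" for a b d
    unfolding L_def M_def using that
    by (auto intro!: J_mult(1)[OF J_mult(2)[OF rgen_J bas_carrier] bas_carrier])
  note LMR = LM[THEN J_carrier]
  have EJ: "E \<in> J"
    unfolding E_def by (intro J_closed(2-4) LM i j k)
  have evL: "ev F (L a (rgen b d)) = F [a, b, d] \<one>\<^bsub>G\<^esub> - q b d * F [a, d, b] \<one>\<^bsub>G\<^esub> - (\<Sum>f\<in>carrier G. \<kappa> b d f * F [a] f)"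
    if "a < N" "b < N" "d < N" for F a b d
    unfolding L_def using that by (simp add: ev_context ev_rgen p_one c_one)
  have evM: "ev F (M (rgen b d) a) = F [b, d, a] \<one>\<^bsub>G\<^esub> - q b d * F [d, b, a] \<one>\<^bsub>G\<^esub> - (\<Sum>f\<in>carrier G. \<kappa> b d f * (c f a * F [p f a] f))"
    if "a < N" "b < N" "d < N" for F a b d
    unfolding M_def using that by (simp add: ev_context ev_rgen p_one c_one)
  have evE: "ev F E = (\<Sum>f\<in>carrier G.
     \<kappa> j k f * (q i j * q i k * c f i * F [p f i] f - F [i] f)
     + \<kappa> i k f * (q i j * F [j] f - q j k * c f j * F [p f j] f)
     + \<kappa> i j f * (c f k * F [p f k] f - q j k * q i k * F [k] f))" for F
    unfolding E_def using i j k
    by (simp add: ev_diff ev_add ev_smult R_add_closed R_smult_closed LMR evL evM)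
       (simp add: sum.distrib sum_subtractf sum_distrib_left algebra_simps)
  have "E = 0"
  proof (rule qdh_J_zero[OF assms(1) EJ, of 1])
    fix f w assume "E f w \<noteq> 0"
    then have "ev (\<lambda>v h. if v = w \<and> h = f then 1 else 0) E \<noteq> 0" using ev_delta J_carrier[OF EJ] by metis
    then show "length w = 1" unfolding evE by (rule contrapos_np) (auto intro!: sum.neutral)
  qed simp
  \<comment> \<open>The functional selects the group element h and gives the letter l the value
    \<nu> l; \<open>evE\<close> meets only words of one letter, where \<open>hd\<close> is that
    letter.\<close>
  then have "0 = ev (\<lambda>v f. if f = h then \<nu> (hd v) else 0) E" by simp
  also have "\<dots> = (\<Sum>f\<in>carrier G. if f = h then
      \<kappa> j k h * (q i j * q i k * c h i * \<nu> (p h i) - \<nu> i)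
     + \<kappa> i k h * (q i j * \<nu> j - q j k * c h j * \<nu> (p h j))
     + \<kappa> i j h * (c h k * \<nu> (p h k) - q j k * q i k * \<nu> k) else 0)"
    unfolding evE by (intro sum.cong) auto
  also have "\<dots> = \<kappa> j k h * (q i j * q i k * c h i * \<nu> (p h i) - \<nu> i)
     + \<kappa> i k h * (q i j * \<nu> j - q j k * c h j * \<nu> (p h j))
     + \<kappa> i j h * (c h k * \<nu> (p h k) - q j k * q i k * \<nu> k)"
    using h finG by simp
  finally show ?thesis by (simp add: jacobi_at_def)
qed

end

section \<open>The group of monomial matrices\<close>

definition mono_mat :: "nat \<Rightarrow> (nat \<Rightarrow> nat) \<Rightarrow> (nat \<Rightarrow> complex) \<Rightarrow> complex mat" where
  "mono_mat n s e = mat n n (\<lambda>(r, k). if r = s k then e k else 0)"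

text \<open>\<open>sg\<close> is the permutation underlying a monomial matrix and \<open>eg\<close>
  its scalars: g sends x_k to \<open>eg n g k\<close> times the basis vector with index
  \<open>sg n g k\<close>.\<close>

definition sg :: "nat \<Rightarrow> complex mat \<Rightarrow> nat \<Rightarrow> nat" where
  "sg n g k = (THE r. r < n \<and> g $$ (r, k) \<noteq> 0)"

definition eg :: "nat \<Rightarrow> complex mat \<Rightarrow> nat \<Rightarrow> complex" where
  "eg n g k = g $$ (sg n g k, k)"

locale monomial_group =
  fixes m n :: nat
  assumes m_pos: "m > 0"
begin

abbreviation \<G> where "\<G> \<equiv> Gm1n m n"
abbreviation s where "s \<equiv> sg n"
abbreviation e where "e \<equiv> eg n"

definition mono_data :: "(nat \<Rightarrow> nat) \<Rightarrow> (nat \<Rightarrow> complex) \<Rightarrow> bool" where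
  "mono_data t f \<longleftrightarrow> bij_betw t {..<n} {..<n} \<and> (\<forall>k<n. f k ^ m = 1)"

lemma root_nonzero: "z ^ m = 1 \<Longrightarrow> z \<noteq> (0::complex)"
  using m_pos by (auto simp: power_0_left)

lemma mono_data_less: "mono_data t f \<Longrightarrow> k < n \<Longrightarrow> t k < n"
  by (auto simp: mono_data_def bij_betw_def)

lemma mono_data_inj: "mono_data t f \<Longrightarrow> k < n \<Longrightarrow> l < n \<Longrightarrow> t k = t l \<longleftrightarrow> k = l"
  by (auto simp: mono_data_def bij_betw_def inj_on_def)

lemma sg_mono: "mono_data t f \<Longrightarrow> k < n \<Longrightarrow> s (mono_mat n t f) k = t k"
  unfolding sg_def using mono_data_less[of t f k] root_nonzero[of "f k"]
  by (intro the_equality) (auto simp: mono_mat_def mono_data_def split: if_splits)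

lemma eg_mono: "mono_data t f \<Longrightarrow> k < n \<Longrightarrow> e (mono_mat n t f) k = f k"
  using mono_data_less[of t f k] by (simp add: eg_def sg_mono) (simp add: mono_mat_def)

lemma mono_mat_carrier:
  assumes "mono_data t f"
  shows "mono_mat n t f \<in> carrier \<G>"
proof -
  have nz: "k < n \<Longrightarrow> f k \<noteq> 0" for k using assms root_nonzero by (auto simp: mono_data_def)
  have "\<exists>!k. k < n \<and> mono_mat n t f $$ (r, k) \<noteq> 0" if r: "r < n" for r
  proof -
    have "r \<in> t ` {..<n}" using assms r by (auto simp: mono_data_def bij_betw_def)
    then obtain k where k: "k < n" "t k = r" by auto
    show ?thesis
    proof (rule ex1I[of _ k])
      show "k < n \<and> mono_mat n t f $$ (r, k) \<noteq> 0" using k r nz by (simp add: mono_mat_def)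
      show "l = k" if "l < n \<and> mono_mat n t f $$ (r, l) \<noteq> 0" for l
        using that k r mono_data_inj[OF assms, of l k] by (auto simp: mono_mat_def split: if_splits)
    qed
  qed
  moreover have "\<exists>!r. r < n \<and> mono_mat n t f $$ (r, k) \<noteq> 0" if k: "k < n" for k
    using k nz mono_data_less[OF assms k] by (intro ex1I[of _ "t k"]) (auto simp: mono_mat_def split: if_splits)
  moreover have "mono_mat n t f $$ (r, k) \<in> roots_unity m" if "r < n" "k < n" "mono_mat n t f $$ (r, k) \<noteq> 0" for r k
    using that assms by (auto simp: mono_mat_def roots_unity_def mono_data_def split: if_splits)
  ultimately show ?thesis by (auto simp: Gm1n_def mono_mat_def)
qed

lemma carrier_props:
  assumes "g \<in> carrier \<G>"
  shows "g \<in> carrier_mat n n" "mono_data (s g) (e g)" "g = mono_mat n (s g) (e g)"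
proof -
  have g: "g \<in> carrier_mat n n" "\<And>r. r < n \<Longrightarrow> \<exists>!k. k < n \<and> g $$ (r, k) \<noteq> 0"
    "\<And>k. k < n \<Longrightarrow> \<exists>!r. r < n \<and> g $$ (r, k) \<noteq> 0"
    "\<And>r k. r < n \<Longrightarrow> k < n \<Longrightarrow> g $$ (r, k) \<noteq> 0 \<Longrightarrow> g $$ (r, k) \<in> roots_unity m"
    using assms by (auto simp: Gm1n_def)
  show "g \<in> carrier_mat n n" by fact
  have s: "s g k < n \<and> g $$ (s g k, k) \<noteq> 0" if "k < n" for k
    unfolding sg_def by (rule theI'[OF g(3)[OF that]])
  have s_eq: "r = s g k" if "k < n" "r < n" "g $$ (r, k) \<noteq> 0" for r k
    using g(3)[OF that(1)] s[OF that(1)] that by blast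
  have "inj_on (s g) {..<n}"
  proof (rule inj_onI)
    fix k l assume "k \<in> {..<n}" "l \<in> {..<n}" "s g k = s g l"
    then show "k = l" using g(2)[of "s g k"] s[of k] s[of l] by auto
  qed
  moreover have "s g ` {..<n} \<subseteq> {..<n}" using s by auto
  ultimately have "bij_betw (s g) {..<n} {..<n}"
    by (simp add: bij_betw_def endo_inj_surj)
  moreover have "e g k ^ m = 1" if "k < n" for k
    using g(4)[of "s g k" k] s[OF that] that by (simp add: eg_def roots_unity_def)
  ultimately show "mono_data (s g) (e g)" by (simp add: mono_data_def)
  show "g = mono_mat n (s g) (e g)"
    using g(1) s_eq by (intro eq_matI) (auto simp: mono_mat_def eg_def)
qed

lemma s_less [simp]: "g \<in> carrier \<G> \<Longrightarrow> k < n \<Longrightarrow> s g k < n"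
  using carrier_props(2) mono_data_less by blast

lemma s_inj: "g \<in> carrier \<G> \<Longrightarrow> k < n \<Longrightarrow> l < n \<Longrightarrow> s g k = s g l \<longleftrightarrow> k = l"
  using carrier_props(2) mono_data_inj by blast

lemma e_root: "g \<in> carrier \<G> \<Longrightarrow> k < n \<Longrightarrow> e g k ^ m = 1"
  using carrier_props(2) by (simp add: mono_data_def)

lemma e_nonzero: "g \<in> carrier \<G> \<Longrightarrow> k < n \<Longrightarrow> e g k \<noteq> 0"
  using e_root root_nonzero by blast

lemma entry:
  assumes "g \<in> carrier \<G>" "r < n" "k < n"
  shows "g $$ (r, k) = (if r = s g k then e g k else 0)"
proof -
  have "mono_mat n (s g) (e g) $$ (r, k) = (if r = s g k then e g k else 0)"
    using assms by (simp add: mono_mat_def)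
  then show ?thesis by (simp only: carrier_props(3)[OF assms(1), symmetric])
qed

lemma mono_mat_cong: "(\<And>k. k < n \<Longrightarrow> t k = t' k \<and> f k = f' k) \<Longrightarrow> mono_mat n t f = mono_mat n t' f'"
  by (intro eq_matI) (auto simp: mono_mat_def)

lemma carrier_eqI:
  assumes "g \<in> carrier \<G>" "h \<in> carrier \<G>" "\<And>k. k < n \<Longrightarrow> s g k = s h k \<and> e g k = e h k"
  shows "g = h"
proof -
  have "mono_mat n (s g) (e g) = mono_mat n (s h) (e h)" using assms(3) by (rule mono_mat_cong)
  then show ?thesis using carrier_props(3) assms(1,2) by metis
qed

lemma mono_mult:
  assumes "mono_data t f" "mono_data t' f'"
  shows "mono_mat n t f * mono_mat n t' f' = mono_mat n (\<lambda>k. t (t' k)) (\<lambda>k. f (t' k) * f' k)"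
    and "mono_data (\<lambda>k. t (t' k)) (\<lambda>k. f (t' k) * f' k)"
proof -
  show "mono_mat n t f * mono_mat n t' f' = mono_mat n (\<lambda>k. t (t' k)) (\<lambda>k. f (t' k) * f' k)"
  proof (rule eq_matI)
    fix r k assume "r < dim_row (mono_mat n (\<lambda>k. t (t' k)) (\<lambda>k. f (t' k) * f' k))"
      "k < dim_col (mono_mat n (\<lambda>k. t (t' k)) (\<lambda>k. f (t' k) * f' k))"
    then have rk: "r < n" "k < n" by (auto simp: mono_mat_def)
    have "(mono_mat n t f * mono_mat n t' f') $$ (r, k)
        = (\<Sum>l\<in>{0..<n}. mono_mat n t f $$ (r, l) * mono_mat n t' f' $$ (l, k))"
      using rk by (simp add: mono_mat_def scalar_prod_def)
    also have "\<dots> = (\<Sum>l\<in>{0..<n}. if l = t' k then (if r = t (t' k) then f (t' k) * f' k else 0) else 0)"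
      using rk by (intro sum.cong) (auto simp: mono_mat_def)
    also have "\<dots> = mono_mat n (\<lambda>k. t (t' k)) (\<lambda>k. f (t' k) * f' k) $$ (r, k)"
      using rk mono_data_less[OF assms(2) rk(2)] by (simp add: mono_mat_def)
    finally show "(mono_mat n t f * mono_mat n t' f') $$ (r, k) = mono_mat n (\<lambda>k. t (t' k)) (\<lambda>k. f (t' k) * f' k) $$ (r, k)" .
  qed (auto simp: mono_mat_def)
  have "bij_betw (t \<circ> t') {..<n} {..<n}" using assms by (auto simp: mono_data_def intro: bij_betw_trans)
  then show "mono_data (\<lambda>k. t (t' k)) (\<lambda>k. f (t' k) * f' k)"
    using assms mono_data_less[OF assms(2)] by (simp add: mono_data_def o_def power_mult_distrib)
qed

lemma mult_carrier:
  assumes "g \<in> carrier \<G>" "h \<in> carrier \<G>"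
  shows "g * h \<in> carrier \<G>" "k < n \<Longrightarrow> s (g * h) k = s g (s h k)" "k < n \<Longrightarrow> e (g * h) k = e g (s h k) * e h k"
proof -
  note d = carrier_props(2)[OF assms(1)] carrier_props(2)[OF assms(2)]
  have eq: "g * h = mono_mat n (\<lambda>k. s g (s h k)) (\<lambda>k. e g (s h k) * e h k)"
    using mono_mult(1)[OF d] carrier_props(3)[OF assms(1)] carrier_props(3)[OF assms(2)] by metis
  show "g * h \<in> carrier \<G>" unfolding eq by (rule mono_mat_carrier[OF mono_mult(2)[OF d]])
  show "k < n \<Longrightarrow> s (g * h) k = s g (s h k)" "k < n \<Longrightarrow> e (g * h) k = e g (s h k) * e h k"
    unfolding eq using sg_mono[OF mono_mult(2)[OF d]] eg_mono[OF mono_mult(2)[OF d]] by auto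
qed

lemma one_mat_mono: "1\<^sub>m n = mono_mat n (\<lambda>k. k) (\<lambda>k. 1)" "mono_data (\<lambda>k. k) (\<lambda>k. 1)"
  by (auto simp: mono_mat_def mono_data_def intro!: eq_matI bij_betw_byWitness[where f' = "\<lambda>k. k"])

lemma Gm1n_simps [simp]: "\<one>\<^bsub>\<G>\<^esub> = 1\<^sub>m n" "g \<otimes>\<^bsub>\<G>\<^esub> h = g * h"
  by (simp_all add: Gm1n_def)

lemma one_carrier: "1\<^sub>m n \<in> carrier \<G>" "k < n \<Longrightarrow> s (1\<^sub>m n) k = k" "k < n \<Longrightarrow> e (1\<^sub>m n) k = 1"
  unfolding one_mat_mono(1) using one_mat_mono(2) mono_mat_carrier sg_mono eg_mono by auto

lemma inv_exists:
  assumes "g \<in> carrier \<G>"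
  shows "\<exists>h\<in>carrier \<G>. h * g = 1\<^sub>m n"
proof -
  note d = carrier_props(2)[OF assms]
  let ?t = "inv_into {..<n} (s g)"
  have bij: "bij_betw (s g) {..<n} {..<n}" using d by (simp add: mono_data_def)
  have t: "bij_betw ?t {..<n} {..<n}" using bij by (rule bij_betw_inv_into)
  then have t_less: "k < n \<Longrightarrow> ?t k < n" for k by (auto simp: bij_betw_def)
  have d': "mono_data ?t (\<lambda>k. inverse (e g (?t k)))"
    using t e_root[OF assms t_less] by (simp add: mono_data_def power_inverse)
  have "mono_mat n ?t (\<lambda>k. inverse (e g (?t k))) * g = 1\<^sub>m n"
  proof (rule carrier_eqI)
    show "mono_mat n ?t (\<lambda>k. inverse (e g (?t k))) * g \<in> carrier \<G>"
      using d' assms mono_mat_carrier mult_carrier by blast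
    fix k assume k: "k < n"
    then have "?t (s g k) = k" using bij by (simp add: bij_betw_def)
    then show "s (mono_mat n ?t (\<lambda>k. inverse (e g (?t k))) * g) k = s (1\<^sub>m n) k
        \<and> e (mono_mat n ?t (\<lambda>k. inverse (e g (?t k))) * g) k = e (1\<^sub>m n) k"
      using k assms mono_mat_carrier[OF d'] e_nonzero
      by (simp add: mult_carrier one_carrier sg_mono[OF d'] eg_mono[OF d'])
  qed (rule one_carrier)
  then show ?thesis using mono_mat_carrier[OF d'] by blast
qed

lemma group_Gm1n: "group \<G>"
proof (rule groupI)
  show "x \<otimes>\<^bsub>\<G>\<^esub> y \<in> carrier \<G>" if "x \<in> carrier \<G>" "y \<in> carrier \<G>" for x y
    using mult_carrier(1)[OF that] by simp
  show "\<one>\<^bsub>\<G>\<^esub> \<in> carrier \<G>" using one_carrier(1) by simp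
  show "x \<otimes>\<^bsub>\<G>\<^esub> y \<otimes>\<^bsub>\<G>\<^esub> z = x \<otimes>\<^bsub>\<G>\<^esub> (y \<otimes>\<^bsub>\<G>\<^esub> z)"
    if "x \<in> carrier \<G>" "y \<in> carrier \<G>" "z \<in> carrier \<G>" for x y z
    using assoc_mult_mat[OF carrier_props(1)[OF that(1)] carrier_props(1)[OF that(2)] carrier_props(1)[OF that(3)]] by simp
  show "\<one>\<^bsub>\<G>\<^esub> \<otimes>\<^bsub>\<G>\<^esub> x = x" if "x \<in> carrier \<G>" for x
    using left_mult_one_mat[OF carrier_props(1)[OF that]] by simp
  show "\<exists>y\<in>carrier \<G>. y \<otimes>\<^bsub>\<G>\<^esub> x = \<one>\<^bsub>\<G>\<^esub>" if "x \<in> carrier \<G>" for x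
    using inv_exists[OF that] by simp
qed

lemma finite_roots_unity_set: "finite (roots_unity m)"
  unfolding roots_unity_def using m_pos by (simp add: finite_roots_unity)

lemma finite_Gm1n: "finite (carrier \<G>)"
proof -
  have "carrier \<G> \<subseteq> (\<lambda>(t, f). mono_mat n t f) ` (({..<n} \<rightarrow>\<^sub>E {..<n}) \<times> ({..<n} \<rightarrow>\<^sub>E roots_unity m))"
  proof
    fix g assume g: "g \<in> carrier \<G>"
    have "g = mono_mat n (restrict (s g) {..<n}) (restrict (e g) {..<n})"
      by (subst carrier_props(3)[OF g]) (auto intro: mono_mat_cong)
    moreover have "restrict (s g) {..<n} \<in> {..<n} \<rightarrow>\<^sub>E {..<n}" "restrict (e g) {..<n} \<in> {..<n} \<rightarrow>\<^sub>E roots_unity m"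
      using g e_root by (auto simp: roots_unity_def)
    ultimately show "g \<in> (\<lambda>(t, f). mono_mat n t f) ` (({..<n} \<rightarrow>\<^sub>E {..<n}) \<times> ({..<n} \<rightarrow>\<^sub>E roots_unity m))"
      by (intro image_eqI[of _ _ "(restrict (s g) {..<n}, restrict (e g) {..<n})"]) auto
  qed
  then show ?thesis
    by (rule finite_subset) (intro finite_imageI finite_cartesian_product finite_PiE finite_lessThan finite_roots_unity_set)
qed

definition pV :: "complex mat \<Rightarrow> nat \<Rightarrow> nat" where
  "pV g i = (if i < n then s g i else n + s g (i - n))"

definition cV :: "complex mat \<Rightarrow> nat \<Rightarrow> complex" where
  "cV g i = (if i < n then e g i else inverse (e g (i - n)))"

sublocale act: monomial_action \<G> "2 * n" pV cV "V_mat n"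
proof (rule monomial_action.intro)
  show "group \<G>" by (rule group_Gm1n)
  show "finite (carrier \<G>)" by (rule finite_Gm1n)
  show "pV g i < 2 * n" if "g \<in> carrier \<G>" "i < 2 * n" for g i
    using that by (auto simp: pV_def intro: less_le_trans[OF s_less])
  show "pV \<one>\<^bsub>\<G>\<^esub> i = i" "cV \<one>\<^bsub>\<G>\<^esub> i = 1" if "i < 2 * n" for i
    using that by (auto simp: pV_def cV_def one_carrier)
  show "pV (g \<otimes>\<^bsub>\<G>\<^esub> h) i = pV g (pV h i)" "cV (g \<otimes>\<^bsub>\<G>\<^esub> h) i = cV g (pV h i) * cV h i"
    if "g \<in> carrier \<G>" "h \<in> carrier \<G>" "i < 2 * n" for g h i
    using that s_less[of h i] s_less[of h "i - n"] by (auto simp: pV_def cV_def mult_carrier)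
  show "V_mat n g j i = (if j = pV g i then cV g i else 0)"
    if "g \<in> carrier \<G>" "i < 2 * n" "j < 2 * n" for g i j
    using that s_less[of g i] s_less[of g "i - n"] by (auto simp: V_mat_def pV_def cV_def entry)
qed

lemma pV_mod: "g \<in> carrier \<G> \<Longrightarrow> i < 2 * n \<Longrightarrow> pV g i mod n = s g (i mod n)"
  using s_less[of g i] s_less[of g "i - n"] by (auto simp: pV_def mod_if)

lemma qpar_pV:
  assumes "g \<in> carrier \<G>" "i < 2 * n" "j < 2 * n"
  shows "qpar n (pV g i) (pV g j) = qpar n i j"
proof -
  have "i mod n < n" "j mod n < n" using assms by auto
  then show ?thesis using assms by (simp add: qpar_def pV_mod s_inj)
qed

text \<open>\<open>eqv\<close> and \<open>jac\<close> are \<open>equivariant\<close> and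
  \<open>jacobi_at\<close> for G(m,1,n), stated for an arbitrary table K outside
  \<open>quantum_data\<close>, so that they can be discussed for tables that do not yet come from a
  skew map.\<close>

definition eqv :: "(nat \<Rightarrow> nat \<Rightarrow> complex mat \<Rightarrow> complex) \<Rightarrow> bool" where
  "eqv K \<longleftrightarrow> (\<forall>h\<in>carrier \<G>. \<forall>g\<in>carrier \<G>. \<forall>i<2 * n. \<forall>j<2 * n.
     cV h i * cV h j * K (pV h i) (pV h j) (h \<otimes>\<^bsub>\<G>\<^esub> g \<otimes>\<^bsub>\<G>\<^esub> inv\<^bsub>\<G>\<^esub> h) = K i j g)"

definition jac :: "(nat \<Rightarrow> nat \<Rightarrow> complex mat \<Rightarrow> complex) \<Rightarrow> nat \<Rightarrow> nat \<Rightarrow> nat \<Rightarrow> complex mat \<Rightarrow> (nat \<Rightarrow> complex) \<Rightarrow> bool" where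
  "jac K i j k h \<nu> \<longleftrightarrow>
     K j k h * (qpar n i j * qpar n i k * cV h i * \<nu> (pV h i) - \<nu> i)
     + K i k h * (qpar n i j * \<nu> j - qpar n j k * cV h j * \<nu> (pV h j))
     + K i j h * (cV h k * \<nu> (pV h k) - qpar n j k * qpar n i k * \<nu> k) = 0"

lemma quantum_data_kmap:
  assumes "\<kappa> \<in> q_skew_maps m n"
  shows "quantum_data \<G> (2 * n) pV cV (V_mat n) (qpar n) (\<lambda>i j. \<kappa> (vb n i) (vb n j))"
proof (intro quantum_data.intro quantum_data_axioms.intro act.monomial_action_axioms)
  show "\<kappa> (vb n i) (vb n j) g = - qpar n i j * \<kappa> (vb n j) (vb n i) g" if "i < 2 * n" "j < 2 * n" for i j g
    using assms that unfolding q_skew_maps_def by (metis (mono_tags, lifting) mem_Collect_eq)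
  show "\<kappa> (vb n i) (vb n j) g = 0" if "g \<notin> carrier \<G>" for i j g
    using assms that by (auto simp: q_skew_maps_def bilinear_maps_def)
  show "qpar n (pV g i) (pV g j) = qpar n i j" if "g \<in> carrier \<G>" "i < 2 * n" "j < 2 * n" for g i j
    using that by (rule qpar_pV)
  show "qpar n i j * qpar n j i = 1" "qpar n i i = 1" for i j
    by (simp_all add: qpar_def)
qed

text \<open>The bridge from the given definitions to the locale; the constants there mirror the
  given ones, so each pair agrees by unfolding.\<close>

lemma quantum_Drinfeld_Hecke_eq:
  assumes "\<kappa> \<in> q_skew_maps m n"
  shows "quantum_Drinfeld_Hecke m n \<kappa> \<longleftrightarrow>
    quantum_data.qdh \<G> (2 * n) (V_mat n) (qpar n) (\<lambda>i j. \<kappa> (vb n i) (vb n j))"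
proof -
  interpret D: quantum_data \<G> "2 * n" pV cV "V_mat n" "qpar n" "\<lambda>i j. \<kappa> (vb n i) (vb n j)"
    using assms by (rule quantum_data_kmap)
  have act: "TV_act n = (\<lambda>g. free_ext {..<2 * n} (V_mat n g))"
    by (simp add: fun_eq_iff TV_act_def)
  have R: "TV_smash m n = act.R" by (simp add: TV_smash_def TV_def act)
  have J: "Hqk_ideal m n \<kappa> = D.J"
    unfolding Hqk_ideal_def D.J_def D.rgen_def R ..
  have I: "Sq_ideal n = D.I0" unfolding Sq_ideal_def D.I0_def TV_def ..
  have Sact: "Sq_act n = D.Sact" by (simp add: fun_eq_iff Sq_act_def D.Sact_def TV_act_def)
  have SG: "Sq_smash m n = D.SG" unfolding Sq_smash_def Sq_def Sact I TV_def ..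
  have filt: "Hqk_filt m n \<kappa> = D.Hfilt"
    by (simp add: fun_eq_iff Hqk_filt_def D.Hfilt_def R J)
  have comp: "Sq_smash_comp m n = D.SGcomp"
    by (simp add: fun_eq_iff Sq_smash_comp_def D.SGcomp_def SG I TV_def)
  show ?thesis
    unfolding quantum_Drinfeld_Hecke_def D.qdh_def Hqk_def R J filt SG comp ..
qed

lemma QDH_conditions:
  assumes "\<kappa> \<in> QDH_maps m n"
  shows "eqv (\<lambda>i j. \<kappa> (vb n i) (vb n j))"
    and "h \<in> carrier \<G> \<Longrightarrow> i < 2 * n \<Longrightarrow> j < 2 * n \<Longrightarrow> k < 2 * n \<Longrightarrow> jac (\<lambda>i j. \<kappa> (vb n i) (vb n j)) i j k h \<nu>"
proof -
  have k: "\<kappa> \<in> q_skew_maps m n" "quantum_Drinfeld_Hecke m n \<kappa>" using assms by (auto simp: QDH_maps_def)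
  interpret D: quantum_data \<G> "2 * n" pV cV "V_mat n" "qpar n" "\<lambda>i j. \<kappa> (vb n i) (vb n j)"
    using k(1) by (rule quantum_data_kmap)
  have q: "D.qdh" using k quantum_Drinfeld_Hecke_eq by blast
  show "eqv (\<lambda>i j. \<kappa> (vb n i) (vb n j))"
    using D.qdh_imp_equivariant[OF q] unfolding eqv_def D.equivariant_def .
  show "jac (\<lambda>i j. \<kappa> (vb n i) (vb n j)) i j k h \<nu>"
    if "h \<in> carrier \<G>" "i < 2 * n" "j < 2 * n" "k < 2 * n"
    using D.qdh_imp_jacobi[OF q that] unfolding jac_def D.jacobi_at_def .
qed

lemma QDH_mapsI:
  assumes "\<kappa> \<in> q_skew_maps m n" "eqv (\<lambda>i j. \<kappa> (vb n i) (vb n j))"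
    and "\<And>h i j k \<nu>. h \<in> carrier \<G> \<Longrightarrow> k < j \<Longrightarrow> j < i \<Longrightarrow> i < 2 * n \<Longrightarrow> jac (\<lambda>i j. \<kappa> (vb n i) (vb n j)) i j k h \<nu>"
  shows "\<kappa> \<in> QDH_maps m n"
proof -
  interpret D: quantum_data \<G> "2 * n" pV cV "V_mat n" "qpar n" "\<lambda>i j. \<kappa> (vb n i) (vb n j)"
    using assms(1) by (rule quantum_data_kmap)
  have "D.qdh"
  proof (rule D.qdh_if_conditions)
    show "D.equivariant" using assms(2) unfolding eqv_def D.equivariant_def .
    show "D.jacobi_at i j k h \<nu>" if "h \<in> carrier \<G>" "k < j" "j < i" "i < 2 * n" for h i j k \<nu>
      using assms(3)[OF that] unfolding jac_def D.jacobi_at_def .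
  qed
  then show ?thesis using assms(1) quantum_Drinfeld_Hecke_eq by (auto simp: QDH_maps_def)
qed

abbreviation conj :: "complex mat \<Rightarrow> complex mat \<Rightarrow> complex mat" where
  "conj h g \<equiv> h \<otimes>\<^bsub>\<G>\<^esub> g \<otimes>\<^bsub>\<G>\<^esub> inv\<^bsub>\<G>\<^esub> h"

text \<open>Evaluated at s h k rather than at k: then the formulas follow from (h g h^-1) h = h g
  without computing the inverse.\<close>

lemma conj_props:
  assumes h: "h \<in> carrier \<G>" and g: "g \<in> carrier \<G>"
  shows "conj h g \<in> carrier \<G>"
    and "k < n \<Longrightarrow> s (conj h g) (s h k) = s h (s g k)"
    and "k < n \<Longrightarrow> e (conj h g) (s h k) = e h (s g k) * e g k / e h k"
proof -
  have i: "inv\<^bsub>\<G>\<^esub> h \<in> carrier \<G>" using h by simp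
  show c: "conj h g \<in> carrier \<G>" using h g i by (simp only: act.G.m_closed)
  have eq: "conj h g \<otimes>\<^bsub>\<G>\<^esub> h = h \<otimes>\<^bsub>\<G>\<^esub> g" using h g i by (simp only: act.G.m_assoc act.G.m_closed act.G.l_inv act.G.r_one)
  then have eq': "conj h g * h = h * g" by simp
  show "s (conj h g) (s h k) = s h (s g k)" if "k < n"
    using mult_carrier(2)[OF c h that] mult_carrier(2)[OF h g that] eq' by simp
  show "e (conj h g) (s h k) = e h (s g k) * e g k / e h k" if "k < n"
    using mult_carrier(3)[OF c h that] mult_carrier(3)[OF h g that] eq' e_nonzero[OF h that]
    by (simp add: field_simps)
qed

end

section \<open>Bilinear maps and their tables on the basis\<close>

lemma qpar_xy [simp]:
  "a < n \<Longrightarrow> b < n \<Longrightarrow> qpar n a b = (if a = b then 1 else -1)"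
  "a < n \<Longrightarrow> b < n \<Longrightarrow> qpar n (n + a) b = (if a = b then 1 else -1)"
  "a < n \<Longrightarrow> b < n \<Longrightarrow> qpar n a (n + b) = (if a = b then 1 else -1)"
  "a < n \<Longrightarrow> b < n \<Longrightarrow> qpar n (n + a) (n + b) = (if a = b then 1 else -1)"
  by (simp_all add: qpar_def)

lemma xy_table_simps [simp]:
  "a < n \<Longrightarrow> b < n \<Longrightarrow> xy_table n C a b = 0"
  "a < n \<Longrightarrow> b < n \<Longrightarrow> xy_table n C a (n + b) = C a b"
  "a < n \<Longrightarrow> b < n \<Longrightarrow> xy_table n C (n + a) b = (\<lambda>g. - qpar n (n + a) b * C b a g)"
  "a < n \<Longrightarrow> b < n \<Longrightarrow> xy_table n C (n + a) (n + b) = 0"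
  by (simp_all add: xy_table_def)

lemma xy_map_vb:
  assumes "i < 2 * n" "j < 2 * n"
  shows "xy_map n C (vb n i) (vb n j) = xy_table n C i j"
proof
  fix g
  have "(\<Sum>k<2 * n. \<Sum>l<2 * n. vb n i $ k * vb n j $ l * xy_table n C k l g)
      = (\<Sum>k<2 * n. \<Sum>l<2 * n. if l = j then if k = i then xy_table n C i j g else 0 else 0)"
    using assms by (intro sum.cong refl) auto
  also have "\<dots> = xy_table n C i j g" using assms by simp
  finally show "xy_map n C (vb n i) (vb n j) g = xy_table n C i j g"
    by (simp add: xy_map_def)
qed

lemma less_2n_cases:
  fixes i n :: nat
  assumes "i < 2 * n"
  obtains a where "a < n" "i = a" | a where "a < n" "i = n + a"
proof (cases "i < n")
  case False
  then show thesis using assms that(2)[of "i - n"] by simp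
qed (use that(1) in blast)

lemma xy_map_skew:
  assumes "\<And>a b g. a < n \<Longrightarrow> b < n \<Longrightarrow> g \<notin> carrier (Gm1n m n) \<Longrightarrow> C a b g = 0"
  shows "xy_map n C \<in> q_skew_maps m n"
proof -
  have z: "xy_table n C i j g = 0" if "i < 2 * n" "j < 2 * n" "g \<notin> carrier (Gm1n m n)" for i j g
    using that(1,2) assms[OF _ _ that(3)] by (elim less_2n_cases) simp_all
  have "xy_map n C \<in> bilinear_maps m n"
    unfolding bilinear_maps_def
  proof (intro CollectI conjI ballI allI impI)
    fix u u' w assume "u \<in> Vsp n" "u' \<in> Vsp n" "w \<in> Vsp n"
    then show "xy_map n C (u + u') w = xy_map n C u w + xy_map n C u' w"
      "xy_map n C u (u' + w) = xy_map n C u u' + xy_map n C u w"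
      by (simp_all add: xy_map_def fun_eq_iff algebra_simps sum.distrib)
    fix c
    show "xy_map n C (c \<cdot>\<^sub>v u) w = (\<lambda>g. c * xy_map n C u w g)" "xy_map n C u (c \<cdot>\<^sub>v w) = (\<lambda>g. c * xy_map n C u w g)"
      using \<open>u \<in> Vsp n\<close> \<open>w \<in> Vsp n\<close>
      by (simp_all add: xy_map_def fun_eq_iff sum_distrib_left mult.assoc mult.left_commute)
  next
    fix u w g assume "g \<notin> carrier (Gm1n m n)"
    then show "xy_map n C u w g = 0" using z by (simp add: xy_map_def)
  next
    fix u w assume "u \<notin> Vsp n \<or> w \<notin> Vsp n"
    then show "xy_map n C u w = 0" by (auto simp: xy_map_def)
  qed
  moreover have "xy_map n C (vb n i) (vb n j) = (\<lambda>g. - qpar n i j * xy_map n C (vb n j) (vb n i) g)"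
    if "i < 2 * n" "j < 2 * n" for i j
    unfolding xy_map_vb[OF that] xy_map_vb[OF that(2,1)]
    using that by (elim less_2n_cases) (simp_all add: fun_eq_iff)
  ultimately show ?thesis unfolding q_skew_maps_def by blast
qed

lemma bilinear_mapsD:
  assumes "\<kappa> \<in> bilinear_maps m n"
  shows "u \<in> Vsp n \<Longrightarrow> u' \<in> Vsp n \<Longrightarrow> w \<in> Vsp n \<Longrightarrow> \<kappa> (u + u') w = \<kappa> u w + \<kappa> u' w"
    "u \<in> Vsp n \<Longrightarrow> w \<in> Vsp n \<Longrightarrow> w' \<in> Vsp n \<Longrightarrow> \<kappa> u (w + w') = \<kappa> u w + \<kappa> u w'"
    "u \<in> Vsp n \<Longrightarrow> w \<in> Vsp n \<Longrightarrow> \<kappa> (c \<cdot>\<^sub>v u) w = (\<lambda>g. c * \<kappa> u w g)"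
    "u \<in> Vsp n \<Longrightarrow> w \<in> Vsp n \<Longrightarrow> \<kappa> u (c \<cdot>\<^sub>v w) = (\<lambda>g. c * \<kappa> u w g)"
    "g \<notin> carrier (Gm1n m n) \<Longrightarrow> \<kappa> u w g = 0"
    "u \<notin> Vsp n \<or> w \<notin> Vsp n \<Longrightarrow> \<kappa> u w = 0"
proof -
  note conj = assms[unfolded bilinear_maps_def mem_Collect_eq]
  show "u \<in> Vsp n \<Longrightarrow> u' \<in> Vsp n \<Longrightarrow> w \<in> Vsp n \<Longrightarrow> \<kappa> (u + u') w = \<kappa> u w + \<kappa> u' w"
    using conj[THEN conjunct1] by simp
  note conj = conj[THEN conjunct2]
  show "u \<in> Vsp n \<Longrightarrow> w \<in> Vsp n \<Longrightarrow> w' \<in> Vsp n \<Longrightarrow> \<kappa> u (w + w') = \<kappa> u w + \<kappa> u w'"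
    using conj[THEN conjunct1] by simp
  note conj = conj[THEN conjunct2]
  show "u \<in> Vsp n \<Longrightarrow> w \<in> Vsp n \<Longrightarrow> \<kappa> (c \<cdot>\<^sub>v u) w = (\<lambda>g. c * \<kappa> u w g)"
    using conj[THEN conjunct1] by simp
  note conj = conj[THEN conjunct2]
  show "u \<in> Vsp n \<Longrightarrow> w \<in> Vsp n \<Longrightarrow> \<kappa> u (c \<cdot>\<^sub>v w) = (\<lambda>g. c * \<kappa> u w g)"
    using conj[THEN conjunct1] by simp
  note conj = conj[THEN conjunct2]
  show "g \<notin> carrier (Gm1n m n) \<Longrightarrow> \<kappa> u w g = 0"
    using conj[THEN conjunct1] by simp
  show "u \<notin> Vsp n \<or> w \<notin> Vsp n \<Longrightarrow> \<kappa> u w = 0"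
    using conj[THEN conjunct2] by simp
qed

lemma bilinear_maps_expand:
  assumes k: "\<kappa> \<in> bilinear_maps m n" and u: "u \<in> Vsp n" and w: "w \<in> Vsp n"
  shows "\<kappa> u w g = (\<Sum>i<2 * n. \<Sum>j<2 * n. u $ i * w $ j * \<kappa> (vb n i) (vb n j) g)"
proof -
  \<comment> \<open>Truncation to the first k coordinates. Adding one coordinate at a time derives
    the finite expansion from additivity in two summands.\<close>
  define tr where "tr k v = vec (2 * n) (\<lambda>i. if i < k then v $ i else 0)" for k and v :: "complex vec"
  note add = bilinear_mapsD(1,2)[OF k] and scale = bilinear_mapsD(3,4)[OF k]
  have tr: "tr k v \<in> Vsp n" for k v by (simp add: tr_def)
  \<comment> \<open>The zero vector is written as 0 times itself so that homogeneity of \<kappa>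
    gives the value 0.\<close>
  have tr_0: "tr 0 v = 0 \<cdot>\<^sub>v tr 0 v" for v by (intro eq_vecI) (simp_all add: tr_def)
  have tr_Suc: "tr (Suc k) v = tr k v + v $ k \<cdot>\<^sub>v vb n k" if "k < 2 * n" for k v
    using that by (intro eq_vecI) (auto simp: tr_def less_Suc_eq)
  have tr_all: "tr (2 * n) v = v" if "v \<in> Vsp n" for v
    using that by (intro eq_vecI) (auto simp: tr_def)
  have left: "\<kappa> (tr k u) w g = (\<Sum>i<k. u $ i * \<kappa> (vb n i) w g)" if "k \<le> 2 * n" for k
    using that
  proof (induction k)
    case 0
    have "\<kappa> (0 \<cdot>\<^sub>v tr 0 u) w g = 0" using scale(1)[OF tr w, of 0 0 u] by simp
    then have "\<kappa> (tr 0 u) w g = 0" by (simp only: tr_0[symmetric])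
    then show ?case by simp
  next
    case (Suc k)
    then show ?case using w by (simp add: tr_Suc add(1) tr scale(1))
  qed
  have right: "\<kappa> v (tr k w) g = (\<Sum>j<k. w $ j * \<kappa> v (vb n j) g)" if "k \<le> 2 * n" "v \<in> Vsp n" for k v
    using that(1)
  proof (induction k)
    case 0
    have "\<kappa> v (0 \<cdot>\<^sub>v tr 0 w) g = 0" using scale(2)[OF that(2) tr, of 0 0 w] by simp
    then have "\<kappa> v (tr 0 w) g = 0" by (simp only: tr_0[symmetric])
    then show ?case by simp
  next
    case (Suc k)
    then show ?case using that(2) by (simp add: tr_Suc add(2) tr scale(2))
  qed
  have "\<kappa> u w g = (\<Sum>i<2 * n. u $ i * \<kappa> (vb n i) w g)"
    using left[of "2 * n"] tr_all[OF u] by simp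
  also have "\<dots> = (\<Sum>i<2 * n. \<Sum>j<2 * n. u $ i * w $ j * \<kappa> (vb n i) (vb n j) g)"
    using right[of "2 * n" "vb n _"] tr_all[OF w] by (simp add: sum_distrib_left mult.assoc)
  finally show ?thesis .
qed

lemma bilinear_maps_eqI:
  assumes "\<kappa> \<in> bilinear_maps m n" "\<kappa>' \<in> bilinear_maps m n"
    and "\<And>i j g. i < 2 * n \<Longrightarrow> j < 2 * n \<Longrightarrow> \<kappa> (vb n i) (vb n j) g = \<kappa>' (vb n i) (vb n j) g"
  shows "\<kappa> = \<kappa>'"
proof (intro ext)
  fix u w g
  show "\<kappa> u w g = \<kappa>' u w g"
  proof (cases "u \<in> Vsp n \<and> w \<in> Vsp n")
    case True
    then have uw: "u \<in> Vsp n" "w \<in> Vsp n" by auto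
    have "\<kappa> u w g = (\<Sum>i<2 * n. \<Sum>j<2 * n. u $ i * w $ j * \<kappa> (vb n i) (vb n j) g)"
      by (rule bilinear_maps_expand[OF assms(1) uw])
    also have "\<dots> = (\<Sum>i<2 * n. \<Sum>j<2 * n. u $ i * w $ j * \<kappa>' (vb n i) (vb n j) g)"
      by (intro sum.cong refl) (simp only: assms(3) lessThan_iff)
    also have "\<dots> = \<kappa>' u w g"
      by (rule bilinear_maps_expand[OF assms(2) uw, symmetric])
    finally show ?thesis .
  next
    case False
    then show ?thesis using bilinear_mapsD(6)[OF assms(1)] bilinear_mapsD(6)[OF assms(2)] by simp
  qed
qed

section \<open>Classification\<close>

text \<open>\<open>two_le\<close> provides the indices 0 and 1 of the sample matrices
  \<open>t_mat n 0 \<epsilon>\<close> and \<open>sigma_mat n 0 1 1\<close>.\<close>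

locale even_monomial_group = monomial_group +
  assumes even: "even m" and two_le: "2 \<le> n"
begin

lemma neg_root: "(z::complex) ^ m = 1 \<Longrightarrow> (- z) ^ m = 1"
  using even by simp

text \<open>These describe \<open>t\<^sub>a\<^bsup>(\<epsilon>)\<^esup>\<close> and the matrices \<open>\<sigma>\<^sub>a\<^sub>d\<^bsup>(\<eta>)\<^esup>\<close> with \<open>\<eta>\<close> arbitrary.\<close>

definition isT :: "nat \<Rightarrow> complex \<Rightarrow> complex mat \<Rightarrow> bool" where
  "isT a \<epsilon> g \<longleftrightarrow> (\<forall>k<n. s g k = k \<and> e g k = (if k = a then \<epsilon> else 1))"

definition isS :: "nat \<Rightarrow> nat \<Rightarrow> complex mat \<Rightarrow> bool" where
  "isS a d g \<longleftrightarrow> s g a = d \<and> s g d = a \<and> e g a * e g d = - 1 \<and> (\<forall>k<n. k \<noteq> a \<longrightarrow> k \<noteq> d \<longrightarrow> s g k = k \<and> e g k = 1)"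

text \<open>In terms of matrices, \<open>sigma_mat n a d \<eta>\<close> is
  \<open>sigma_mat n d a (- inverse \<eta>)\<close>.\<close>

lemma isS_sym: "isS a d g \<longleftrightarrow> isS d a g"
  by (auto simp: isS_def mult.commute)

lemma t_mat_props:
  assumes "a < n" "\<epsilon> ^ m = 1"
  shows "t_mat n a \<epsilon> \<in> carrier \<G>" "isT a \<epsilon> (t_mat n a \<epsilon>)"
    "g \<in> carrier \<G> \<Longrightarrow> g = t_mat n a \<epsilon> \<longleftrightarrow> isT a \<epsilon> g"
proof -
  let ?f = "\<lambda>k. if k = a then \<epsilon> else 1"
  have eq: "t_mat n a \<epsilon> = mono_mat n (\<lambda>k. k) ?f" by (intro eq_matI) (auto simp: t_mat_def mono_mat_def)
  have d: "mono_data (\<lambda>k. k) ?f" using assms one_mat_mono(2) by (auto simp: mono_data_def)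
  show c: "t_mat n a \<epsilon> \<in> carrier \<G>" unfolding eq using d by (rule mono_mat_carrier)
  show T: "isT a \<epsilon> (t_mat n a \<epsilon>)" unfolding isT_def eq using sg_mono[OF d] eg_mono[OF d] by simp
  show "g = t_mat n a \<epsilon> \<longleftrightarrow> isT a \<epsilon> g" if g: "g \<in> carrier \<G>"
    using T carrier_eqI[OF g c] by (auto simp: isT_def)
qed

lemma sigma_mat_props:
  assumes "a < n" "d < n" "a \<noteq> d" "\<eta> ^ m = 1"
  shows "sigma_mat n a d \<eta> \<in> carrier \<G>" "isS a d (sigma_mat n a d \<eta>)" "e (sigma_mat n a d \<eta>) a = \<eta>"
    "g \<in> carrier \<G> \<Longrightarrow> g = sigma_mat n a d \<eta> \<longleftrightarrow> isS a d g \<and> e g a = \<eta>"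
proof -
  let ?f = "\<lambda>k. if k = a then \<eta> else if k = d then - inverse \<eta> else 1"
  have nz: "\<eta> \<noteq> 0" using assms root_nonzero by blast
  have eq: "sigma_mat n a d \<eta> = mono_mat n (transpose a d) ?f"
    using assms by (intro eq_matI) (auto simp: sigma_mat_def mono_mat_def transpose_def)
  have "bij_betw (transpose a d) {..<n} {..<n}"
    by (rule bij_betw_byWitness[where f' = "transpose a d"]) (use assms in \<open>auto simp: transpose_def\<close>)
  \<comment> \<open>Evenness of m places the matrix in G.\<close>
  moreover have "(- inverse \<eta>) ^ m = 1" using neg_root[of "inverse \<eta>"] assms by (simp add: power_inverse)
  ultimately have dt: "mono_data (transpose a d) ?f" using assms by (simp add: mono_data_def)
  show c: "sigma_mat n a d \<eta> \<in> carrier \<G>" unfolding eq using dt by (rule mono_mat_carrier)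
  show S: "isS a d (sigma_mat n a d \<eta>)"
    unfolding isS_def eq using sg_mono[OF dt] eg_mono[OF dt] assms nz by simp
  show E: "e (sigma_mat n a d \<eta>) a = \<eta>" unfolding eq using eg_mono[OF dt] assms by simp
  show "g = sigma_mat n a d \<eta> \<longleftrightarrow> isS a d g \<and> e g a = \<eta>" if g: "g \<in> carrier \<G>"
  proof
    assume R: "isS a d g \<and> e g a = \<eta>"
    show "g = sigma_mat n a d \<eta>"
    proof (rule carrier_eqI[OF g c])
      fix k assume k: "k < n"
      have "\<eta> * e g d = - 1" "\<eta> * e (sigma_mat n a d \<eta>) d = - 1"
        using R S E by (auto simp: isS_def)
      then have "e g d = e (sigma_mat n a d \<eta>) d" using nz by (metis mult_left_cancel)
      then show "s g k = s (sigma_mat n a d \<eta>) k \<and> e g k = e (sigma_mat n a d \<eta>) k"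
        using R S E k unfolding isS_def by metis
    qed
  qed (use S E in auto)
qed

definition Ct :: "complex \<Rightarrow> nat \<Rightarrow> nat \<Rightarrow> complex mat \<Rightarrow> complex" where
  "Ct \<epsilon> = (\<lambda>i j. if i = j then grp_elt (t_mat n i \<epsilon>) else 0)"

definition Cs :: "nat \<Rightarrow> nat \<Rightarrow> complex mat \<Rightarrow> complex" where
  "Cs = (\<lambda>i j.
     if i = j then \<Sum>\<eta>\<in>roots_unity m. \<Sum>k\<in>{..<n} - {i}. grp_elt (sigma_mat n i k \<eta>)
     else \<Sum>\<eta>\<in>roots_unity m. (\<lambda>g. \<eta> * grp_elt (sigma_mat n i j \<eta>) g))"

lemma kappa_t_eq: "kappa_t n \<epsilon> = xy_map n (Ct \<epsilon>)"
  by (simp only: kappa_t_def Ct_def)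

lemma kappa_sigma_eq: "kappa_sigma m n = xy_map n Cs"
  by (simp only: kappa_sigma_def Cs_def)

lemma Ct_eq:
  assumes "a < n" "b < n" "\<epsilon> \<in> roots_unity m"
  shows "g \<in> carrier \<G> \<Longrightarrow> Ct \<epsilon> a b g = (if a = b \<and> isT a \<epsilon> g then 1 else 0)"
    "g \<notin> carrier \<G> \<Longrightarrow> Ct \<epsilon> a b g = 0"
proof -
  have r: "\<epsilon> ^ m = 1" using assms by (simp add: roots_unity_def)
  show "Ct \<epsilon> a b g = (if a = b \<and> isT a \<epsilon> g then 1 else 0)" if "g \<in> carrier \<G>"
    using t_mat_props(3)[OF assms(1) r that] by (cases "a = b") (simp_all add: Ct_def grp_elt_def)
  show "Ct \<epsilon> a b g = 0" if "g \<notin> carrier \<G>"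
    using t_mat_props(1)[OF assms(1) r] that by (cases "a = b") (auto simp: Ct_def grp_elt_def)
qed

text \<open>A matrix g occurs in the sums at most once, because it determines their parameters:
  \<eta> is e g a, and the index exchanged with a is s g a.\<close>

lemma Cs_eq:
  assumes "a < n" "b < n"
  shows "g \<in> carrier \<G> \<Longrightarrow> Cs a b g =
      (if a = b then if \<exists>d<n. d \<noteq> a \<and> isS a d g then 1 else 0 else if isS a b g then e g a else 0)"
    "g \<notin> carrier \<G> \<Longrightarrow> Cs a b g = 0"
proof -
  have fin: "finite (roots_unity m)" by (rule finite_roots_unity_set)
  have sig: "grp_elt (sigma_mat n a d \<eta>) g = (if g \<in> carrier \<G> \<and> isS a d g \<and> e g a = \<eta> then 1 else 0)"
    if "d < n" "d \<noteq> a" "\<eta> \<in> roots_unity m" for d \<eta> g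
  proof -
    have r: "\<eta> ^ m = 1" using that by (simp add: roots_unity_def)
    show ?thesis
      using sigma_mat_props(1,4)[OF assms(1) that(1) that(2)[symmetric] r] unfolding grp_elt_def by auto
  qed
  have off: "(\<Sum>\<eta>\<in>roots_unity m. (\<lambda>g. \<eta> * grp_elt (sigma_mat n a b \<eta>) g)) g
      = (if g \<in> carrier \<G> \<and> isS a b g then e g a else 0)" if "a \<noteq> b" for g
  proof -
    have "(\<Sum>\<eta>\<in>roots_unity m. (\<lambda>g. \<eta> * grp_elt (sigma_mat n a b \<eta>) g)) g
       = (\<Sum>\<eta>\<in>roots_unity m. \<eta> * grp_elt (sigma_mat n a b \<eta>) g)"
      by (rule sum_fun_apply)
    also have "\<dots> = (\<Sum>\<eta>\<in>roots_unity m. if \<eta> = e g a then (if g \<in> carrier \<G> \<and> isS a b g then e g a else 0) else 0)"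
      using assms that by (intro sum.cong) (auto simp: sig)
    also have "\<dots> = (if g \<in> carrier \<G> \<and> isS a b g then e g a else 0)"
      using fin e_root[of g a] assms by (auto simp: roots_unity_def)
    finally show ?thesis .
  qed
  have diag: "(\<Sum>\<eta>\<in>roots_unity m. \<Sum>k\<in>{..<n} - {a}. grp_elt (sigma_mat n a k \<eta>)) g
      = (if g \<in> carrier \<G> \<and> (\<exists>d<n. d \<noteq> a \<and> isS a d g) then 1 else 0)" for g
  proof -
    have "(\<Sum>\<eta>\<in>roots_unity m. \<Sum>k\<in>{..<n} - {a}. grp_elt (sigma_mat n a k \<eta>)) g
       = (\<Sum>\<eta>\<in>roots_unity m. \<Sum>k\<in>{..<n} - {a}. grp_elt (sigma_mat n a k \<eta>) g)"
      by (simp only: sum_fun_apply)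
    also have "\<dots> = (\<Sum>\<eta>\<in>roots_unity m. \<Sum>k\<in>{..<n} - {a}. if g \<in> carrier \<G> \<and> isS a k g \<and> e g a = \<eta> then 1 else 0)"
      by (intro sum.cong) (auto simp: sig)
    also have "\<dots> = (\<Sum>\<eta>\<in>roots_unity m. if \<eta> = e g a then (\<Sum>k\<in>{..<n} - {a}. if g \<in> carrier \<G> \<and> isS a k g then 1 else 0) else 0)"
      by (intro sum.cong) auto
    also have "\<dots> = (\<Sum>k\<in>{..<n} - {a}. if g \<in> carrier \<G> \<and> isS a k g then 1 else 0)"
    proof (cases "g \<in> carrier \<G>")
      case True
      then show ?thesis using fin e_root[of g a] assms by (simp add: roots_unity_def)
    qed (simp cong: if_cong)
    also have "\<dots> = (\<Sum>k\<in>{..<n} - {a}. if k = s g a then (if g \<in> carrier \<G> \<and> isS a (s g a) g then 1 else 0) else 0)"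
      by (intro sum.cong) (auto simp: isS_def)
    also have "\<dots> = (if s g a \<in> {..<n} - {a} \<and> g \<in> carrier \<G> \<and> isS a (s g a) g then 1 else 0)"
      by simp
    also have "s g a \<in> {..<n} - {a} \<and> g \<in> carrier \<G> \<and> isS a (s g a) g \<longleftrightarrow> g \<in> carrier \<G> \<and> (\<exists>d<n. d \<noteq> a \<and> isS a d g)"
      by (auto simp: isS_def)
    finally show ?thesis .
  qed
  show "g \<in> carrier \<G> \<Longrightarrow> Cs a b g =
      (if a = b then if \<exists>d<n. d \<noteq> a \<and> isS a d g then 1 else 0 else if isS a b g then e g a else 0)"
    "g \<notin> carrier \<G> \<Longrightarrow> Cs a b g = 0"
    using off[of g] diag[of g] by (cases "a = b"; simp add: Cs_def)+
qed

lemma kappa_t_skew: "\<epsilon> \<in> roots_unity m \<Longrightarrow> kappa_t n \<epsilon> \<in> q_skew_maps m n"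
  unfolding kappa_t_eq using Ct_eq(2) by (intro xy_map_skew)

lemma kappa_sigma_skew: "kappa_sigma m n \<in> q_skew_maps m n"
  unfolding kappa_sigma_eq by (rule xy_map_skew) (rule Cs_eq(2))

section \<open>The basis maps satisfy both conditions\<close>

lemma s_surj: "h \<in> carrier \<G> \<Longrightarrow> s h ` {..<n} = {..<n}"
  using carrier_props(2) by (simp add: mono_data_def bij_betw_def)

lemma conj_isT:
  assumes "h \<in> carrier \<G>" "g \<in> carrier \<G>" "a < n"
  shows "isT (s h a) \<epsilon> (conj h g) \<longleftrightarrow> isT a \<epsilon> g"
proof
  assume T: "isT a \<epsilon> g"
  show "isT (s h a) \<epsilon> (conj h g)"
    unfolding isT_def
  proof (intro allI impI)
    fix l assume "l < n"
    then obtain k where "k < n" "l = s h k" using s_surj[OF assms(1)] by blast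
    then show "s (conj h g) l = l \<and> e (conj h g) l = (if l = s h a then \<epsilon> else 1)"
      using T assms e_nonzero[OF assms(1)] by (simp add: isT_def conj_props s_inj del: Gm1n_simps)
  qed
next
  assume T: "isT (s h a) \<epsilon> (conj h g)"
  show "isT a \<epsilon> g"
    unfolding isT_def
  proof (intro allI impI)
    fix k assume k: "k < n"
    have "s h (s g k) = s h k" using T k assms conj_props(2)[OF assms(1,2) k] by (simp add: isT_def del: Gm1n_simps)
    then have "s g k = k" using s_inj assms k by simp
    moreover have "e h (s g k) * e g k / e h k = (if s h k = s h a then \<epsilon> else 1)"
      using T k assms conj_props(3)[OF assms(1,2) k] by (simp add: isT_def del: Gm1n_simps)
    ultimately show "s g k = k \<and> e g k = (if k = a then \<epsilon> else 1)"
      using e_nonzero[OF assms(1) k] s_inj[OF assms(1) k assms(3)] by simp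
  qed
qed

text \<open>Conjugation rescales e g a and e g d by mutually inverse factors, so their product -1 is
  preserved.\<close>

lemma conj_isS:
  assumes "h \<in> carrier \<G>" "g \<in> carrier \<G>" "a < n" "d < n"
  shows "isS (s h a) (s h d) (conj h g) \<longleftrightarrow> isS a d g"
proof
  assume S: "isS a d g"
  show "isS (s h a) (s h d) (conj h g)"
    unfolding isS_def
  proof (intro conjI allI impI)
    show "s (conj h g) (s h a) = s h d" "s (conj h g) (s h d) = s h a"
      "e (conj h g) (s h a) * e (conj h g) (s h d) = - 1"
      using S assms e_nonzero[OF assms(1)] by (simp_all add: isS_def conj_props del: Gm1n_simps)
    fix l assume l: "l < n" "l \<noteq> s h a" "l \<noteq> s h d"
    then obtain k where k: "k < n" "l = s h k" using s_surj[OF assms(1)] by blast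
    with l have "k \<noteq> a" "k \<noteq> d" by auto
    with S k(1) have "s g k = k" "e g k = 1" by (simp_all add: isS_def)
    then show "s (conj h g) l = l" "e (conj h g) l = 1"
      using k assms e_nonzero[OF assms(1)] by (simp_all add: conj_props del: Gm1n_simps)
  qed
next
  assume S: "isS (s h a) (s h d) (conj h g)"
  have p: "s h (s g k) = s (conj h g) (s h k)" "e g k = e (conj h g) (s h k) * e h k / e h (s g k)" if "k < n" for k
    using conj_props(2,3)[OF assms(1,2) that] e_nonzero[OF assms(1) that] e_nonzero[OF assms(1) s_less[OF assms(2) that]]
    by (simp_all del: Gm1n_simps)
  have "s h (s g a) = s h d" "s h (s g d) = s h a"
    using S p(1)[OF assms(3)] p(1)[OF assms(4)] by (simp_all add: isS_def del: Gm1n_simps)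
  then have sad: "s g a = d" "s g d = a" using s_inj[OF assms(1)] assms by simp_all
  show "isS a d g"
    unfolding isS_def
  proof (intro conjI allI impI sad)
    have "e (conj h g) (s h a) * e (conj h g) (s h d) = - 1" using S by (simp add: isS_def del: Gm1n_simps)
    then show "e g a * e g d = - 1"
      using p(2)[OF assms(3)] p(2)[OF assms(4)] sad e_nonzero[OF assms(1)] assms
      by (simp del: Gm1n_simps)
    fix k assume k: "k < n" "k \<noteq> a" "k \<noteq> d"
    then have "s h k \<noteq> s h a" "s h k \<noteq> s h d" "s h k < n" using assms s_inj[OF assms(1)] by simp_all
    then have *: "s (conj h g) (s h k) = s h k" "e (conj h g) (s h k) = 1"
      using S by (simp_all add: isS_def del: Gm1n_simps)
    then have "s h (s g k) = s h k" using p(1)[OF k(1)] by simp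
    then show "s g k = k" using k(1) assms s_inj[OF assms(1), of "s g k" k] by simp
    then show "e g k = 1" using p(2)[OF k(1)] * e_nonzero[OF assms(1) k(1)] by (simp del: Gm1n_simps)
  qed
qed

text \<open>Only the pairs x_a, y_b have to be checked: pairs of the same kind have value 0, and the
  pairs y_a, x_b follow because q is invariant under G.\<close>

lemma eqv_xy_table:
  assumes "\<And>h g a b. h \<in> carrier \<G> \<Longrightarrow> g \<in> carrier \<G> \<Longrightarrow> a < n \<Longrightarrow> b < n \<Longrightarrow>
     e h a * inverse (e h b) * C (s h a) (s h b) (conj h g) = C a b g"
  shows "eqv (xy_table n C)"
  unfolding eqv_def
proof (intro ballI allI impI)
  fix h g i j assume h: "h \<in> carrier \<G>" and g: "g \<in> carrier \<G>" and ij: "i < 2 * n" "j < 2 * n"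
  show "cV h i * cV h j * xy_table n C (pV h i) (pV h j) (conj h g) = xy_table n C i j g"
    using ij
  proof (elim less_2n_cases)
    fix a b assume *: "a < n" "i = a" "b < n" "j = n + b"
    then show ?thesis using assms[OF h g *(1,3)] h by (simp add: cV_def pV_def del: Gm1n_simps)
  next
    fix a b assume *: "a < n" "i = n + a" "b < n" "j = b"
    have "cV h i * cV h j * xy_table n C (pV h i) (pV h j) (conj h g)
      = - qpar n (n + a) b * (e h b * inverse (e h a) * C (s h b) (s h a) (conj h g))"
      using * h by (simp add: cV_def pV_def s_inj del: Gm1n_simps)
    then show ?thesis using * by (simp add: assms[OF h g *(3,1)] del: Gm1n_simps)
  qed (use h in \<open>simp_all add: cV_def pV_def del: Gm1n_simps\<close>)
qed

text \<open>As the x come before the y, a triple k < j < i with both kinds is x_d, x_a, y_b or x_d,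
  y_b, y_a, and each gives one hypothesis. For three vectors of the same kind all values of the
  table vanish.\<close>

lemma jac_xy_table:
  assumes xxy: "\<And>a b d. a < n \<Longrightarrow> b < n \<Longrightarrow> d < n \<Longrightarrow> a \<noteq> d \<Longrightarrow>
      qpar n b d * C d b h * (qpar n b a * \<nu> a + e h a * \<nu> (s h a))
      + qpar n b a * C a b h * (e h d * \<nu> (s h d) + qpar n b d * \<nu> d) = 0"
    and yyx: "\<And>a b d. a < n \<Longrightarrow> b < n \<Longrightarrow> d < n \<Longrightarrow> a \<noteq> b \<Longrightarrow>
      qpar n b d * C d b h * (qpar n a d * inverse (e h a) * \<nu> (n + s h a) + \<nu> (n + a))
      + qpar n a d * C d a h * (\<nu> (n + b) + qpar n b d * inverse (e h b) * \<nu> (n + s h b)) = 0"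
    and h: "h \<in> carrier \<G>" and ijk: "k < j" "j < i" "i < 2 * n"
  shows "jac (xy_table n C) i j k h \<nu>"
proof -
  from ijk have "j < 2 * n" "k < 2 * n" by auto
  with ijk(3) show ?thesis
  proof (elim less_2n_cases)
    fix b a d assume *: "b < n" "i = n + b" "a < n" "j = a" "d < n" "k = d"
    then show ?thesis
      using xxy[OF *(3,1,5)] ijk unfolding jac_def by (simp add: cV_def pV_def split: if_splits)
  next
    fix a b d assume *: "a < n" "i = n + a" "b < n" "j = n + b" "d < n" "k = d"
    have ab: "a \<noteq> b" using * ijk by auto
    have K: "xy_table n C j k h = - qpar n b d * C d b h" "xy_table n C i k h = - qpar n a d * C d a h"
      "xy_table n C i j h = 0" "qpar n i j = - 1" "qpar n i k = qpar n a d" "qpar n j k = qpar n b d"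
      "cV h i = inverse (e h a)" "cV h j = inverse (e h b)" "pV h i = n + s h a" "pV h j = n + s h b"
      using * ab by (simp_all add: cV_def pV_def)
    have alg: "(- qbd * Cdb) * ((- 1) * qad * ia * x - y) + (- qad * Cda) * ((- 1) * z - qbd * ib * t) + 0 * w = 0"
      if "qbd * Cdb * (qad * ia * x + y) + qad * Cda * (z + qbd * ib * t) = 0" for qbd Cdb qad ia x y Cda z ib t w :: complex
      using that by (simp add: algebra_simps)
    show ?thesis unfolding jac_def K using *(2,4) by (simp only:) (rule alg[OF yyx[OF *(1,3,5) ab]])
  qed (use ijk in \<open>simp_all add: jac_def\<close>)
qed

lemma in_QDH_maps_xy:
  assumes "xy_map n C \<in> q_skew_maps m n" "eqv (xy_table n C)"
    "\<And>h i j k \<nu>. h \<in> carrier \<G> \<Longrightarrow> k < j \<Longrightarrow> j < i \<Longrightarrow> i < 2 * n \<Longrightarrow> jac (xy_table n C) i j k h \<nu>"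
  shows "xy_map n C \<in> QDH_maps m n"
proof (rule QDH_mapsI)
  have pV: "pV h i < 2 * n" if "h \<in> carrier \<G>" "i < 2 * n" for h i using act.p_less that .
  show "eqv (\<lambda>i j. xy_map n C (vb n i) (vb n j))"
    using assms(2) pV unfolding eqv_def by (simp add: xy_map_vb del: Gm1n_simps)
  show "jac (\<lambda>i j. xy_map n C (vb n i) (vb n j)) i j k h \<nu>"
    if "h \<in> carrier \<G>" "k < j" "j < i" "i < 2 * n" for h i j k \<nu>
    using assms(3)[OF that] that unfolding jac_def by (simp add: xy_map_vb)
qed (rule assms)

text \<open>The matrix \<open>t_mat n d \<epsilon>\<close> fixes x_a and y_a for a \<noteq> d, and q
  is -1 between different indices, so every bracket next to a nonzero coefficient cancels by
  itself.\<close>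

lemma kappa_t_QDH:
  assumes "\<epsilon> \<in> roots_unity m"
  shows "kappa_t n \<epsilon> \<in> QDH_maps m n"
  unfolding kappa_t_eq
proof (rule in_QDH_maps_xy)
  show "xy_map n (Ct \<epsilon>) \<in> q_skew_maps m n" using kappa_t_skew[OF assms] by (simp only: kappa_t_eq)
  show "eqv (xy_table n (Ct \<epsilon>))"
  proof (rule eqv_xy_table)
    fix h g a b assume *: "h \<in> carrier \<G>" "g \<in> carrier \<G>" "a < n" "b < n"
    have "(if s h a = s h b \<and> isT (s h a) \<epsilon> (conj h g) then 1 else 0 :: complex) = (if a = b \<and> isT a \<epsilon> g then 1 else 0)"
      using * by (simp only: conj_isT s_inj)
    then show "e h a * inverse (e h b) * Ct \<epsilon> (s h a) (s h b) (conj h g) = Ct \<epsilon> a b g"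
      unfolding Ct_eq(1)[OF s_less[OF *(1,3)] s_less[OF *(1,4)] assms conj_props(1)[OF *(1,2)]] Ct_eq(1)[OF *(3,4) assms *(2)]
      using e_nonzero[OF *(1,4)] by (cases "a = b") (simp_all del: Gm1n_simps)
  qed
  show "jac (xy_table n (Ct \<epsilon>)) i j k h \<nu>" if h: "h \<in> carrier \<G>" and ijk: "k < j" "j < i" "i < 2 * n" for h i j k \<nu>
  proof (rule jac_xy_table[OF _ _ h ijk])
    fix a b d assume *: "a < n" "b < n" "d < n"
    note eq = Ct_eq(1)[OF *(3,2) assms h] Ct_eq(1)[OF *(1,2) assms h] Ct_eq(1)[OF *(3,1) assms h]
    show "qpar n b d * Ct \<epsilon> d b h * (qpar n b a * \<nu> a + e h a * \<nu> (s h a))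
      + qpar n b a * Ct \<epsilon> a b h * (e h d * \<nu> (s h d) + qpar n b d * \<nu> d) = 0" if "a \<noteq> d"
      unfolding eq using * that by (cases "d = b"; cases "a = b") (simp_all add: isT_def)
    show "qpar n b d * Ct \<epsilon> d b h * (qpar n a d * inverse (e h a) * \<nu> (n + s h a) + \<nu> (n + a))
      + qpar n a d * Ct \<epsilon> d a h * (\<nu> (n + b) + qpar n b d * inverse (e h b) * \<nu> (n + s h b)) = 0" if "a \<noteq> b"
      unfolding eq using * that by (cases "d = b"; cases "d = a") (simp_all add: isT_def)
  qed
qed

lemma kappa_sigma_QDH: "kappa_sigma m n \<in> QDH_maps m n"
  unfolding kappa_sigma_eq
proof (rule in_QDH_maps_xy)
  show "xy_map n Cs \<in> q_skew_maps m n" using kappa_sigma_skew by (simp only: kappa_sigma_eq)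
  show "eqv (xy_table n Cs)"
  proof (rule eqv_xy_table)
    fix h g a b assume *: "h \<in> carrier \<G>" "g \<in> carrier \<G>" "a < n" "b < n"
    have "(\<exists>d<n. d \<noteq> s h a \<and> isS (s h a) d (conj h g)) \<longleftrightarrow> (\<exists>d\<in>s h ` {..<n}. d \<noteq> s h a \<and> isS (s h a) d (conj h g))"
      unfolding s_surj[OF *(1)] by blast
    also have "\<dots> \<longleftrightarrow> (\<exists>d<n. d \<noteq> a \<and> isS a d g)"
      using conj_isS[OF *(1,2,3)] s_inj[OF *(1) _ *(3)] by (auto simp del: Gm1n_simps)
    finally have ex: "(\<exists>d<n. d \<noteq> s h a \<and> isS (s h a) d (conj h g)) \<longleftrightarrow> (\<exists>d<n. d \<noteq> a \<and> isS a d g)" .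
    have e_off: "e h a * inverse (e h b) * e (conj h g) (s h a) = e g a" if "isS a b g"
      using that * e_nonzero[of h a] e_nonzero[of h b] by (simp add: isS_def conj_props del: Gm1n_simps)
    show "e h a * inverse (e h b) * Cs (s h a) (s h b) (conj h g) = Cs a b g"
      unfolding Cs_eq(1)[OF s_less[OF *(1,3)] s_less[OF *(1,4)] conj_props(1)[OF *(1,2)]] Cs_eq(1)[OF *(3,4,2)] ex
        conj_isS[OF *] s_inj[OF *(1,3,4)]
      using e_nonzero[OF *(1,4)] e_off by (cases "a = b"; cases "isS a b g") (simp_all del: Gm1n_simps)
  qed
  show "jac (xy_table n Cs) i j k h \<nu>" if h: "h \<in> carrier \<G>" and ijk: "k < j" "j < i" "i < 2 * n" for h i j k \<nu>
  proof (rule jac_xy_table[OF _ _ h ijk])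
    fix a b d assume *: "a < n" "b < n" "d < n"
    note eq = Cs_eq(1)[OF *(3,2) h] Cs_eq(1)[OF *(1,2) h] Cs_eq(1)[OF *(3,1) h]
    have inv: "inverse (e h x) = - e h y" if "isS x y h" "x < n" for x y
    proof -
      have "e h x * (- e h y) = 1" using that by (simp add: isS_def)
      then show ?thesis by (rule inverse_unique)
    qed
    have uniq: "z = y" if "isS x y h" "isS x z h" for x y z using that by (simp add: isS_def)
    have fixed: "s h x = x \<and> e h x = 1" if "isS y z h" "x \<noteq> y" "x \<noteq> z" "x < n" for x y z
      using that by (simp add: isS_def)
    show "qpar n b d * Cs d b h * (qpar n b a * \<nu> a + e h a * \<nu> (s h a))
      + qpar n b a * Cs a b h * (e h d * \<nu> (s h d) + qpar n b d * \<nu> d) = 0" if ad: "a \<noteq> d"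
    proof (cases "isS a d h")
      case True
      then have da: "isS d a h" using isS_sym by blast
      have ex: "\<exists>k<n. k \<noteq> d \<and> isS d k h" "\<exists>k<n. k \<noteq> a \<and> isS a k h"
        using True da ad * by blast+
      have s: "s h a = d" "s h d = a" "e h a * e h d = - 1" "e h d * e h a = - 1" using True by (auto simp: isS_def mult.commute)
      then have s': "e h a * (e h d * x) = - x" "e h d * (e h a * x) = - x" for x by (simp_all flip: mult.assoc)
      \<comment> \<open>For b = a and b = d both summands survive and cancel each other through e h
        a * e h d = -1. For any other b both coefficients are 0.\<close>
      consider "b = a" | "b = d" | "b \<noteq> a" "b \<noteq> d" by blast
      then show ?thesis
      proof cases
        case 3
        then have "\<not> isS d b h" "\<not> isS a b h" using True da uniq by blast+
        with 3 show ?thesis unfolding eq by simp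
      qed (unfold eq, use ex s True da ad * in \<open>simp_all add: algebra_simps s'\<close>)
    next
      case False
      then have da: "\<not> isS d a h" using isS_sym by blast
      \<comment> \<open>Now each summand vanishes alone. If the first coefficient is nonzero, h
        exchanges d with an index other than a, hence fixes x_a, and the bracket cancels.\<close>
      have 1: "s h a = a \<and> e h a = 1" if "isS d k h" for k
        using fixed[OF that ad _ *(1)] that da by blast
      have 2: "s h d = d \<and> e h d = 1" if "isS a k h" for k
        using fixed[OF that ad[symmetric] _ *(3)] that False by blast
      have t1: "Cs d b h * (qpar n b a * \<nu> a + e h a * \<nu> (s h a)) = 0"
        unfolding eq using 1 da ad * by (cases "d = b"; cases "a = b") auto
      have t2: "Cs a b h * (e h d * \<nu> (s h d) + qpar n b d * \<nu> d) = 0"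
        unfolding eq using 2 False ad * by (cases "d = b"; cases "a = b") auto
      show ?thesis by (simp only: mult.assoc t1 t2) simp
    qed
    show "qpar n b d * Cs d b h * (qpar n a d * inverse (e h a) * \<nu> (n + s h a) + \<nu> (n + a))
      + qpar n a d * Cs d a h * (\<nu> (n + b) + qpar n b d * inverse (e h b) * \<nu> (n + s h b)) = 0" if ab: "a \<noteq> b"
    proof (cases "isS a b h")
      case True
      then have ba: "isS b a h" using isS_sym by blast
      have ex: "\<exists>k<n. k \<noteq> b \<and> isS b k h" "\<exists>k<n. k \<noteq> a \<and> isS a k h"
        using True ba ab * by blast+
      have s: "s h a = b" "s h b = a" "inverse (e h a) = - e h b" "inverse (e h b) = - e h a"
        using True ba inv * by (auto simp: isS_def)
      have s': "e h a * (e h b * x) = - x" "e h b * (e h a * x) = - x" for x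
        using True ba by (simp_all add: isS_def flip: mult.assoc)
      consider "d = a" | "d = b" | "d \<noteq> a" "d \<noteq> b" by blast
      then show ?thesis
      proof cases
        case 3
        then have "\<not> isS d b h" "\<not> isS d a h" using True ba uniq isS_sym by blast+
        with 3 show ?thesis unfolding eq by simp
      qed (unfold eq, use ex s True ba ab * in \<open>simp_all add: algebra_simps s'\<close>)
    next
      case False
      then have ba: "\<not> isS b a h" using isS_sym by blast
      have 1: "s h a = a \<and> e h a = 1" if "isS b k h" for k
        using fixed[OF that ab _ *(1)] that ba by blast
      have 2: "s h b = b \<and> e h b = 1" if "isS a k h" for k
        using fixed[OF that ab[symmetric] _ *(2)] that False by blast
      have t1: "Cs d b h * (qpar n a d * inverse (e h a) * \<nu> (n + s h a) + \<nu> (n + a)) = 0"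
        unfolding eq using 1 isS_sym[of d b] ba False ab * by (cases "d = b"; cases "d = a") auto
      have t2: "Cs d a h * (\<nu> (n + b) + qpar n b d * inverse (e h b) * \<nu> (n + s h b)) = 0"
        unfolding eq using 2 isS_sym[of d a] ba False ab * by (cases "d = b"; cases "d = a") auto
      show ?thesis by (simp only: mult.assoc[of _ "Cs _ _ _"] t1 t2) simp
    qed
  qed
qed

end

section \<open>Solutions of the two conditions\<close>

locale kappa_solution = even_monomial_group +
  fixes K :: "nat \<Rightarrow> nat \<Rightarrow> complex mat \<Rightarrow> complex"
  assumes K_eqv: "eqv K"
    and K_jac: "h \<in> carrier \<G> \<Longrightarrow> i < 2 * n \<Longrightarrow> j < 2 * n \<Longrightarrow> k < 2 * n \<Longrightarrow> jac K i j k h \<nu>"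
begin

text \<open>Taking \<nu> to be the indicator of a letter isolates one coefficient of the Jacobi
  identity. In the one of v_i only K j k g remains unless g carries v_j or v_k into the line of v_i;
  the second claim uses the letter to which g moves v_i.\<close>

lemma moved_index:
  assumes g: "g \<in> carrier \<G>" and ijk: "i < 2 * n" "j < 2 * n" "k < 2 * n" "i \<noteq> j" "i \<noteq> k"
    and nz: "K j k g \<noteq> 0" and moved: "pV g i \<noteq> i"
  shows "pV g j = i \<or> pV g k = i" "pV g i = j \<or> pV g i = k"
proof -
  show "pV g j = i \<or> pV g k = i"
  proof (rule ccontr)
    assume "\<not> (pV g j = i \<or> pV g k = i)"
    then show False
      using K_jac[OF g ijk(1-3), of "\<lambda>l. if l = i then 1 else 0"] ijk nz moved by (simp add: jac_def)
  qed
  show "pV g i = j \<or> pV g i = k"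
  proof (rule ccontr)
    assume "\<not> (pV g i = j \<or> pV g i = k)"
    moreover have "pV g j \<noteq> pV g i" "pV g k \<noteq> pV g i" using act.p_inj[OF g] ijk by simp_all
    ultimately have "K j k g * (qpar n i j * qpar n i k * cV g i) = 0"
      using K_jac[OF g ijk(1-3), of "\<lambda>l. if l = pV g i then 1 else 0"] moved by (simp add: jac_def)
    moreover have "qpar n i j * qpar n i k * cV g i \<noteq> 0"
      using act.c_nonzero[OF g ijk(1)] by (simp add: qpar_def)
    ultimately show False using nz by simp
  qed
qed

lemma fixed_index:
  assumes g: "g \<in> carrier \<G>" and ijk: "i < 2 * n" "j < 2 * n" "k < 2 * n" "i \<noteq> j" "i \<noteq> k"
    and nz: "K j k g \<noteq> 0" and fixed: "pV g i = i"
  shows "cV g i = qpar n i j * qpar n i k"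
proof -
  have "pV g j \<noteq> i" "pV g k \<noteq> i" using act.p_inj[OF g, of _ i] ijk fixed by metis+
  then have "K j k g * (qpar n i j * qpar n i k * cV g i - 1) = 0"
    using K_jac[OF g ijk(1-3), of "\<lambda>l. if l = i then 1 else 0"] ijk fixed by (simp add: jac_def)
  with nz have "qpar n i j * qpar n i k * cV g i = 1" by simp
  moreover have "cV g i = qpar n i j * qpar n i k * (qpar n i j * qpar n i k * cV g i)"
    by (simp add: qpar_def)
  ultimately show ?thesis by simp
qed

text \<open>The diagonal matrix t_a^(-1) commutes with g and changes the sign of exactly one of the
  two vectors, so equivariance gives K = -K.\<close>

lemma diagonal_zero:
  assumes g: "g \<in> carrier \<G>" and ab: "a < n" "b < n" "a \<noteq> b" and diag: "\<And>k. k < n \<Longrightarrow> s g k = k"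
  shows "K a b g = 0" "K (n + a) (n + b) g = 0" "K a (n + b) g = 0"
proof -
  have "(- 1 :: complex) ^ m = 1" using even by simp
  note t = t_mat_props(1,2)[OF ab(1) this]
  let ?h = "t_mat n a (- 1)"
  have h: "s ?h k = k" "e ?h k = (if k = a then - 1 else 1)" if "k < n" for k
    using t(2) that by (simp_all add: isT_def)
  have "conj ?h g = g"
  proof (rule carrier_eqI[OF conj_props(1)[OF t(1) g] g])
    fix k assume k: "k < n"
    show "s (conj ?h g) k = s g k \<and> e (conj ?h g) k = e g k"
      using conj_props(2,3)[OF t(1) g k] k h diag by (simp del: Gm1n_simps)
  qed
  then have "cV ?h i * cV ?h j * K (pV ?h i) (pV ?h j) g = K i j g" if "i < 2 * n" "j < 2 * n" for i j
    using K_eqv t(1) g that unfolding eqv_def by metis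
  from this[of a b] this[of "n + a" "n + b"] this[of a "n + b"]
  show "K a b g = 0" "K (n + a) (n + b) g = 0" "K a (n + b) g = 0"
    using ab h by (simp_all add: cV_def pV_def)
qed

text \<open>If g moved y_d, it would have to carry x_a or x_b into the line of y_d, but G preserves
  U. Hence g is diagonal, and \<open>diagonal_zero\<close> applies.\<close>

lemma xx_zero:
  assumes g: "g \<in> carrier \<G>" and ab: "a < n" "b < n" "a \<noteq> b"
  shows "K a b g = 0"
proof (rule ccontr)
  assume nz: "K a b g \<noteq> 0"
  have "s g d = d" if d: "d < n" for d
  proof (rule ccontr)
    assume "s g d \<noteq> d"
    then show False
      using moved_index(1)[OF g, of "n + d" a b] nz ab d s_less[OF g ab(1)] s_less[OF g ab(2)]
      by (simp add: pV_def)
  qed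
  then show False using diagonal_zero(1)[OF g ab] nz by blast
qed

lemma yy_zero:
  assumes g: "g \<in> carrier \<G>" and ab: "a < n" "b < n" "a \<noteq> b"
  shows "K (n + a) (n + b) g = 0"
proof (rule ccontr)
  assume nz: "K (n + a) (n + b) g \<noteq> 0"
  have "s g d = d" if d: "d < n" for d
  proof (rule ccontr)
    assume "s g d \<noteq> d"
    then show False
      using moved_index(1)[OF g, of d "n + a" "n + b"] nz ab d by (simp add: pV_def)
  qed
  then show False using diagonal_zero(2)[OF g ab] nz by blast
qed

lemma xy_diagonal_support:
  assumes g: "g \<in> carrier \<G>" and a: "a < n" and nz: "K a (n + a) g \<noteq> 0"
  shows "isT a (e g a) g \<or> (\<exists>d<n. d \<noteq> a \<and> isS a d g)"
proof -
  have mv: "s g a = d \<and> s g d = a" if "d < n" "d \<noteq> a" "s g d \<noteq> d" for d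
    using moved_index[OF g, of d a "n + a"] nz a that s_less[OF g that(1)] by (simp add: pV_def)
  \<comment> \<open>The prescribed scalar is the product of two parameters q, both -1 because d
    differs from a.\<close>
  have fx: "e g d = 1" if "d < n" "d \<noteq> a" "s g d = d" for d
    using fixed_index[OF g, of d a "n + a"] nz a that by (simp add: pV_def cV_def)
  show ?thesis
  proof (cases "s g a = a")
    case True
    then have "s g k = k" if "k < n" for k using mv[of k] that by (cases "k = a") auto
    then show ?thesis using fx by (auto simp: isT_def)
  next
    case False
    let ?d = "s g a"
    have d: "?d < n" "?d \<noteq> a" "s g ?d \<noteq> ?d" using False g a s_inj[OF g, of ?d a] by simp_all
    have sd: "s g ?d = a" using mv[OF d] by simp
    have others: "s g k = k \<and> e g k = 1" if "k < n" "k \<noteq> a" "k \<noteq> ?d" for k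
      using mv[of k] fx[of k] that by auto
    \<comment> \<open>With d = s g a, these are the coefficients of x_d and x_a in the Jacobi
      identity for x_d, x_a, y_a. Eliminating K on x_d, y_a leaves K (1 + e g a * e g d) =
      0.\<close>
    have 1: "K ?d (n + a) g * e g a = - K a (n + a) g"
      using K_jac[OF g, of ?d a "n + a" "\<lambda>l. if l = ?d then 1 else 0"] a d sd
      by (simp add: jac_def pV_def cV_def)
    have 2: "K a (n + a) g * e g ?d = K ?d (n + a) g"
      using K_jac[OF g, of ?d a "n + a" "\<lambda>l. if l = a then 1 else 0"] a d sd
      by (simp add: jac_def pV_def cV_def)
    have "K a (n + a) g * (1 + e g a * e g ?d) = K a (n + a) g + (K a (n + a) g * e g ?d) * e g a"
      by (simp add: algebra_simps)
    also have "\<dots> = 0" unfolding 2 1 by simp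
    finally have "K a (n + a) g * (1 + e g a * e g ?d) = 0" .
    then have "e g a * e g ?d = - 1" using nz by (simp add: add_eq_0_iff)
    with d sd others show ?thesis by (auto simp: isS_def)
  qed
qed

lemma xy_off_diagonal:
  assumes g: "g \<in> carrier \<G>" and ab: "a < n" "b < n" "a \<noteq> b"
  shows "K a (n + b) g = (if isS a b g then e g a * K b (n + b) g else 0)"
proof -
  have rel: "K a (n + b) g = e g a * K b (n + b) g" if "s g a = b" "s g b = a"
    using K_jac[OF g, of b a "n + b" "\<lambda>l. if l = b then 1 else 0"] ab that
    by (simp add: jac_def pV_def cV_def mult.commute)
  have swap: "s g a = b \<and> s g b = a" if nz: "K a (n + b) g \<noteq> 0"
  proof -
    \<comment> \<open>A moved index f is tested as x_f and as y_f. Outside {a, b} the demands s g f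
      = a and s g f = b clash; for f = a or f = b the remaining test says that g exchanges a and
      b.\<close>
    obtain f where f: "f < n" "s g f \<noteq> f" using diagonal_zero(3)[OF g ab] nz by blast
    have x: "s g a = f \<and> s g f = a" if "f < n" "s g f \<noteq> f" "f \<noteq> a" for f
      using moved_index[OF g, of f a "n + b"] nz ab that s_less[OF g that(1)] by (simp add: pV_def)
    have y: "s g b = f \<and> s g f = b" if "f < n" "s g f \<noteq> f" "f \<noteq> b" for f
      using moved_index[OF g, of "n + f" a "n + b"] nz ab that s_less[OF g ab(1)] by (simp add: pV_def)
    show ?thesis using x[OF f] y[OF f] ab by (cases "f = a"; cases "f = b") auto
  qed
  show ?thesis
  proof (cases "isS a b g")
    case True
    then show ?thesis using rel by (simp add: isS_def)
  next
    case False
    have "K a (n + b) g = 0"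
    proof (rule ccontr)
      assume nz: "K a (n + b) g \<noteq> 0"
      then have "K b (n + b) g \<noteq> 0" using rel swap by auto
      then consider "isT b (e g b) g" | d where "isS b d g"
        using xy_diagonal_support[OF g ab(2)] by blast
      then show False
      proof cases
        case 1
        then have "s g b = b" using ab(2) by (simp add: isT_def)
        then show False using swap[OF nz] ab(3) by simp
      next
        case (2 d)
        then have "d = a" using swap[OF nz] by (simp add: isS_def)
        then show False using 2 False isS_sym by blast
      qed
    qed
    with False show ?thesis by simp
  qed
qed

text \<open>No scalar appears because h scales x_a and y_a by inverse factors.\<close>

lemma conj_xy_diagonal:
  assumes "h \<in> carrier \<G>" "g \<in> carrier \<G>" "a < n"
  shows "K a (n + a) g = K (s h a) (n + s h a) (conj h g)"
proof -
  have "cV h a * cV h (n + a) * K (pV h a) (pV h (n + a)) (conj h g) = K a (n + a) g"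
    using K_eqv assms unfolding eqv_def by simp
  then show ?thesis using assms e_nonzero[OF assms(1,3)] by (simp add: cV_def pV_def del: Gm1n_simps)
qed

lemma value_T:
  assumes g: "g \<in> carrier \<G>" and a: "a < n" and T: "isT a \<epsilon> g"
  shows "K a (n + a) g = K 0 n (t_mat n 0 \<epsilon>)"
proof -
  have \<epsilon>: "\<epsilon> ^ m = 1" using T a e_root[OF g a] by (simp add: isT_def)
  have n0: "0 < n" using two_le by simp
  \<comment> \<open>The permutation matrix of this transposition conjugates g into the standard
    position at index 0.\<close>
  let ?t = "transpose a 0"
  have "bij_betw ?t {..<n} {..<n}"
    by (rule bij_betw_byWitness[where f' = ?t]) (use a n0 in \<open>auto simp: transpose_def\<close>)
  then have d: "mono_data ?t (\<lambda>_. 1)" by (simp add: mono_data_def)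
  let ?h = "mono_mat n ?t (\<lambda>_. 1)"
  have h: "?h \<in> carrier \<G>" using d by (rule mono_mat_carrier)
  have sh: "s ?h a = 0" using sg_mono[OF d a] by simp
  have "isT 0 \<epsilon> (conj ?h g)" using conj_isT[OF h g a, of \<epsilon>] T sh by simp
  then have "conj ?h g = t_mat n 0 \<epsilon>" using t_mat_props(3)[OF n0 \<epsilon> conj_props(1)[OF h g]] by simp
  then show ?thesis using conj_xy_diagonal[OF h g a] sh by simp
qed

lemma value_S:
  assumes g: "g \<in> carrier \<G>" and ad: "a < n" "d < n" "a \<noteq> d" and S: "isS a d g"
  shows "K a (n + a) g = K 0 n (sigma_mat n 0 1 1)"
proof -
  have n: "0 < n" "1 < n" using two_le by simp_all
  \<comment> \<open>The first transposition carries a to 0; the second carries the image of d to 1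
    and fixes 0, since d differs from a. The scalar e g a placed at a turns the parameter of the
    conjugate into e g a / e g a = 1.\<close>
  let ?t = "transpose 1 (transpose a 0 d) \<circ> transpose a 0"
  let ?f = "\<lambda>k. if k = a then e g a else 1"
  have bij: "bij_betw (transpose x y) {..<n} {..<n}" if "x < n" "y < n" for x y
    by (rule bij_betw_byWitness[where f' = "transpose x y"]) (use that in \<open>auto simp: transpose_def\<close>)
  have "transpose a 0 d < n" using n ad by (simp add: transpose_def)
  then have "bij_betw ?t {..<n} {..<n}" using bij ad n by (intro bij_betw_trans[OF bij bij]) auto
  then have dt: "mono_data ?t ?f" using e_root[OF g ad(1)] by (simp add: mono_data_def)
  let ?h = "mono_mat n ?t ?f"
  have h: "?h \<in> carrier \<G>" using dt by (rule mono_mat_carrier)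
  have sh: "s ?h a = 0" "s ?h d = 1"
    using sg_mono[OF dt ad(1)] sg_mono[OF dt ad(2)] ad by (auto simp: transpose_def)
  have "isS 0 1 (conj ?h g)" using conj_isS[OF h g ad(1,2)] S sh by simp
  moreover have "e (conj ?h g) 0 = 1"
    using conj_props(3)[OF h g ad(1)] sh eg_mono[OF dt ad(1)] eg_mono[OF dt ad(2)] S ad e_nonzero[OF g ad(1)]
    by (simp add: isS_def del: Gm1n_simps)
  ultimately have "conj ?h g = sigma_mat n 0 1 1"
    using sigma_mat_props(4)[OF n zero_neq_one power_one conj_props(1)[OF h g]] by simp
  then show ?thesis using conj_xy_diagonal[OF h g ad(1)] sh by simp
qed

text \<open>Index n is y_0: the coefficients are values of K on x_0, y_0, read at the standard
  representatives to which \<open>value_T\<close> and \<open>value_S\<close> conjugate all group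
  elements in the support.\<close>

lemma xy_value:
  assumes g: "g \<in> carrier \<G>" and ab: "a < n" "b < n"
  shows "K a (n + b) g = (\<Sum>\<epsilon>\<in>roots_unity m. K 0 n (t_mat n 0 \<epsilon>) * Ct \<epsilon> a b g) + K 0 n (sigma_mat n 0 1 1) * Cs a b g"
proof (cases "a = b")
  case True
  have "(\<Sum>\<epsilon>\<in>roots_unity m. K 0 n (t_mat n 0 \<epsilon>) * Ct \<epsilon> a b g)
      = (\<Sum>\<epsilon>\<in>roots_unity m. if \<epsilon> = e g a then (if isT a (e g a) g then K 0 n (t_mat n 0 (e g a)) else 0) else 0)"
  proof (rule sum.cong)
    fix \<epsilon> assume "\<epsilon> \<in> roots_unity m"
    then have "Ct \<epsilon> a b g = (if isT a \<epsilon> g then 1 else 0)" using Ct_eq(1)[OF ab _ g] True by simp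
    moreover have "\<epsilon> = e g a" if "isT a \<epsilon> g" using that ab(1) by (simp add: isT_def)
    ultimately show "K 0 n (t_mat n 0 \<epsilon>) * Ct \<epsilon> a b g
        = (if \<epsilon> = e g a then (if isT a (e g a) g then K 0 n (t_mat n 0 (e g a)) else 0) else 0)"
      by (cases "\<epsilon> = e g a") auto
  qed simp
  also have "\<dots> = (if isT a (e g a) g then K 0 n (t_mat n 0 (e g a)) else 0)"
    using finite_roots_unity_set e_root[OF g ab(1)] by (simp add: roots_unity_def)
  finally have sumT: "(\<Sum>\<epsilon>\<in>roots_unity m. K 0 n (t_mat n 0 \<epsilon>) * Ct \<epsilon> a b g)
    = (if isT a (e g a) g then K 0 n (t_mat n 0 (e g a)) else 0)" .
  have sumS: "Cs a b g = (if \<exists>d<n. d \<noteq> a \<and> isS a d g then 1 else 0)"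
    using Cs_eq(1)[OF ab g] True by simp
  have excl: "\<not> isS a d g" if "isT a (e g a) g" "d \<noteq> a" for d
  proof -
    have "s g a = a" using that(1) ab(1) by (simp add: isT_def)
    then show ?thesis using that(2) by (simp add: isS_def)
  qed
  consider "isT a (e g a) g" | d where "d < n" "d \<noteq> a" "isS a d g"
    | "\<not> isT a (e g a) g" "\<not> (\<exists>d<n. d \<noteq> a \<and> isS a d g)" by blast
  then show ?thesis
  proof cases
    case 1
    then have "\<not> (\<exists>d<n. d \<noteq> a \<and> isS a d g)" using excl by blast
    then have "Cs a b g = 0" unfolding sumS by (simp only: if_False)
    then show ?thesis unfolding sumT using value_T[OF g ab(1) 1] 1 True by simp
  next
    case (2 d)
    then have "\<not> isT a (e g a) g" using excl by blast
    moreover have "\<exists>d<n. d \<noteq> a \<and> isS a d g" using 2 by blast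
    then have "Cs a b g = 1" unfolding sumS by (simp only: if_True)
    ultimately show ?thesis unfolding sumT using value_S[OF g ab(1) 2(1) 2(2)[symmetric] 2(3)] True by simp
  next
    case 3
    then have "K a (n + a) g = 0" using xy_diagonal_support[OF g ab(1)] by blast
    moreover have "Cs a b g = 0" unfolding sumS using 3(2) by (simp only: if_False)
    ultimately show ?thesis unfolding sumT using 3(1) True by simp
  qed
next
  case False
  have 1: "(\<Sum>\<epsilon>\<in>roots_unity m. K 0 n (t_mat n 0 \<epsilon>) * Ct \<epsilon> a b g) = 0"
    using False Ct_eq(1)[OF ab _ g] by (intro sum.neutral) simp
  have 2: "Cs a b g = (if isS a b g then e g a else 0)" using Cs_eq(1)[OF ab g] False by simp
  have 3: "K b (n + b) g = K 0 n (sigma_mat n 0 1 1)" if "isS a b g"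
    using value_S[OF g ab(2,1) False[symmetric]] that isS_sym by blast
  show ?thesis unfolding xy_off_diagonal[OF g ab False] 1 2 using 3 by simp
qed

end

section \<open>The solution space, its basis and its dimension\<close>

context even_monomial_group begin

lemma bilinear_maps_subspace: "kvs.subspace (bilinear_maps m n)"
proof (rule kvs.subspaceI)
  show "0 \<in> bilinear_maps m n"
    unfolding bilinear_maps_def mem_Collect_eq by (simp add: fun_eq_iff)
  show "\<kappa> + \<kappa>' \<in> bilinear_maps m n" if k: "\<kappa> \<in> bilinear_maps m n" "\<kappa>' \<in> bilinear_maps m n" for \<kappa> \<kappa>'
    unfolding bilinear_maps_def mem_Collect_eq plus_fun_apply
    by (intro conjI ballI allI impI)
       (simp_all add: bilinear_mapsD[OF k(1)] bilinear_mapsD[OF k(2)] fun_eq_iff distrib_left)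
  show "kscale c \<kappa> \<in> bilinear_maps m n" if k: "\<kappa> \<in> bilinear_maps m n" for c \<kappa>
    unfolding bilinear_maps_def mem_Collect_eq kscale_def
    by (intro conjI ballI allI impI)
       (simp_all add: bilinear_mapsD[OF k] fun_eq_iff distrib_left mult.left_commute)
qed

lemma q_skew_mapsD:
  assumes "\<kappa> \<in> q_skew_maps m n" "i < 2 * n" "j < 2 * n"
  shows "\<kappa> (vb n i) (vb n j) g = - qpar n i j * \<kappa> (vb n j) (vb n i) g"
proof -
  have "\<kappa> (vb n i) (vb n j) = (\<lambda>g. - qpar n i j * \<kappa> (vb n j) (vb n i) g)"
    using assms unfolding q_skew_maps_def by blast
  then show ?thesis by (rule fun_cong)
qed

lemma q_skew_mapsI:
  assumes "\<kappa> \<in> bilinear_maps m n"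
    "\<And>i j g. i < 2 * n \<Longrightarrow> j < 2 * n \<Longrightarrow> \<kappa> (vb n i) (vb n j) g = - qpar n i j * \<kappa> (vb n j) (vb n i) g"
  shows "\<kappa> \<in> q_skew_maps m n"
  unfolding q_skew_maps_def mem_Collect_eq
proof (intro conjI allI impI ext)
  show "\<kappa> \<in> bilinear_maps m n" by (rule assms(1))
qed (rule assms(2))

lemma q_skew_bilinear: "\<kappa> \<in> q_skew_maps m n \<Longrightarrow> \<kappa> \<in> bilinear_maps m n"
  by (simp add: q_skew_maps_def)

lemma q_skew_subspace: "kvs.subspace (q_skew_maps m n)"
proof (rule kvs.subspaceI)
  show "0 \<in> q_skew_maps m n"
    using kvs.subspace_0[OF bilinear_maps_subspace] by (rule q_skew_mapsI) simp
  show "\<kappa> + \<kappa>' \<in> q_skew_maps m n" if k: "\<kappa> \<in> q_skew_maps m n" "\<kappa>' \<in> q_skew_maps m n" for \<kappa> \<kappa>'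
  proof (rule q_skew_mapsI)
    show "\<kappa> + \<kappa>' \<in> bilinear_maps m n"
      using k q_skew_bilinear by (intro kvs.subspace_add[OF bilinear_maps_subspace])
    show "(\<kappa> + \<kappa>') (vb n i) (vb n j) g = - qpar n i j * (\<kappa> + \<kappa>') (vb n j) (vb n i) g"
      if "i < 2 * n" "j < 2 * n" for i j g
      unfolding plus_fun_apply q_skew_mapsD[OF k(1) that] q_skew_mapsD[OF k(2) that] by (rule distrib_left[symmetric])
  qed
  show "kscale c \<kappa> \<in> q_skew_maps m n" if k: "\<kappa> \<in> q_skew_maps m n" for c \<kappa>
  proof (rule q_skew_mapsI)
    show "kscale c \<kappa> \<in> bilinear_maps m n"
      using k q_skew_bilinear by (intro kvs.subspace_scale[OF bilinear_maps_subspace])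
    show "kscale c \<kappa> (vb n i) (vb n j) g = - qpar n i j * kscale c \<kappa> (vb n j) (vb n i) g"
      if "i < 2 * n" "j < 2 * n" for i j g
      unfolding kscale_def q_skew_mapsD[OF k that] by (rule mult.left_commute)
  qed
qed

text \<open>The existence of a graded isomorphism is not visibly linear in \<kappa>, but
  \<open>eqv\<close> and \<open>jac\<close> are; both directions of the criterion are used.\<close>

lemma QDH_subspace: "kvs.subspace (QDH_maps m n)"
proof (rule kvs.subspaceI)
  have skew: "\<kappa> \<in> QDH_maps m n \<Longrightarrow> \<kappa> \<in> q_skew_maps m n" for \<kappa> by (simp add: QDH_maps_def)
  show "0 \<in> QDH_maps m n"
    using kvs.subspace_0[OF q_skew_subspace] by (rule QDH_mapsI) (auto simp: eqv_def jac_def)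
  show "\<kappa> + \<kappa>' \<in> QDH_maps m n" if k: "\<kappa> \<in> QDH_maps m n" "\<kappa>' \<in> QDH_maps m n" for \<kappa> \<kappa>'
  proof (rule QDH_mapsI)
    show "\<kappa> + \<kappa>' \<in> q_skew_maps m n" using k skew by (intro kvs.subspace_add[OF q_skew_subspace])
    show "eqv (\<lambda>i j. (\<kappa> + \<kappa>') (vb n i) (vb n j))"
      using QDH_conditions(1)[OF k(1)] QDH_conditions(1)[OF k(2)] unfolding eqv_def
      by (simp add: distrib_left del: Gm1n_simps)
    show "jac (\<lambda>i j. (\<kappa> + \<kappa>') (vb n i) (vb n j)) i j l h \<nu>"
      if "h \<in> carrier \<G>" "l < j" "j < i" "i < 2 * n" for h i j l \<nu>
    proof -
      have "j < 2 * n" "l < 2 * n" using that by auto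
      note J = QDH_conditions(2)[OF k(1) that(1,4) this, of \<nu>] QDH_conditions(2)[OF k(2) that(1,4) this, of \<nu>]
      have alg: "(x + x') * p + (y + y') * q + (z + z') * r = 0"
        if "x * p + y * q + z * r = 0" "x' * p + y' * q + z' * r = 0" for x x' y y' z z' p q r :: complex
      proof -
        have "(x + x') * p + (y + y') * q + (z + z') * r = (x * p + y * q + z * r) + (x' * p + y' * q + z' * r)"
          by (simp add: algebra_simps)
        with that show ?thesis by simp
      qed
      show ?thesis unfolding jac_def plus_fun_apply by (rule alg[OF J[unfolded jac_def]])
    qed
  qed
  show "kscale c \<kappa> \<in> QDH_maps m n" if k: "\<kappa> \<in> QDH_maps m n" for c \<kappa>
  proof (rule QDH_mapsI)
    show "kscale c \<kappa> \<in> q_skew_maps m n" using k skew by (intro kvs.subspace_scale[OF q_skew_subspace])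
    show "eqv (\<lambda>i j. kscale c \<kappa> (vb n i) (vb n j))"
      using QDH_conditions(1)[OF k] unfolding eqv_def kscale_def
      by (simp add: mult.left_commute[of _ c] del: Gm1n_simps)
    show "jac (\<lambda>i j. kscale c \<kappa> (vb n i) (vb n j)) i j l h \<nu>"
      if "h \<in> carrier \<G>" "l < j" "j < i" "i < 2 * n" for h i j l \<nu>
    proof -
      have "j < 2 * n" "l < 2 * n" using that by auto
      note J = QDH_conditions(2)[OF k that(1,4) this, of \<nu>]
      have alg: "c * x * p + c * y * q + c * z * r = 0" if "x * p + y * q + z * r = 0" for x y z p q r :: complex
      proof -
        have "c * x * p + c * y * q + c * z * r = c * (x * p + y * q + z * r)"
          by (simp add: algebra_simps)
        with that show ?thesis by simp
      qed
      show ?thesis unfolding jac_def kscale_def by (rule alg[OF J[unfolded jac_def]])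
    qed
  qed
qed

lemma basis_maps_QDH: "basis_maps m n \<subseteq> QDH_maps m n"
  using kappa_t_QDH kappa_sigma_QDH by (auto simp: basis_maps_def)

lemma QDH_in_span:
  assumes k: "\<kappa> \<in> QDH_maps m n"
  shows "\<kappa> \<in> kvs.span (basis_maps m n)"
proof -
  define K where "K i j = \<kappa> (vb n i) (vb n j)" for i j
  have skew: "\<kappa> \<in> q_skew_maps m n" using k by (simp add: QDH_maps_def)
  interpret kappa_solution m n K
    by unfold_locales (use QDH_conditions[OF k] in \<open>simp_all add: K_def [abs_def]\<close>)
  have K_skew: "K i j g = - qpar n i j * K j i g" if "i < 2 * n" "j < 2 * n" for i j g
    unfolding K_def using skew that by (rule q_skew_mapsD)
  have K_out: "K i j g = 0" if "g \<notin> carrier \<G>" for i j g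
    using quantum_data.k_outside[OF quantum_data_kmap[OF skew] that] by (simp add: K_def)
  have K_refl: "K i i g = 0" if "i < 2 * n" for i g
    using K_skew[OF that that, of g] by (simp add: qpar_def)
  \<comment> \<open>The candidate combination, with the coefficients from
    \<open>xy_value\<close>.\<close>
  define \<kappa>' where "\<kappa>' = (\<Sum>\<epsilon>\<in>roots_unity m. kscale (K 0 n (t_mat n 0 \<epsilon>)) (kappa_t n \<epsilon>))
      + kscale (K 0 n (sigma_mat n 0 1 1)) (kappa_sigma m n)"
  have span: "\<kappa>' \<in> kvs.span (basis_maps m n)"
    unfolding \<kappa>'_def by (intro kvs.span_add kvs.span_sum kvs.span_scale kvs.span_base) (auto simp: basis_maps_def)
  have "kvs.span (basis_maps m n) \<subseteq> QDH_maps m n"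
    using basis_maps_QDH QDH_subspace by (rule kvs.span_minimal)
  \<comment> \<open>Lying in the span of solutions makes \<kappa>' skew, so its values on the pairs
    y_a, x_b are determined by those on x_b, y_a.\<close>
  with span have skew': "\<kappa>' \<in> q_skew_maps m n" by (auto simp: QDH_maps_def)
  have val: "\<kappa>' (vb n i) (vb n j) g = (\<Sum>\<epsilon>\<in>roots_unity m. K 0 n (t_mat n 0 \<epsilon>) * xy_table n (Ct \<epsilon>) i j g)
      + K 0 n (sigma_mat n 0 1 1) * xy_table n Cs i j g" if "i < 2 * n" "j < 2 * n" for i j g
    unfolding \<kappa>'_def plus_fun_apply sum_fun_apply kscale_def kappa_t_eq kappa_sigma_eq xy_map_vb[OF that] ..
  have out: "\<kappa>' u w g = 0" if "g \<notin> carrier \<G>" for u w g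
    using bilinear_mapsD(5)[OF q_skew_bilinear[OF skew'] that] .
  have xy: "K a (n + b) g = \<kappa>' (vb n a) (vb n (n + b)) g" if "a < n" "b < n" for a b g
    using that xy_value[of g a b] K_out out by (cases "g \<in> carrier \<G>") (simp_all add: val)
  have skew_val: "\<kappa>' (vb n i) (vb n j) g = - qpar n i j * \<kappa>' (vb n j) (vb n i) g" if "i < 2 * n" "j < 2 * n" for i j g
    using skew' that by (rule q_skew_mapsD)
  have "\<kappa> (vb n i) (vb n j) g = \<kappa>' (vb n i) (vb n j) g" if "i < 2 * n" "j < 2 * n" for i j g
    unfolding K_def[symmetric] using that
  proof (elim less_2n_cases)
    fix a b assume *: "a < n" "i = a" "b < n" "j = b"
    then have "K a b g = 0" using xx_zero[of g a b] K_out K_refl[of a] by (cases "a = b"; cases "g \<in> carrier \<G>") auto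
    then show "K i j g = \<kappa>' (vb n i) (vb n j) g" using * by (simp add: val)
  next
    fix a b assume *: "a < n" "i = n + a" "b < n" "j = n + b"
    then have "K (n + a) (n + b) g = 0" using yy_zero[of g a b] K_out K_refl[of "n + a"] by (cases "a = b"; cases "g \<in> carrier \<G>") auto
    then show "K i j g = \<kappa>' (vb n i) (vb n j) g" using * by (simp add: val)
  next
    fix a b assume *: "a < n" "i = a" "b < n" "j = n + b"
    then show "K i j g = \<kappa>' (vb n i) (vb n j) g" using xy by simp
  next
    fix a b assume *: "a < n" "i = n + a" "b < n" "j = b"
    have "K i j g = - qpar n i j * K j i g" "\<kappa>' (vb n i) (vb n j) g = - qpar n i j * \<kappa>' (vb n j) (vb n i) g"
      using K_skew[OF that] skew_val[OF that] by auto
    then show "K i j g = \<kappa>' (vb n i) (vb n j) g" using xy[OF *(3,1)] * by simp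
  qed
  then have "\<kappa> = \<kappa>'"
    by (rule bilinear_maps_eqI[OF q_skew_bilinear[OF skew] q_skew_bilinear[OF skew']])
  with span show ?thesis by simp
qed

lemma span_basis_maps: "kvs.span (basis_maps m n) = QDH_maps m n"
proof
  show "kvs.span (basis_maps m n) \<subseteq> QDH_maps m n"
    using basis_maps_QDH QDH_subspace by (rule kvs.span_minimal)
qed (use QDH_in_span in blast)

lemma kappa_t_at_t:
  assumes "\<epsilon> \<in> roots_unity m" "\<epsilon>' \<in> roots_unity m"
  shows "kappa_t n \<epsilon> (vb n 0) (vb n n) (t_mat n 0 \<epsilon>') = (if \<epsilon> = \<epsilon>' then 1 else 0)"
proof -
  have n: "0 < n" using two_le by simp
  have r: "\<epsilon>' ^ m = 1" using assms(2) by (simp add: roots_unity_def)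
  have "xy_table n (Ct \<epsilon>) 0 n = Ct \<epsilon> 0 0" using xy_table_simps(2)[OF n n, of "Ct \<epsilon>"] by simp
  moreover have "Ct \<epsilon> 0 0 (t_mat n 0 \<epsilon>') = (if isT 0 \<epsilon> (t_mat n 0 \<epsilon>') then 1 else 0)"
    using Ct_eq(1)[OF n n assms(1) t_mat_props(1)[OF n r]] by simp
  moreover have "isT 0 \<epsilon> (t_mat n 0 \<epsilon>') \<longleftrightarrow> \<epsilon> = \<epsilon>'"
    using t_mat_props(2)[OF n r] n by (auto simp: isT_def)
  ultimately show ?thesis using n by (simp add: kappa_t_eq xy_map_vb)
qed

text \<open>On the off-diagonal pair x_0, y_1 only \<open>kappa_sigma\<close> is nonzero, and its
  coefficient at \<open>sigma_mat n 0 1 \<eta>\<close> is \<eta>, taken here at \<eta> = 1.\<close>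

lemma basis_maps_at_sigma:
  shows "\<epsilon> \<in> roots_unity m \<Longrightarrow> kappa_t n \<epsilon> (vb n 0) (vb n (n + 1)) (sigma_mat n 0 1 1) = 0"
    and "kappa_sigma m n (vb n 0) (vb n (n + 1)) (sigma_mat n 0 1 1) = 1"
proof -
  have n: "0 < n" "1 < n" using two_le by simp_all
  note \<sigma> = sigma_mat_props[OF n zero_neq_one power_one]
  have lt: "0 < 2 * n" "n + 1 < 2 * n" using n by simp_all
  show "kappa_t n \<epsilon> (vb n 0) (vb n (n + 1)) (sigma_mat n 0 1 1) = 0" if "\<epsilon> \<in> roots_unity m"
    using Ct_eq(1)[OF n that \<sigma>(1)] unfolding kappa_t_eq xy_map_vb[OF lt] xy_table_simps(2)[OF n] by simp
  show "kappa_sigma m n (vb n 0) (vb n (n + 1)) (sigma_mat n 0 1 1) = 1"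
    using Cs_eq(1)[OF n \<sigma>(1)] \<sigma>(2,3) unfolding kappa_sigma_eq xy_map_vb[OF lt] xy_table_simps(2)[OF n] by simp
qed

lemma kappa_t_inj: "inj_on (kappa_t n) (roots_unity m)"
proof (rule inj_onI)
  fix \<epsilon> \<epsilon>' assume *: "\<epsilon> \<in> roots_unity m" "\<epsilon>' \<in> roots_unity m" "kappa_t n \<epsilon> = kappa_t n \<epsilon>'"
  have "(if \<epsilon>' = \<epsilon> then 1 else 0) = (1 :: complex)"
    using kappa_t_at_t[OF *(1,1)] kappa_t_at_t[OF *(2,1)] unfolding *(3) by (simp only: refl if_True)
  then show "\<epsilon> = \<epsilon>'" by (simp split: if_splits)
qed

lemma kappa_sigma_notin: "kappa_sigma m n \<notin> kappa_t n ` roots_unity m"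
  using basis_maps_at_sigma by fastforce

lemma independent_basis_maps: "kvs.independent (basis_maps m n)"
proof (rule kvs.independent_if_scalars_zero)
  have fin: "finite (kappa_t n ` roots_unity m)" using finite_roots_unity_set by simp
  then show "finite (basis_maps m n)" by (simp add: basis_maps_def)
  fix f x assume sum: "(\<Sum>x\<in>basis_maps m n. kscale (f x) x) = 0" and x: "x \<in> basis_maps m n"
  have "(\<Sum>x\<in>basis_maps m n. kscale (f x) x)
      = kscale (f (kappa_sigma m n)) (kappa_sigma m n) + (\<Sum>\<epsilon>\<in>roots_unity m. kscale (f (kappa_t n \<epsilon>)) (kappa_t n \<epsilon>))"
    unfolding basis_maps_def using fin kappa_sigma_notin kappa_t_inj by (simp add: sum.reindex)
  with sum have 0: "f (kappa_sigma m n) * kappa_sigma m n u w g + (\<Sum>\<epsilon>\<in>roots_unity m. f (kappa_t n \<epsilon>) * kappa_t n \<epsilon> u w g) = 0" for u w g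
    by (simp add: fun_eq_iff sum_fun_apply kscale_def)
  \<comment> \<open>The coefficient of \<open>kappa_sigma\<close> is isolated first, at x_0, y_1.
    After that the pair x_0, y_0 at t_0^(\<epsilon>) isolates the coefficient of each
    \<open>kappa_t n \<epsilon>\<close>.\<close>
  have \<sigma>: "f (kappa_sigma m n) = 0"
    using 0[of "vb n 0" "vb n (n + 1)" "sigma_mat n 0 1 1"] basis_maps_at_sigma by simp
  have "f (kappa_t n \<epsilon>) = 0" if "\<epsilon> \<in> roots_unity m" for \<epsilon>
  proof -
    have "(\<Sum>\<epsilon>'\<in>roots_unity m. f (kappa_t n \<epsilon>') * kappa_t n \<epsilon>' (vb n 0) (vb n n) (t_mat n 0 \<epsilon>))
        = (\<Sum>\<epsilon>'\<in>roots_unity m. if \<epsilon>' = \<epsilon> then f (kappa_t n \<epsilon>) else 0)"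
      using that by (intro sum.cong) (auto simp: kappa_t_at_t)
    also have "\<dots> = f (kappa_t n \<epsilon>)" using that finite_roots_unity_set by simp
    finally show ?thesis using 0[of "vb n 0" "vb n n" "t_mat n 0 \<epsilon>"] \<sigma> by simp
  qed
  with \<sigma> x show "f x = 0" by (auto simp: basis_maps_def)
qed

lemma card_basis_maps: "card (basis_maps m n) = m + 1"
  using kappa_sigma_notin kappa_t_inj finite_roots_unity_set m_pos card_roots_unity_eq[of m]
  by (simp add: basis_maps_def card_image roots_unity_def)

lemma dim_QDH_maps: "kvs.dim (QDH_maps m n) = m + 1"
  using kvs.dim_eq_card[OF _ independent_basis_maps, of "QDH_maps m n"] card_basis_maps
    kvs.span_eq_iff[THEN iffD2, OF QDH_subspace] by (simp add: span_basis_maps)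

end

theorem theorem7p3:
  fixes m n :: nat
  assumes "even m" and "m > 0" and "n \<ge> 3"
  shows "kvs.subspace (QDH_maps m n) \<and>
    kvs.dim (QDH_maps m n) = m + 1 \<and>
    inj_on (kappa_t n) (roots_unity m) \<and>
    kappa_sigma m n \<notin> kappa_t n ` roots_unity m \<and>
    kvs.independent (basis_maps m n) \<and>
    kvs.span (basis_maps m n) = QDH_maps m n"
proof -
  interpret even_monomial_group m n by unfold_locales (use assms in auto)
  show ?thesis
    using QDH_subspace dim_QDH_maps kappa_t_inj kappa_sigma_notin independent_basis_maps span_basis_maps by blast
qed

end
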